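(* Continuous machines form a $\mathcal{W}_{\widetilde{\mathrm{Int}}}$-algebra $\mathsf{Mch}\colon\mathcal{W}_{\widetilde{\mathrm{Int}}}\to\mathbf{Cat}$.
   Context: Interval sheaves. $\mathrm{Int}$ is the category with objects $\ell\in\mathbb{R}_{\ge0}$, morphisms $\ell'\to\ell$ the translations $\mathrm{Tr}_p$ with $p\in\mathbb{R}_{\ge0}$, $p\le\ell-\ell'$, composition $\mathrm{Tr}_p\circ\mathrm{Tr}_{p'}=\mathrm{Tr}_{p+p'}$, identities $\mathrm{Tr}_0$. For a presheaf $X$ on $\mathrm{Int}$ and $x\in X(\ell)$, write $x|_{[p,p+\ell']}=X(\mathrm{Tr}_p)(x)$. A continuous interval sheaf is a presheaf $X$ on $\mathrm{Int}$ such that for all $x_1\in X(\ell_1)$, $x_2\in X(\ell_2)$ with $x_1|_{[\ell_1,\ell_1]}=x_2|_{[0,0]}$ there is a unique element of $X(\ell_1+\ell_2)$ restricting to $x_1$ on $[0,\ell_1]$ and to $x_2$ on $[\ell_1,\ell_1+\ell_2]$. $\widetilde{\mathrm{Int}}$ is the topos of such sheaves. Machines. For $A,B\in\widetilde{\mathrm{Int}}$, a continuous $(A,B)$-machine is a span $A\xleftarrow{p^{i}}S\xrightarrow{p^{o}}B$ in $\widetilde{\mathrm{Int}}$, equivalently a sheaf $S$ together with a sheaf map $p=(p^i,p^o)\colon S\to A\times B$; these form the category $\mathsf{Mch}(A,B)=\widetilde{\mathrm{Int}}/(A\times B)$. Wiring diagrams, with $\mathcal{C}=\widetilde{\mathrm{Int}}$.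 A $\mathcal{C}$-typed finite set is a finite set $X$ with $\tau\colon X\to\mathrm{ob}\,\mathcal{C}$; typed functions preserve types; $\widehat{X}=\prod_{x\in X}\tau(x)$. $\mathcal{W}_{\mathcal{C}}$ is the symmetric monoidal category whose objects (boxes) are pairs $X=(X^{\mathrm{in}},X^{\mathrm{out}})$ of $\mathcal{C}$-typed finite sets and whose morphisms (wiring diagrams) $\phi\colon X\to Y$ are pairs of typed functions $\phi^{\mathrm{in}}\colon X^{\mathrm{in}}\to X^{\mathrm{out}}+Y^{\mathrm{in}}$, $\phi^{\mathrm{out}}\colon Y^{\mathrm{out}}\to X^{\mathrm{out}}$. The composite $\omega=\psi\circ\phi$ has $\omega^{\mathrm{out}}=\phi^{\mathrm{out}}\circ\psi^{\mathrm{out}}$ and $\omega^{\mathrm{in}}=(\nabla+1)\circ(1+\phi^{\mathrm{out}}+1)\circ(1+\psi^{\mathrm{in}})\circ\phi^{\mathrm{in}}$, where $\nabla$ is the codiagonal; the identity is (coproduct inclusion, identity). The tensor $\oplus$ is componentwise disjoint union with unit $0=(\emptyset,\emptyset)$. A $\mathcal{W}_{\mathcal{C}}$-algebra is a symmetric lax monoidal functor $(\mathcal{W}_{\mathcal{C}},\oplus,0)\to(\mathbf{Cat},\times,\mathbf{1})$, in the pseudo sense (functoriality and monoidal axioms up to coherent natural isomorphism). That continuous machines form an algebra $\mathsf{Mch}$ means that the category it assigns to a box $X$ is $\mathsf{Mch}(X)=\mathsf{Mch}(\widehat{X^{\mathrm{in}}},\widehat{X^{\mathrm{out}}})$. *)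

theory Defs
  imports Complex_Main "HOL-Library.FuncSet"
begin

section \<open>Categories, functors, natural isomorphisms\<close>

record ('o, 'm) cat =
  Ob  :: "'o set"
  Ar  :: "'m set"
  Dom :: "'m \<Rightarrow> 'o"
  Cod :: "'m \<Rightarrow> 'o"
  Idn :: "'o \<Rightarrow> 'm"
  Cmp :: "'m \<Rightarrow> 'm \<Rightarrow> 'm"  (infixr "\<odot>\<index>" 55)

definition hom :: "('o, 'm, 'z) cat_scheme \<Rightarrow> 'o \<Rightarrow> 'o \<Rightarrow> 'm set" where
  "hom C a b = {f \<in> Ar C. Dom C f = a \<and> Cod C f = b}"

locale category =
  fixes C :: "('o, 'm, 'z) cat_scheme" (structure)
  assumes dom_ob: "f \<in> Ar C \<Longrightarrow> Dom C f \<in> Ob C"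
    and cod_ob: "f \<in> Ar C \<Longrightarrow> Cod C f \<in> Ob C"
    and idn_hom: "a \<in> Ob C \<Longrightarrow> Idn C a \<in> hom C a a"
    and cmp_hom: "\<lbrakk>f \<in> Ar C; g \<in> Ar C; Cod C f = Dom C g\<rbrakk> \<Longrightarrow> g \<odot> f \<in> hom C (Dom C f) (Cod C g)"
    and cmp_idn_right: "f \<in> Ar C \<Longrightarrow> f \<odot> Idn C (Dom C f) = f"
    and cmp_idn_left: "f \<in> Ar C \<Longrightarrow> Idn C (Cod C f) \<odot> f = f"
    and cmp_assoc: "\<lbrakk>f \<in> Ar C; g \<in> Ar C; h \<in> Ar C; Cod C f = Dom C g; Cod C g = Dom C h\<rbrakk>
      \<Longrightarrow> (h \<odot> g) \<odot> f = h \<odot> (g \<odot> f)"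

definition inverse_pair :: "('o, 'm, 'z) cat_scheme \<Rightarrow> 'm \<Rightarrow> 'm \<Rightarrow> bool" where
  "inverse_pair C f g \<longleftrightarrow> f \<in> Ar C \<and> g \<in> hom C (Cod C f) (Dom C f)
    \<and> g \<odot>\<^bsub>C\<^esub> f = Idn C (Dom C f) \<and> f \<odot>\<^bsub>C\<^esub> g = Idn C (Cod C f)"

definition is_iso :: "('o, 'm, 'z) cat_scheme \<Rightarrow> 'm \<Rightarrow> bool" where
  "is_iso C f \<longleftrightarrow> (\<exists>g. inverse_pair C f g)"

definition inv_ar :: "('o, 'm, 'z) cat_scheme \<Rightarrow> 'm \<Rightarrow> 'm" where
  "inv_ar C f = (THE g. inverse_pair C f g)"

record ('o, 'm, 'p, 'n) fctr =
  FOb :: "'o \<Rightarrow> 'p"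
  FAr :: "'m \<Rightarrow> 'n"

definition is_functor ::
  "('o, 'm, 'y) cat_scheme \<Rightarrow> ('p, 'n, 'z) cat_scheme \<Rightarrow> ('o, 'm, 'p, 'n) fctr \<Rightarrow> bool" where
  "is_functor C D F \<longleftrightarrow> category C \<and> category D
    \<and> (\<forall>a\<in>Ob C. FOb F a \<in> Ob D)
    \<and> (\<forall>f\<in>Ar C. FAr F f \<in> hom D (FOb F (Dom C f)) (FOb F (Cod C f)))
    \<and> (\<forall>a\<in>Ob C. FAr F (Idn C a) = Idn D (FOb F a))
    \<and> (\<forall>f\<in>Ar C. \<forall>g\<in>Ar C. Cod C f = Dom C g
          \<longrightarrow> FAr F (g \<odot>\<^bsub>C\<^esub> f) = FAr F g \<odot>\<^bsub>D\<^esub> FAr F f)"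

definition id_fctr :: "('o, 'm, 'o, 'm) fctr" where
  "id_fctr = \<lparr>FOb = id, FAr = id\<rparr>"

definition comp_fctr ::
  "('p, 'n, 'q, 'k) fctr \<Rightarrow> ('o, 'm, 'p, 'n) fctr \<Rightarrow> ('o, 'm, 'q, 'k) fctr"
  (infixr "\<circ>\<^sub>F" 55) where
  "G \<circ>\<^sub>F F = \<lparr>FOb = FOb G \<circ> FOb F, FAr = FAr G \<circ> FAr F\<rparr>"

definition nat_trans ::
  "('o, 'm, 'y) cat_scheme \<Rightarrow> ('p, 'n, 'z) cat_scheme \<Rightarrow> ('o, 'm, 'p, 'n) fctr
    \<Rightarrow> ('o, 'm, 'p, 'n) fctr \<Rightarrow> ('o \<Rightarrow> 'n) \<Rightarrow> bool" where
  "nat_trans C D F G \<eta> \<longleftrightarrow>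
      (\<forall>a\<in>Ob C. \<eta> a \<in> hom D (FOb F a) (FOb G a))
    \<and> (\<forall>f\<in>Ar C. \<eta> (Cod C f) \<odot>\<^bsub>D\<^esub> FAr F f = FAr G f \<odot>\<^bsub>D\<^esub> \<eta> (Dom C f))"

definition nat_iso ::
  "('o, 'm, 'y) cat_scheme \<Rightarrow> ('p, 'n, 'z) cat_scheme \<Rightarrow> ('o, 'm, 'p, 'n) fctr
    \<Rightarrow> ('o, 'm, 'p, 'n) fctr \<Rightarrow> ('o \<Rightarrow> 'n) \<Rightarrow> bool" where
  "nat_iso C D F G \<eta> \<longleftrightarrow> nat_trans C D F G \<eta> \<and> (\<forall>a\<in>Ob C. is_iso D (\<eta> a))"

definition op_cat :: "('o, 'm) cat \<Rightarrow> ('o, 'm) cat" where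
  "op_cat C = \<lparr>Ob = Ob C, Ar = Ar C, Dom = Cod C, Cod = Dom C, Idn = Idn C,
    Cmp = (\<lambda>g f. f \<odot>\<^bsub>C\<^esub> g)\<rparr>"

definition full_subcat :: "('o, 'm) cat \<Rightarrow> ('o \<Rightarrow> bool) \<Rightarrow> ('o, 'm) cat" where
  "full_subcat C P = C\<lparr>Ob := {a \<in> Ob C. P a}, Ar := {f \<in> Ar C. P (Dom C f) \<and> P (Cod C f)}\<rparr>"

text \<open>Functors and natural transformations are extensional here, so that two of them are equal
  as soon as they agree on the source category.\<close>

definition functor_cat ::
  "('o, 'm) cat \<Rightarrow> ('p, 'n) cat \<Rightarrow>
    (('o, 'm, 'p, 'n) fctr, ('o, 'm, 'p, 'n) fctr \<times> ('o \<Rightarrow> 'n) \<times> ('o, 'm, 'p, 'n) fctr) cat" where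
  "functor_cat C D =
    (let Fs = {F. is_functor C D F \<and> FOb F \<in> extensional (Ob C) \<and> FAr F \<in> extensional (Ar C)} in
     \<lparr>Ob = Fs,
      Ar = {(F, \<eta>, G). F \<in> Fs \<and> G \<in> Fs \<and> \<eta> \<in> extensional (Ob C) \<and> nat_trans C D F G \<eta>},
      Dom = (\<lambda>(F, \<eta>, G). F),
      Cod = (\<lambda>(F, \<eta>, G). G),
      Idn = (\<lambda>F. (F, \<lambda>a\<in>Ob C. Idn D (FOb F a), F)),
      Cmp = (\<lambda>(G', \<theta>, H) (F, \<eta>, G). (F, \<lambda>a\<in>Ob C. \<theta> a \<odot>\<^bsub>D\<^esub> \<eta> a, H))\<rparr>)"

definition slice_cat :: "('o, 'm) cat \<Rightarrow> 'o \<Rightarrow> ('m, 'm \<times> 'm \<times> 'm) cat" where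
  "slice_cat C c =
    \<lparr>Ob = {p \<in> Ar C. Cod C p = c},
     Ar = {(p, h, q). p \<in> Ar C \<and> Cod C p = c \<and> q \<in> Ar C \<and> Cod C q = c
            \<and> h \<in> hom C (Dom C p) (Dom C q) \<and> q \<odot>\<^bsub>C\<^esub> h = p},
     Dom = (\<lambda>(p, h, q). p),
     Cod = (\<lambda>(p, h, q). q),
     Idn = (\<lambda>p. (p, Idn C (Dom C p), p)),
     Cmp = (\<lambda>(q', k, r) (p, h, q). (p, k \<odot>\<^bsub>C\<^esub> h, r))\<rparr>"

definition one_cat :: "(unit, unit) cat" where
  "one_cat = \<lparr>Ob = UNIV, Ar = UNIV, Dom = id, Cod = id, Idn = id, Cmp = (\<lambda>_ _. ())\<rparr>"

definition prod_cat :: "('o, 'm) cat \<Rightarrow> ('p, 'n) cat \<Rightarrow> ('o \<times> 'p, 'm \<times> 'n) cat"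
  (infixr "\<times>\<^sub>C" 65) where
  "C \<times>\<^sub>C D =
    \<lparr>Ob = Ob C \<times> Ob D, Ar = Ar C \<times> Ar D,
     Dom = map_prod (Dom C) (Dom D), Cod = map_prod (Cod C) (Cod D),
     Idn = map_prod (Idn C) (Idn D),
     Cmp = (\<lambda>(g, g') (f, f'). (g \<odot>\<^bsub>C\<^esub> f, g' \<odot>\<^bsub>D\<^esub> f'))\<rparr>"

definition prod_fctr ::
  "('o, 'm, 'p, 'n) fctr \<Rightarrow> ('o', 'm', 'p', 'n') fctr \<Rightarrow> ('o \<times> 'o', 'm \<times> 'm', 'p \<times> 'p', 'n \<times> 'n') fctr"
  (infixr "\<times>\<^sub>F" 65) where
  "F \<times>\<^sub>F G = \<lparr>FOb = map_prod (FOb F) (FOb G), FAr = map_prod (FAr F) (FAr G)\<rparr>"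

definition fst_fctr :: "('o \<times> 'p, 'm \<times> 'n, 'o, 'm) fctr" where
  "fst_fctr = \<lparr>FOb = fst, FAr = fst\<rparr>"

definition snd_fctr :: "('o \<times> 'p, 'm \<times> 'n, 'p, 'n) fctr" where
  "snd_fctr = \<lparr>FOb = snd, FAr = snd\<rparr>"

definition swap_fctr :: "('o \<times> 'p, 'm \<times> 'n, 'p \<times> 'o, 'n \<times> 'm) fctr" where
  "swap_fctr = \<lparr>FOb = (\<lambda>(a, b). (b, a)), FAr = (\<lambda>(f, g). (g, f))\<rparr>"

definition assoc_fctr ::
  "(('o \<times> 'p) \<times> 'q, ('m \<times> 'n) \<times> 'k, 'o \<times> 'p \<times> 'q, 'm \<times> 'n \<times> 'k) fctr" where
  "assoc_fctr = \<lparr>FOb = (\<lambda>((a, b), c). (a, b, c)), FAr = (\<lambda>((f, g), h). (f, g, h))\<rparr>"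


section \<open>Symmetric monoidal categories\<close>

record ('o, 'm) smcat = "('o, 'm) cat" +
  Ten  :: "'o \<Rightarrow> 'o \<Rightarrow> 'o"  (infixr "\<oplus>\<index>" 65)
  TenA :: "'m \<Rightarrow> 'm \<Rightarrow> 'm"  (infixr "\<otimes>\<index>" 65)
  Unt  :: "'o"  ("\<zero>\<index>")
  Asc  :: "'o \<Rightarrow> 'o \<Rightarrow> 'o \<Rightarrow> 'm"
  Lun  :: "'o \<Rightarrow> 'm"
  Run  :: "'o \<Rightarrow> 'm"
  Brd  :: "'o \<Rightarrow> 'o \<Rightarrow> 'm"

locale symmetric_monoidal_category = category W
  for W :: "('o, 'm, 'z) smcat_scheme" (structure) +
  assumes ten_ob: "\<lbrakk>X \<in> Ob W; Y \<in> Ob W\<rbrakk> \<Longrightarrow> X \<oplus> Y \<in> Ob W"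
    and ten_hom: "\<lbrakk>f \<in> Ar W; g \<in> Ar W\<rbrakk> \<Longrightarrow> f \<otimes> g \<in> hom W (Dom W f \<oplus> Dom W g) (Cod W f \<oplus> Cod W g)"
    and ten_idn: "\<lbrakk>X \<in> Ob W; Y \<in> Ob W\<rbrakk> \<Longrightarrow> Idn W X \<otimes> Idn W Y = Idn W (X \<oplus> Y)"
    and ten_cmp: "\<lbrakk>f \<in> Ar W; f' \<in> Ar W; g \<in> Ar W; g' \<in> Ar W; Cod W f = Dom W f'; Cod W g = Dom W g'\<rbrakk>
      \<Longrightarrow> (f' \<odot> f) \<otimes> (g' \<odot> g) = (f' \<otimes> g') \<odot> (f \<otimes> g)"
    and unt_ob: "\<zero> \<in> Ob W"
    and asc_hom: "\<lbrakk>X \<in> Ob W; Y \<in> Ob W; Z \<in> Ob W\<rbrakk>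
      \<Longrightarrow> Asc W X Y Z \<in> hom W ((X \<oplus> Y) \<oplus> Z) (X \<oplus> (Y \<oplus> Z)) \<and> is_iso W (Asc W X Y Z)"
    and lun_hom: "X \<in> Ob W \<Longrightarrow> Lun W X \<in> hom W (\<zero> \<oplus> X) X \<and> is_iso W (Lun W X)"
    and run_hom: "X \<in> Ob W \<Longrightarrow> Run W X \<in> hom W (X \<oplus> \<zero>) X \<and> is_iso W (Run W X)"
    and brd_hom: "\<lbrakk>X \<in> Ob W; Y \<in> Ob W\<rbrakk>
      \<Longrightarrow> Brd W X Y \<in> hom W (X \<oplus> Y) (Y \<oplus> X) \<and> is_iso W (Brd W X Y)"
    and asc_nat: "\<lbrakk>f \<in> hom W X X'; g \<in> hom W Y Y'; h \<in> hom W Z Z'\<rbrakk>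
      \<Longrightarrow> Asc W X' Y' Z' \<odot> ((f \<otimes> g) \<otimes> h) = (f \<otimes> (g \<otimes> h)) \<odot> Asc W X Y Z"
    and lun_nat: "f \<in> hom W X X' \<Longrightarrow> Lun W X' \<odot> (Idn W \<zero> \<otimes> f) = f \<odot> Lun W X"
    and run_nat: "f \<in> hom W X X' \<Longrightarrow> Run W X' \<odot> (f \<otimes> Idn W \<zero>) = f \<odot> Run W X"
    and brd_nat: "\<lbrakk>f \<in> hom W X X'; g \<in> hom W Y Y'\<rbrakk>
      \<Longrightarrow> Brd W X' Y' \<odot> (f \<otimes> g) = (g \<otimes> f) \<odot> Brd W X Y"
    and pentagon: "\<lbrakk>X \<in> Ob W; Y \<in> Ob W; Z \<in> Ob W; V \<in> Ob W\<rbrakk>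
      \<Longrightarrow> Asc W X Y (Z \<oplus> V) \<odot> Asc W (X \<oplus> Y) Z V
        = (Idn W X \<otimes> Asc W Y Z V) \<odot> (Asc W X (Y \<oplus> Z) V \<odot> (Asc W X Y Z \<otimes> Idn W V))"
    and triangle: "\<lbrakk>X \<in> Ob W; Y \<in> Ob W\<rbrakk>
      \<Longrightarrow> Run W X \<otimes> Idn W Y = (Idn W X \<otimes> Lun W Y) \<odot> Asc W X \<zero> Y"
    and hexagon: "\<lbrakk>X \<in> Ob W; Y \<in> Ob W; Z \<in> Ob W\<rbrakk>
      \<Longrightarrow> Asc W Y Z X \<odot> (Brd W X (Y \<oplus> Z) \<odot> Asc W X Y Z)
        = (Idn W Y \<otimes> Brd W X Z) \<odot> (Asc W Y X Z \<odot> (Brd W X Y \<otimes> Idn W Z))"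
    and symmetry: "\<lbrakk>X \<in> Ob W; Y \<in> Ob W\<rbrakk> \<Longrightarrow> Brd W Y X \<odot> Brd W X Y = Idn W (X \<oplus> Y)"


section \<open>Symmetric lax monoidal pseudofunctors into the 2-category of categories\<close>

text \<open>For \<open>f : X \<rightarrow> Y\<close> in the source, write \<open>f\<^sub>*\<close> for the functor \<open>LAr F f : F X \<rightarrow> F Y\<close> and
  \<open>S \<box> T\<close> for the value of the laxator \<open>LTen F X Y : F X \<times> F Y \<rightarrow> F (X \<oplus> Y)\<close>.
  The remaining fields are the components of the structural isomorphisms:
  \<^item> \<open>LCmp F g f S : g\<^sub>* f\<^sub>* S \<rightarrow> (g f)\<^sub>* S\<close> and \<open>LIdn F X S : S \<rightarrow> (id\<^sub>X)\<^sub>* S\<close> (pseudofunctoriality);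
  \<^item> \<open>LTenA F f g (S, T) : f\<^sub>* S \<box> g\<^sub>* T \<rightarrow> (f \<otimes> g)\<^sub>* (S \<box> T)\<close> (pseudonaturality of the laxator);
  \<^item> \<open>LAsc\<close>, \<open>LLun\<close>, \<open>LRun\<close>, \<open>LBrd\<close>: the modifications that replace the associativity, unit and
    symmetry axioms of a lax monoidal functor.
  The functor \<open>LUnt F : 1 \<rightarrow> F 0\<close> is the unit.\<close>

record ('o, 'm, 'p, 'n) lax_data =
  LOb   :: "'o \<Rightarrow> ('p, 'n) cat"
  LAr   :: "'m \<Rightarrow> ('p, 'n, 'p, 'n) fctr"
  LCmp  :: "'m \<Rightarrow> 'm \<Rightarrow> 'p \<Rightarrow> 'n"
  LIdn  :: "'o \<Rightarrow> 'p \<Rightarrow> 'n"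
  LTen  :: "'o \<Rightarrow> 'o \<Rightarrow> ('p \<times> 'p, 'n \<times> 'n, 'p, 'n) fctr"
  LTenA :: "'m \<Rightarrow> 'm \<Rightarrow> 'p \<times> 'p \<Rightarrow> 'n"
  LUnt  :: "(unit, unit, 'p, 'n) fctr"
  LAsc  :: "'o \<Rightarrow> 'o \<Rightarrow> 'o \<Rightarrow> ('p \<times> 'p) \<times> 'p \<Rightarrow> 'n"
  LLun  :: "'o \<Rightarrow> unit \<times> 'p \<Rightarrow> 'n"
  LRun  :: "'o \<Rightarrow> 'p \<times> unit \<Rightarrow> 'n"
  LBrd  :: "'o \<Rightarrow> 'o \<Rightarrow> 'p \<times> 'p \<Rightarrow> 'n"

text \<open>The coherence axioms are equations between pasting composites of 2-cells, evaluated at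
  objects. A pasting diagram is evaluated at \<open>S \<in> F X\<close> to a triple \<open>(f, S, u)\<close> with
  \<open>f : X \<rightarrow> Y\<close> and \<open>u : f\<^sub>* S \<rightarrow> T\<close> in \<open>F Y\<close>. The operations \<open>paste\<close>, \<open>juxt\<close> and \<open>id_cell\<close> are
  vertical pasting, tensoring and identity; they insert the structural isomorphisms
  \<open>LCmp\<close>, \<open>LTenA\<close>, \<open>LIdn\<close> needed to make the boundaries match. \<open>push_cell\<close> is the identity
  2-cell on \<open>f\<^sub>*\<close>. Objects are paired with the object they lie over.\<close>

type_synonym ('m, 'p, 'n) cell = "'m \<times> 'p \<times> 'n"

context
  fixes W :: "('o, 'm, 'z) smcat_scheme" (structure)
    and F :: "('o, 'm, 'p, 'n) lax_data"
begin

definition paste :: "('m, 'p, 'n) cell \<Rightarrow> ('m, 'p, 'n) cell \<Rightarrow> ('m, 'p, 'n) cell" where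
  "paste = (\<lambda>(g, T, v) (f, S, u).
    (let D = LOb F (Cod W g) in
      (g \<odot> f, S, v \<odot>\<^bsub>D\<^esub> (FAr (LAr F g) u \<odot>\<^bsub>D\<^esub> inv_ar D (LCmp F g f S)))))"

definition juxt :: "('m, 'p, 'n) cell \<Rightarrow> ('m, 'p, 'n) cell \<Rightarrow> ('m, 'p, 'n) cell" where
  "juxt = (\<lambda>(f, S, u) (g, T, v).
    (let D = LOb F (Cod W f \<oplus> Cod W g) in
      (f \<otimes> g, FOb (LTen F (Dom W f) (Dom W g)) (S, T),
       FAr (LTen F (Cod W f) (Cod W g)) (u, v) \<odot>\<^bsub>D\<^esub> inv_ar D (LTenA F f g (S, T)))))"

definition id_cell :: "'o \<times> 'p \<Rightarrow> ('m, 'p, 'n) cell" where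
  "id_cell = (\<lambda>(X, S). (Idn W X, S, inv_ar (LOb F X) (LIdn F X S)))"

definition push_cell :: "'m \<Rightarrow> 'p \<Rightarrow> ('m, 'p, 'n) cell" where
  "push_cell f S = (f, S, Idn (LOb F (Cod W f)) (FOb (LAr F f) S))"

definition over :: "('o \<times> 'p) set" where
  "over = {(X, S). X \<in> Ob W \<and> S \<in> Ob (LOb F X)}"

definition push :: "'m \<Rightarrow> 'p \<Rightarrow> 'o \<times> 'p" where
  "push f S = (Cod W f, FOb (LAr F f) S)"

definition over_ten :: "'o \<times> 'p \<Rightarrow> 'o \<times> 'p \<Rightarrow> 'o \<times> 'p" where
  "over_ten = (\<lambda>(X, S) (Y, T). (X \<oplus> Y, FOb (LTen F X Y) (S, T)))"

definition over_unt :: "'o \<times> 'p" where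
  "over_unt = (\<zero>, FOb (LUnt F) ())"

definition asc_cell :: "'o \<times> 'p \<Rightarrow> 'o \<times> 'p \<Rightarrow> 'o \<times> 'p \<Rightarrow> ('m, 'p, 'n) cell" where
  "asc_cell = (\<lambda>(X, S) (Y, T) (Z, U).
    (Asc W X Y Z, snd (over_ten (over_ten (X, S) (Y, T)) (Z, U)), LAsc F X Y Z ((S, T), U)))"

definition lun_cell :: "'o \<times> 'p \<Rightarrow> ('m, 'p, 'n) cell" where
  "lun_cell = (\<lambda>(X, S). (Lun W X, snd (over_ten over_unt (X, S)), LLun F X ((), S)))"

definition run_cell :: "'o \<times> 'p \<Rightarrow> ('m, 'p, 'n) cell" where
  "run_cell = (\<lambda>(X, S). (Run W X, snd (over_ten (X, S) over_unt), LRun F X (S, ())))"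

definition brd_cell :: "'o \<times> 'p \<Rightarrow> 'o \<times> 'p \<Rightarrow> ('m, 'p, 'n) cell" where
  "brd_cell = (\<lambda>(X, S) (Y, T).
    (Brd W X Y, snd (over_ten (X, S) (Y, T)), LBrd F X Y (S, T)))"

end

locale symmetric_lax_monoidal_pseudofunctor = symmetric_monoidal_category W
  for W :: "('o, 'm, 'z) smcat_scheme" (structure) +
  fixes F :: "('o, 'm, 'p, 'n) lax_data"
  \<comment> \<open>pseudofunctor\<close>
  assumes fib_category: "X \<in> Ob W \<Longrightarrow> category (LOb F X)"
    and push_functor: "f \<in> hom W X Y \<Longrightarrow> is_functor (LOb F X) (LOb F Y) (LAr F f)"
    and push_cmp: "\<lbrakk>f \<in> hom W X Y; g \<in> hom W Y Z\<rbrakk>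
      \<Longrightarrow> nat_iso (LOb F X) (LOb F Z) (LAr F g \<circ>\<^sub>F LAr F f) (LAr F (g \<odot> f)) (LCmp F g f)"
    and push_idn: "X \<in> Ob W
      \<Longrightarrow> nat_iso (LOb F X) (LOb F X) id_fctr (LAr F (Idn W X)) (LIdn F X)"
    and push_cmp_assoc:
      "\<lbrakk>f \<in> hom W X Y; g \<in> hom W Y Z; h \<in> hom W Z V; S \<in> Ob (LOb F X)\<rbrakk>
      \<Longrightarrow> LCmp F h (g \<odot> f) S \<odot>\<^bsub>LOb F V\<^esub> FAr (LAr F h) (LCmp F g f S)
        = LCmp F (h \<odot> g) f S \<odot>\<^bsub>LOb F V\<^esub> LCmp F h g (FOb (LAr F f) S)"
    and push_cmp_idn_right:
      "\<lbrakk>f \<in> hom W X Y; S \<in> Ob (LOb F X)\<rbrakk>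
      \<Longrightarrow> LCmp F f (Idn W X) S \<odot>\<^bsub>LOb F Y\<^esub> FAr (LAr F f) (LIdn F X S)
        = Idn (LOb F Y) (FOb (LAr F f) S)"
    and push_cmp_idn_left:
      "\<lbrakk>f \<in> hom W X Y; S \<in> Ob (LOb F X)\<rbrakk>
      \<Longrightarrow> LCmp F (Idn W Y) f S \<odot>\<^bsub>LOb F Y\<^esub> LIdn F Y (FOb (LAr F f) S)
        = Idn (LOb F Y) (FOb (LAr F f) S)"
  \<comment> \<open>pseudonatural laxator, and unit\<close>
    and lax_functor: "\<lbrakk>X \<in> Ob W; Y \<in> Ob W\<rbrakk>
      \<Longrightarrow> is_functor (LOb F X \<times>\<^sub>C LOb F Y) (LOb F (X \<oplus> Y)) (LTen F X Y)"
    and lax_push: "\<lbrakk>f \<in> hom W X X'; g \<in> hom W Y Y'\<rbrakk>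
      \<Longrightarrow> nat_iso (LOb F X \<times>\<^sub>C LOb F Y) (LOb F (X' \<oplus> Y'))
            (LTen F X' Y' \<circ>\<^sub>F (LAr F f \<times>\<^sub>F LAr F g)) (LAr F (f \<otimes> g) \<circ>\<^sub>F LTen F X Y) (LTenA F f g)"
    and lax_push_cmp:
      "\<lbrakk>f \<in> hom W X X'; f' \<in> hom W X' X''; g \<in> hom W Y Y'; g' \<in> hom W Y' Y'';
        S \<in> Ob (LOb F X); T \<in> Ob (LOb F Y)\<rbrakk>
      \<Longrightarrow> LTenA F (f' \<odot> f) (g' \<odot> g) (S, T)
            \<odot>\<^bsub>LOb F (X'' \<oplus> Y'')\<^esub> FAr (LTen F X'' Y'') (LCmp F f' f S, LCmp F g' g T)
        = LCmp F (f' \<otimes> g') (f \<otimes> g) (FOb (LTen F X Y) (S, T))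
            \<odot>\<^bsub>LOb F (X'' \<oplus> Y'')\<^esub> (FAr (LAr F (f' \<otimes> g')) (LTenA F f g (S, T))
            \<odot>\<^bsub>LOb F (X'' \<oplus> Y'')\<^esub> LTenA F f' g' (FOb (LAr F f) S, FOb (LAr F g) T))"
    and lax_push_idn:
      "\<lbrakk>X \<in> Ob W; Y \<in> Ob W; S \<in> Ob (LOb F X); T \<in> Ob (LOb F Y)\<rbrakk>
      \<Longrightarrow> LTenA F (Idn W X) (Idn W Y) (S, T)
            \<odot>\<^bsub>LOb F (X \<oplus> Y)\<^esub> FAr (LTen F X Y) (LIdn F X S, LIdn F Y T)
        = LIdn F (X \<oplus> Y) (FOb (LTen F X Y) (S, T))"
    and unt_functor: "is_functor one_cat (LOb F \<zero>) (LUnt F)"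
  \<comment> \<open>associativity, unit and symmetry isomorphisms\<close>
    and asc_iso: "\<lbrakk>X \<in> Ob W; Y \<in> Ob W; Z \<in> Ob W\<rbrakk>
      \<Longrightarrow> nat_iso ((LOb F X \<times>\<^sub>C LOb F Y) \<times>\<^sub>C LOb F Z) (LOb F (X \<oplus> (Y \<oplus> Z)))
            (LAr F (Asc W X Y Z) \<circ>\<^sub>F LTen F (X \<oplus> Y) Z \<circ>\<^sub>F (LTen F X Y \<times>\<^sub>F id_fctr))
            (LTen F X (Y \<oplus> Z) \<circ>\<^sub>F (id_fctr \<times>\<^sub>F LTen F Y Z) \<circ>\<^sub>F assoc_fctr)
            (LAsc F X Y Z)"
    and lun_iso: "X \<in> Ob W
      \<Longrightarrow> nat_iso (one_cat \<times>\<^sub>C LOb F X) (LOb F X)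
            (LAr F (Lun W X) \<circ>\<^sub>F LTen F \<zero> X \<circ>\<^sub>F (LUnt F \<times>\<^sub>F id_fctr)) snd_fctr (LLun F X)"
    and run_iso: "X \<in> Ob W
      \<Longrightarrow> nat_iso (LOb F X \<times>\<^sub>C one_cat) (LOb F X)
            (LAr F (Run W X) \<circ>\<^sub>F LTen F X \<zero> \<circ>\<^sub>F (id_fctr \<times>\<^sub>F LUnt F)) fst_fctr (LRun F X)"
    and brd_iso: "\<lbrakk>X \<in> Ob W; Y \<in> Ob W\<rbrakk>
      \<Longrightarrow> nat_iso (LOb F X \<times>\<^sub>C LOb F Y) (LOb F (Y \<oplus> X))
            (LAr F (Brd W X Y) \<circ>\<^sub>F LTen F X Y) (LTen F Y X \<circ>\<^sub>F swap_fctr) (LBrd F X Y)"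
  \<comment> \<open>they are modifications\<close>
    and asc_modification:
      "\<lbrakk>f \<in> hom W X X'; g \<in> hom W Y Y'; h \<in> hom W Z Z';
        S \<in> Ob (LOb F X); T \<in> Ob (LOb F Y); U \<in> Ob (LOb F Z)\<rbrakk>
      \<Longrightarrow> paste W F (asc_cell W F (push W F f S) (push W F g T) (push W F h U))
            (juxt W F (juxt W F (push_cell W F f S) (push_cell W F g T)) (push_cell W F h U))
        = paste W F (juxt W F (push_cell W F f S) (juxt W F (push_cell W F g T) (push_cell W F h U)))
            (asc_cell W F (X, S) (Y, T) (Z, U))"
    and lun_modification:
      "\<lbrakk>f \<in> hom W X X'; S \<in> Ob (LOb F X)\<rbrakk>
      \<Longrightarrow> paste W F (lun_cell W F (push W F f S))
            (juxt W F (id_cell W F (over_unt W F)) (push_cell W F f S))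
        = paste W F (push_cell W F f S) (lun_cell W F (X, S))"
    and run_modification:
      "\<lbrakk>f \<in> hom W X X'; S \<in> Ob (LOb F X)\<rbrakk>
      \<Longrightarrow> paste W F (run_cell W F (push W F f S))
            (juxt W F (push_cell W F f S) (id_cell W F (over_unt W F)))
        = paste W F (push_cell W F f S) (run_cell W F (X, S))"
    and brd_modification:
      "\<lbrakk>f \<in> hom W X X'; g \<in> hom W Y Y'; S \<in> Ob (LOb F X); T \<in> Ob (LOb F Y)\<rbrakk>
      \<Longrightarrow> paste W F (brd_cell W F (push W F f S) (push W F g T))
            (juxt W F (push_cell W F f S) (push_cell W F g T))
        = paste W F (juxt W F (push_cell W F g T) (push_cell W F f S))
            (brd_cell W F (X, S) (Y, T))"
  \<comment> \<open>coherence\<close>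
    and pentagon_cell:
      "\<lbrakk>P \<in> over W F; Q \<in> over W F; R \<in> over W F; K \<in> over W F\<rbrakk>
      \<Longrightarrow> paste W F (asc_cell W F P Q (over_ten W F R K)) (asc_cell W F (over_ten W F P Q) R K)
        = paste W F (juxt W F (id_cell W F P) (asc_cell W F Q R K))
            (paste W F (asc_cell W F P (over_ten W F Q R) K)
              (juxt W F (asc_cell W F P Q R) (id_cell W F K)))"
    and triangle_cell:
      "\<lbrakk>P \<in> over W F; Q \<in> over W F\<rbrakk>
      \<Longrightarrow> juxt W F (run_cell W F P) (id_cell W F Q)
        = paste W F (juxt W F (id_cell W F P) (lun_cell W F Q)) (asc_cell W F P (over_unt W F) Q)"
    and hexagon_cell:
      "\<lbrakk>P \<in> over W F; Q \<in> over W F; R \<in> over W F\<rbrakk>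
      \<Longrightarrow> paste W F (asc_cell W F Q R P)
            (paste W F (brd_cell W F P (over_ten W F Q R)) (asc_cell W F P Q R))
        = paste W F (juxt W F (id_cell W F Q) (brd_cell W F P R))
            (paste W F (asc_cell W F Q P R) (juxt W F (brd_cell W F P Q) (id_cell W F R)))"
    and symmetry_cell:
      "\<lbrakk>P \<in> over W F; Q \<in> over W F\<rbrakk>
      \<Longrightarrow> paste W F (brd_cell W F Q P) (brd_cell W F P Q) = id_cell W F (over_ten W F P Q)"


section \<open>Typed finite sets and wiring diagrams\<close>

text \<open>The elements of the finite sets come from the closure of an arbitrary type under formal
  disjoint union, so that the disjoint union of two such sets is again one.\<close>

datatype 'i lbl = Pt 'i | InL "'i lbl" | InR "'i lbl"

fun lcase :: "('i lbl \<Rightarrow> 'b) \<Rightarrow> ('i lbl \<Rightarrow> 'b) \<Rightarrow> 'i lbl \<Rightarrow> 'b" where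
  "lcase f g (InL x) = f x"
| "lcase f g (InR y) = g y"
| "lcase f g (Pt i) = undefined"

definition lplus :: "('i lbl \<Rightarrow> 'i lbl) \<Rightarrow> ('i lbl \<Rightarrow> 'i lbl) \<Rightarrow> 'i lbl \<Rightarrow> 'i lbl" where
  "lplus f g = lcase (InL \<circ> f) (InR \<circ> g)"

record ('i, 'o) tset =
  Elts :: "'i lbl set"
  Typ  :: "'i lbl \<Rightarrow> 'o"

definition is_tset :: "('o, 'm, 'z) cat_scheme \<Rightarrow> ('i, 'o) tset \<Rightarrow> bool" where
  "is_tset C X \<longleftrightarrow> finite (Elts X) \<and> Typ X \<in> Elts X \<rightarrow>\<^sub>E Ob C"

definition typed_fun :: "('i, 'o) tset \<Rightarrow> ('i lbl \<Rightarrow> 'i lbl) \<Rightarrow> ('i, 'o) tset \<Rightarrow> bool" where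
  "typed_fun X f Y \<longleftrightarrow> f \<in> Elts X \<rightarrow>\<^sub>E Elts Y \<and> (\<forall>x\<in>Elts X. Typ Y (f x) = Typ X x)"

definition tsum :: "('i, 'o) tset \<Rightarrow> ('i, 'o) tset \<Rightarrow> ('i, 'o) tset" where
  "tsum X Y = \<lparr>Elts = InL ` Elts X \<union> InR ` Elts Y, Typ = lcase (Typ X) (Typ Y)\<rparr>"

definition tempty :: "('i, 'o) tset" where
  "tempty = \<lparr>Elts = {}, Typ = (\<lambda>_. undefined)\<rparr>"

record ('i, 'o) box =
  Inp :: "('i, 'o) tset"
  Out :: "('i, 'o) tset"

definition is_box :: "('o, 'm, 'z) cat_scheme \<Rightarrow> ('i, 'o) box \<Rightarrow> bool" where
  "is_box C X \<longleftrightarrow> is_tset C (Inp X) \<and> is_tset C (Out X)"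

record ('i, 'o) wiring =
  wdom :: "('i, 'o) box"
  wcod :: "('i, 'o) box"
  win  :: "'i lbl \<Rightarrow> 'i lbl"
  wout :: "'i lbl \<Rightarrow> 'i lbl"

definition is_wiring :: "('o, 'm, 'z) cat_scheme \<Rightarrow> ('i, 'o) wiring \<Rightarrow> bool" where
  "is_wiring C f \<longleftrightarrow> is_box C (wdom f) \<and> is_box C (wcod f)
    \<and> typed_fun (Inp (wdom f)) (win f) (tsum (Out (wdom f)) (Inp (wcod f)))
    \<and> typed_fun (Out (wcod f)) (wout f) (Out (wdom f))"

definition mk_wiring ::
  "('i, 'o) box \<Rightarrow> ('i, 'o) box \<Rightarrow> ('i lbl \<Rightarrow> 'i lbl) \<Rightarrow> ('i lbl \<Rightarrow> 'i lbl) \<Rightarrow> ('i, 'o) wiring" where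
  "mk_wiring X Y a b =
    \<lparr>wdom = X, wcod = Y, win = restrict a (Elts (Inp X)), wout = restrict b (Elts (Out Y))\<rparr>"

text \<open>\<open>lcase InL id : A + (A + B) \<rightarrow> A + B\<close> is \<open>\<nabla> + 1\<close> after reassociation.\<close>

definition wiring_comp :: "('i, 'o) wiring \<Rightarrow> ('i, 'o) wiring \<Rightarrow> ('i, 'o) wiring" where
  "wiring_comp g f = mk_wiring (wdom f) (wcod g)
    (lcase InL id \<circ> lplus id (lplus (wout f) id) \<circ> lplus id (win g) \<circ> win f)
    (wout f \<circ> wout g)"

definition box_sum :: "('i, 'o) box \<Rightarrow> ('i, 'o) box \<Rightarrow> ('i, 'o) box" where
  "box_sum X Y = \<lparr>Inp = tsum (Inp X) (Inp Y), Out = tsum (Out X) (Out Y)\<rparr>"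

text \<open>On inputs, the disjoint union of \<open>f\<close> and \<open>g\<close> is followed by the interchange
  \<open>(A + B) + (A' + B') \<rightarrow> (A + A') + (B + B')\<close>.\<close>

definition wiring_sum :: "('i, 'o) wiring \<Rightarrow> ('i, 'o) wiring \<Rightarrow> ('i, 'o) wiring" where
  "wiring_sum f g = mk_wiring (box_sum (wdom f) (wdom g)) (box_sum (wcod f) (wcod g))
    (lcase (lplus InL InL \<circ> win f) (lplus InR InR \<circ> win g))
    (lplus (wout f) (wout g))"

definition lassoc :: "'i lbl \<Rightarrow> 'i lbl" where
  "lassoc = lcase (lcase InL (InR \<circ> InL)) (InR \<circ> InR)"

definition lassoc' :: "'i lbl \<Rightarrow> 'i lbl" where
  "lassoc' = lcase (InL \<circ> InL) (lcase (InL \<circ> InR) InR)"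

definition wiring_cat :: "('o, 'm, 'z) cat_scheme \<Rightarrow> (('i, 'o) box, ('i, 'o) wiring) smcat" where
  "wiring_cat C =
    \<lparr>Ob = {X. is_box C X},
     Ar = {f. is_wiring C f},
     Dom = wdom,
     Cod = wcod,
     Idn = (\<lambda>X. mk_wiring X X InR id),
     Cmp = wiring_comp,
     Ten = box_sum,
     TenA = wiring_sum,
     Unt = \<lparr>Inp = tempty, Out = tempty\<rparr>,
     Asc = (\<lambda>X Y Z. mk_wiring (box_sum (box_sum X Y) Z) (box_sum X (box_sum Y Z))
                     (InR \<circ> lassoc) lassoc'),
     Lun = (\<lambda>X. mk_wiring (box_sum \<lparr>Inp = tempty, Out = tempty\<rparr> X) X
                     (InR \<circ> lcase (\<lambda>_. undefined) id) InR),
     Run = (\<lambda>X. mk_wiring (box_sum X \<lparr>Inp = tempty, Out = tempty\<rparr>) X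
                     (InR \<circ> lcase id (\<lambda>_. undefined)) InL),
     Brd = (\<lambda>X Y. mk_wiring (box_sum X Y) (box_sum Y X)
                     (InR \<circ> lcase InR InL) (lcase InR InL))\<rparr>"

definition wiring_algebra ::
  "('o, 'm, 'z) cat_scheme \<Rightarrow> (('i, 'o) box, ('i, 'o) wiring, 'p, 'n) lax_data \<Rightarrow> bool" where
  "wiring_algebra C F \<longleftrightarrow> symmetric_lax_monoidal_pseudofunctor (wiring_cat C) F"


section \<open>Continuous interval sheaves\<close>

text \<open>The translation \<open>Tr\<^sub>p : l' \<rightarrow> l\<close> is the triple \<open>(l', p, l)\<close>.\<close>

definition int_cat :: "(real, real \<times> real \<times> real) cat" where
  "int_cat =
    \<lparr>Ob = {l. 0 \<le> l},
     Ar = {(l', p, l). 0 \<le> l' \<and> 0 \<le> l \<and> 0 \<le> p \<and> p \<le> l - l'},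
     Dom = (\<lambda>(l', p, l). l'),
     Cod = (\<lambda>(l', p, l). l),
     Idn = (\<lambda>l. (l, 0, l)),
     Cmp = (\<lambda>(l', p, l) (l'', p', m). (l'', p + p', l))\<rparr>"

text \<open>Sets are the sets of elements of a type that is closed under pairs and under families
  indexed by sets of labels; this provides finite products. The type \<open>'a\<close> of atoms is arbitrary.\<close>

datatype ('i, 'a) elt =
  Atom 'a | Two "('i, 'a) elt" "('i, 'a) elt" | Fam "'i lbl \<Rightarrow> ('i, 'a) elt option"

definition set_cat :: "('u set, 'u set \<times> ('u \<Rightarrow> 'u) \<times> 'u set) cat" where
  "set_cat =
    \<lparr>Ob = UNIV,
     Ar = {(A, f, B). f \<in> A \<rightarrow>\<^sub>E B},
     Dom = (\<lambda>(A, f, B). A),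
     Cod = (\<lambda>(A, f, B). B),
     Idn = (\<lambda>A. (A, \<lambda>x\<in>A. x, A)),
     Cmp = (\<lambda>(B', g, D) (A, f, B). (A, compose A g f, D))\<rparr>"

type_synonym 'u psh =
  "(real, real \<times> real \<times> real, 'u set, 'u set \<times> ('u \<Rightarrow> 'u) \<times> 'u set) fctr"

type_synonym 'u psh_map =
  "'u psh \<times> (real \<Rightarrow> 'u set \<times> ('u \<Rightarrow> 'u) \<times> 'u set) \<times> 'u psh"

definition psh_cat :: "('u psh, 'u psh_map) cat" where
  "psh_cat = functor_cat (op_cat int_cat) set_cat"

text \<open>\<open>restr X (l', p, l) x\<close> is the restriction of \<open>x \<in> X(l)\<close> to \<open>[p, p + l']\<close>.\<close>

definition restr :: "'u psh \<Rightarrow> real \<times> real \<times> real \<Rightarrow> 'u \<Rightarrow> 'u" where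
  "restr X t = (case FAr X t of (A, f, B) \<Rightarrow> f)"

definition is_interval_sheaf :: "'u psh \<Rightarrow> bool" where
  "is_interval_sheaf X \<longleftrightarrow>
    (\<forall>l\<^sub>1\<ge>0. \<forall>l\<^sub>2\<ge>0. \<forall>x\<^sub>1\<in>FOb X l\<^sub>1. \<forall>x\<^sub>2\<in>FOb X l\<^sub>2.
      restr X (0, l\<^sub>1, l\<^sub>1) x\<^sub>1 = restr X (0, 0, l\<^sub>2) x\<^sub>2 \<longrightarrow>
      (\<exists>!x. x \<in> FOb X (l\<^sub>1 + l\<^sub>2)
        \<and> restr X (l\<^sub>1, 0, l\<^sub>1 + l\<^sub>2) x = x\<^sub>1 \<and> restr X (l\<^sub>2, l\<^sub>1, l\<^sub>1 + l\<^sub>2) x = x\<^sub>2))"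

definition int_sheaves :: "('u psh, 'u psh_map) cat" where
  "int_sheaves = full_subcat psh_cat is_interval_sheaf"


section \<open>Products of interval sheaves; continuous machines\<close>

definition mk_psh :: "(real \<Rightarrow> 'u set) \<Rightarrow> (real \<times> real \<times> real \<Rightarrow> 'u \<Rightarrow> 'u) \<Rightarrow> 'u psh" where
  "mk_psh A r =
    \<lparr>FOb = restrict A (Ob int_cat),
     FAr = (\<lambda>t\<in>Ar int_cat. (A (Cod int_cat t), restrict (r t) (A (Cod int_cat t)), A (Dom int_cat t)))\<rparr>"

definition psh_times :: "('i, 'a) elt psh \<Rightarrow> ('i, 'a) elt psh \<Rightarrow> ('i, 'a) elt psh" where
  "psh_times A B = mk_psh
    (\<lambda>l. {Two x y | x y. x \<in> FOb A l \<and> y \<in> FOb B l})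
    (\<lambda>t z. case z of Two x y \<Rightarrow> Two (restr A t x) (restr B t y))"

text \<open>\<open>tset_prod X\<close> is the product of the types of the elements of \<open>X\<close>; the family \<open>Fam s\<close> is
  defined exactly on \<open>X\<close>.\<close>

definition tset_prod :: "('i, ('i, 'a) elt psh) tset \<Rightarrow> ('i, 'a) elt psh" where
  "tset_prod X = mk_psh
    (\<lambda>l. {Fam s | s. dom s = Elts X \<and> (\<forall>i\<in>Elts X. the (s i) \<in> FOb (Typ X i) l)})
    (\<lambda>t z. case z of Fam s \<Rightarrow> Fam (\<lambda>i. map_option (restr (Typ X i) t) (s i)))"

type_synonym ('i, 'a) machine = "('i, 'a) elt psh_map"

type_synonym ('i, 'a) machine_map =
  "('i, 'a) elt psh_map \<times> ('i, 'a) elt psh_map \<times> ('i, 'a) elt psh_map"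

definition machines ::
  "('i, 'a) elt psh \<Rightarrow> ('i, 'a) elt psh \<Rightarrow> (('i, 'a) machine, ('i, 'a) machine_map) cat" where
  "machines A B = slice_cat int_sheaves (psh_times A B)"

definition box_machines ::
  "('i, ('i, 'a) elt psh) box \<Rightarrow> (('i, 'a) machine, ('i, 'a) machine_map) cat" where
  "box_machines X = machines (tset_prod (Inp X)) (tset_prod (Out X))"

end

theory Submission
  imports Defs
begin

text \<open>A wiring diagram \<open>f : X \<rightarrow> Y\<close> acts on a machine \<open>S\<close> over \<open>X\<close> by a pullback. A state of \<open>f\<^sub>* S\<close>
  (here \<open>wired f S\<close>) is a pair of a state \<open>s\<close> of \<open>S\<close> and an input signal \<open>y\<close> for the outer box \<open>Y\<close>,
  subject to the feedback equation: the input that \<open>S\<close> reads in state \<open>s\<close> is the one that \<open>f\<close>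
  assembles from the output of \<open>s\<close> and from \<open>y\<close>. Two machines are placed side by side by taking
  the product of their state sheaves, and the unit is the terminal sheaf. All of this happens
  separately at each length, and restriction acts componentwise; the only point where the sheaf
  condition needs thought is the feedback equation, which holds on a glued interval as soon as it
  holds on both pieces, because a signal is determined by its restrictions to them (\<open>wired_ob\<close>).

  The structural isomorphisms exist because intermediate signals carry no information. A state of
  \<open>g\<^sub>* f\<^sub>* S\<close> is a triple \<open>((s, y), z)\<close> in which \<open>y\<close> is what \<open>g\<close> assembles from the output of \<open>f\<^sub>* S\<close> and
  from \<open>z\<close>, so that forgetting \<open>y\<close> is a bijection onto the states of \<open>(g f)\<^sub>* S\<close>; in the same way
  the signal in a state of \<open>id\<^sub>* S\<close> repeats the input of \<open>S\<close>, and a signal on a disjoint union of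
  boxes is a pair of signals. A map of machines that is bijective on states is invertible
  (\<open>acts_bij\<close>), which gives \<open>cmp_arrow\<close>, \<open>idn_arrow\<close>, \<open>interchange_arrow\<close> and, for wirings that merely
  rename wires, \<open>wired_relabel_iso\<close>.

  Coherence is then a matter of bookkeeping. A map of machines is determined by its function on
  states (\<open>acts_eqI\<close>). Every structural map, and its inverse, is given by an explicit rearrangement of
  tuples, and the rearrangement performed by a composite, by a pasting of cells and by a
  tensor of cells can be read off from those of its parts (\<open>acts_cmp\<close>, \<open>cell_paste\<close>, \<open>cell_juxt\<close>). Each
  coherence axiom therefore splits into an equation between wiring diagrams, which is the corresponding
  axiom of the symmetric monoidal category of wiring diagrams, and an equation between two
  rearrangements of tuples, which is evident.\<close>

section \<open>Categories\<close>

lemma hom_iff: "f \<in> hom C a b \<longleftrightarrow> f \<in> Ar C \<and> Dom C f = a \<and> Cod C f = b"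
  by (auto simp: hom_def)

lemma category_op_cat:
  assumes "category C"
  shows "category (op_cat C)"
proof -
  interpret category C by fact
  show ?thesis
    by unfold_locales
      (use dom_ob cod_ob idn_hom cmp_hom cmp_idn_right cmp_idn_left cmp_assoc
        in \<open>auto simp: op_cat_def hom_iff\<close>)
qed

lemma category_full_subcat:
  assumes "category C"
  shows "category (full_subcat C P)"
proof -
  interpret category C by fact
  show ?thesis
    by unfold_locales
      (use dom_ob cod_ob idn_hom cmp_hom cmp_idn_right cmp_idn_left cmp_assoc
        in \<open>auto simp: full_subcat_def hom_iff\<close>)
qed

lemma category_one_cat: "category one_cat"
  by unfold_locales (auto simp: one_cat_def hom_iff)

lemma category_prod_cat:
  assumes "category C" "category D"
  shows "category (C \<times>\<^sub>C D)"
proof -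
  interpret C: category C by fact
  interpret D: category D by fact
  show ?thesis
    by unfold_locales
      (use C.dom_ob C.cod_ob C.idn_hom C.cmp_hom C.cmp_idn_right C.cmp_idn_left C.cmp_assoc
        D.dom_ob D.cod_ob D.idn_hom D.cmp_hom D.cmp_idn_right D.cmp_idn_left D.cmp_assoc
        in \<open>auto simp: prod_cat_def hom_iff\<close>)
qed

lemma category_slice_cat:
  assumes "category C"
  shows "category (slice_cat C c)"
proof -
  interpret category C by fact
  show ?thesis
    apply unfold_locales
    subgoal by (auto simp: slice_cat_def)
    subgoal by (auto simp: slice_cat_def)
    subgoal by (use dom_ob idn_hom cmp_idn_right in \<open>auto simp: slice_cat_def hom_iff\<close>)
    subgoal for f g
    proof -
      assume "f \<in> Ar (slice_cat C c)" "g \<in> Ar (slice_cat C c)"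
        "Cod (slice_cat C c) f = Dom (slice_cat C c) g"
      then obtain p h q k r where "f = (p, h, q)" "g = (q, k, r)" "p \<in> Ar C" "q \<in> Ar C" "r \<in> Ar C"
        "h \<in> hom C (Dom C p) (Dom C q)" "k \<in> hom C (Dom C q) (Dom C r)" "q \<odot>\<^bsub>C\<^esub> h = p" "r \<odot>\<^bsub>C\<^esub> k = q"
        "Cod C p = c" "Cod C r = c"
        by (auto simp: slice_cat_def)
      moreover have "r \<odot>\<^bsub>C\<^esub> (k \<odot>\<^bsub>C\<^esub> h) = (r \<odot>\<^bsub>C\<^esub> k) \<odot>\<^bsub>C\<^esub> h"
        using cmp_assoc[of h k r] calculation by (simp add: hom_iff)
      ultimately show ?thesis
        using cmp_hom[of h k] by (simp add: slice_cat_def hom_iff)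
    qed
    subgoal by (clarsimp simp: slice_cat_def hom_iff) (metis cmp_idn_right)
    subgoal by (clarsimp simp: slice_cat_def hom_iff) (metis cmp_idn_left)
    subgoal by (use cmp_assoc in \<open>auto simp: slice_cat_def hom_iff\<close>)
    done
qed

lemma category_functor_cat:
  fixes C :: "('o, 'm) cat" and D :: "('p, 'n) cat" (structure)
  assumes C: "category C" and D: "category D"
  shows "category (functor_cat C D)"
proof -
  interpret C: category C by fact
  interpret D: category D by fact
  show ?thesis
    apply unfold_locales
    subgoal by (auto simp: functor_cat_def Let_def)
    subgoal by (auto simp: functor_cat_def Let_def)
    subgoal for F
    proof -
      assume "F \<in> Ob (functor_cat C D)"
      then have F: "is_functor C D F" "FOb F \<in> extensional (Ob C)" "FAr F \<in> extensional (Ar C)"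
        by (auto simp: functor_cat_def Let_def)
      have "nat_trans C D F F (\<lambda>a\<in>Ob C. Idn D (FOb F a))"
        unfolding nat_trans_def
      proof (intro conjI ballI)
        fix a assume "a \<in> Ob C"
        then show "(\<lambda>a\<in>Ob C. Idn D (FOb F a)) a \<in> hom D (FOb F a) (FOb F a)"
          using F D.idn_hom by (auto simp: is_functor_def)
      next
        fix k assume k: "k \<in> Ar C"
        then have "FAr F k \<in> hom D (FOb F (Dom C k)) (FOb F (Cod C k))"
          using F by (auto simp: is_functor_def)
        then show "(\<lambda>a\<in>Ob C. Idn D (FOb F a)) (Cod C k) \<odot> FAr F k
            = FAr F k \<odot> (\<lambda>a\<in>Ob C. Idn D (FOb F a)) (Dom C k)"
          using D.cmp_idn_left[of "FAr F k"] D.cmp_idn_right[of "FAr F k"] k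
          by (simp add: C.dom_ob C.cod_ob hom_iff)
      qed
      then show ?thesis
        using F by (simp add: functor_cat_def Let_def hom_iff)
    qed
    subgoal for f g
    proof -
      assume "f \<in> Ar (functor_cat C D)" "g \<in> Ar (functor_cat C D)"
        "Cod (functor_cat C D) f = Dom (functor_cat C D) g"
      then obtain F G H \<eta> \<theta> where fg: "f = (F, \<eta>, G)" "g = (G, \<theta>, H)"
        and F: "is_functor C D F" and G: "is_functor C D G" and H: "is_functor C D H"
        and ext: "FOb F \<in> extensional (Ob C)" "FAr F \<in> extensional (Ar C)"
          "FOb H \<in> extensional (Ob C)" "FAr H \<in> extensional (Ar C)"
        and n: "nat_trans C D F G \<eta>" "nat_trans C D G H \<theta>"
        by (cases f; cases g) (auto simp: functor_cat_def Let_def)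
      have "nat_trans C D F H (\<lambda>a\<in>Ob C. \<theta> a \<odot> \<eta> a)"
        unfolding nat_trans_def
      proof (intro conjI ballI)
        fix a assume "a \<in> Ob C"
        then show "(\<lambda>a\<in>Ob C. \<theta> a \<odot> \<eta> a) a \<in> hom D (FOb F a) (FOb H a)"
          using n D.cmp_hom by (auto simp: nat_trans_def hom_iff)
      next
        fix k assume k: "k \<in> Ar C"
        note [simp] = C.dom_ob[OF k] C.cod_ob[OF k]
        have F1: "FAr F k \<in> hom D (FOb F (Dom C k)) (FOb F (Cod C k))"
          and G1: "FAr G k \<in> hom D (FOb G (Dom C k)) (FOb G (Cod C k))"
          and H1: "FAr H k \<in> hom D (FOb H (Dom C k)) (FOb H (Cod C k))"
          using F G H k by (auto simp: is_functor_def)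
        have nn: "\<And>a. a \<in> Ob C \<Longrightarrow> \<eta> a \<in> hom D (FOb F a) (FOb G a)"
          "\<And>a. a \<in> Ob C \<Longrightarrow> \<theta> a \<in> hom D (FOb G a) (FOb H a)"
          "\<eta> (Cod C k) \<odot> FAr F k = FAr G k \<odot> \<eta> (Dom C k)"
          "\<theta> (Cod C k) \<odot> FAr G k = FAr H k \<odot> \<theta> (Dom C k)"
          using n k by (auto simp: nat_trans_def)
        have "(\<theta> (Cod C k) \<odot> \<eta> (Cod C k)) \<odot> FAr F k
          = \<theta> (Cod C k) \<odot> (FAr G k \<odot> \<eta> (Dom C k))"
          using nn(1,2)[of "Cod C k"] F1 nn(3) by (simp add: D.cmp_assoc hom_iff)
        also have "\<dots> = (\<theta> (Cod C k) \<odot> FAr G k) \<odot> \<eta> (Dom C k)"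
          using nn(1)[of "Dom C k"] nn(2)[of "Cod C k"] G1 by (simp add: D.cmp_assoc hom_iff)
        also have "\<dots> = FAr H k \<odot> (\<theta> (Dom C k) \<odot> \<eta> (Dom C k))"
          using nn(1,2)[of "Dom C k"] H1 nn(4) by (simp add: D.cmp_assoc hom_iff)
        finally show "(\<lambda>a\<in>Ob C. \<theta> a \<odot> \<eta> a) (Cod C k) \<odot> FAr F k
          = FAr H k \<odot> (\<lambda>a\<in>Ob C. \<theta> a \<odot> \<eta> a) (Dom C k)"
          by simp
      qed
      then show ?thesis
        using F H ext by (simp add: fg functor_cat_def Let_def hom_iff)
    qed
    subgoal for f
    proof -
      assume "f \<in> Ar (functor_cat C D)"
      then obtain F \<eta> G where f: "f = (F, \<eta>, G)" "\<eta> \<in> extensional (Ob C)" "nat_trans C D F G \<eta>"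
        by (cases f) (auto simp: functor_cat_def Let_def)
      then have "(\<lambda>a\<in>Ob C. \<eta> a \<odot> (\<lambda>a\<in>Ob C. Idn D (FOb F a)) a) = \<eta>"
        using D.cmp_idn_right[of "\<eta> _"]
        by (intro extensionalityI[where A="Ob C"]) (force simp: nat_trans_def hom_iff)+
      then show ?thesis by (simp add: f functor_cat_def Let_def)
    qed
    subgoal for f
    proof -
      assume "f \<in> Ar (functor_cat C D)"
      then obtain F \<eta> G where f: "f = (F, \<eta>, G)" "\<eta> \<in> extensional (Ob C)" "nat_trans C D F G \<eta>"
        by (cases f) (auto simp: functor_cat_def Let_def)
      then have "(\<lambda>a\<in>Ob C. (\<lambda>a\<in>Ob C. Idn D (FOb G a)) a \<odot> \<eta> a) = \<eta>"
        using D.cmp_idn_left[of "\<eta> _"]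
        by (intro extensionalityI[where A="Ob C"]) (force simp: nat_trans_def hom_iff)+
      then show ?thesis by (simp add: f functor_cat_def Let_def)
    qed
    subgoal for f g h
    proof -
      assume "f \<in> Ar (functor_cat C D)" "g \<in> Ar (functor_cat C D)" "h \<in> Ar (functor_cat C D)"
        "Cod (functor_cat C D) f = Dom (functor_cat C D) g"
        "Cod (functor_cat C D) g = Dom (functor_cat C D) h"
      then obtain F \<eta> G \<theta> H \<kappa> K where fgh: "f = (F, \<eta>, G)" "g = (G, \<theta>, H)" "h = (H, \<kappa>, K)"
        and n: "nat_trans C D F G \<eta>" "nat_trans C D G H \<theta>" "nat_trans C D H K \<kappa>"
        by (cases f; cases g; cases h) (auto simp: functor_cat_def Let_def)
      have "(\<kappa> a \<odot> \<theta> a) \<odot> \<eta> a = \<kappa> a \<odot> (\<theta> a \<odot> \<eta> a)" if "a \<in> Ob C" for a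
        using n that by (intro D.cmp_assoc) (auto simp: nat_trans_def hom_iff)
      then show ?thesis
        by (simp add: fgh functor_cat_def Let_def cong: restrict_cong)
    qed
    done
qed

text \<open>Cells are pasted with \<open>inv_ar\<close>, a definite description; this is how it is evaluated.\<close>

lemma (in category) inv_ar_eq:
  assumes "inverse_pair C f g"
  shows "inv_ar C f = g"
  unfolding inv_ar_def
proof (rule the_equality)
  fix k assume "inverse_pair C f k"
  then have k: "k \<in> Ar C" "Dom C k = Cod C f" "Cod C k = Dom C f" "k \<odot> f = Idn C (Dom C f)"
    by (auto simp: inverse_pair_def hom_iff)
  have g: "f \<in> Ar C" "g \<in> Ar C" "Dom C g = Cod C f" "Cod C g = Dom C f" "f \<odot> g = Idn C (Cod C f)"
    using assms by (auto simp: inverse_pair_def hom_iff)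
  have "k = k \<odot> (f \<odot> g)" using cmp_idn_right[of k] k g by simp
  also have "\<dots> = (k \<odot> f) \<odot> g" using cmp_assoc[of g f k] k(1-3) g(1-4) by simp
  also have "\<dots> = g" using cmp_idn_left[of g] k g by simp
  finally show "k = g" .
qed (fact assms)

section \<open>Wiring diagrams form a symmetric monoidal category\<close>

lemma tsum_simps [simp]:
  "Elts (tsum A B) = InL ` Elts A \<union> InR ` Elts B"
  "Typ (tsum A B) (InL x) = Typ A x" "Typ (tsum A B) (InR y) = Typ B y"
  by (auto simp: tsum_def)

lemma tempty_simps [simp]: "Elts tempty = {}"
  by (simp add: tempty_def)

lemma box_sum_simps [simp]:
  "Inp (box_sum X Y) = tsum (Inp X) (Inp Y)" "Out (box_sum X Y) = tsum (Out X) (Out Y)"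
  by (auto simp: box_sum_def)

lemma lplus_simps [simp]: "lplus f g (InL x) = InL (f x)" "lplus f g (InR x) = InR (g x)"
  by (auto simp: lplus_def)

lemma mk_wiring_simps [simp]:
  "wdom (mk_wiring X Y a b) = X" "wcod (mk_wiring X Y a b) = Y"
  "x \<in> Elts (Inp X) \<Longrightarrow> win (mk_wiring X Y a b) x = a x"
  "y \<in> Elts (Out Y) \<Longrightarrow> wout (mk_wiring X Y a b) y = b y"
  by (auto simp: mk_wiring_def)

lemma wiring_comp_simps [simp]:
  "wdom (wiring_comp g f) = wdom f" "wcod (wiring_comp g f) = wcod g"
  by (auto simp: wiring_comp_def)

lemma win_wiring_comp:
  assumes "x \<in> Elts (Inp (wdom f))"
  shows "win f x = InL y \<Longrightarrow> win (wiring_comp g f) x = InL y"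
    "win f x = InR z \<Longrightarrow> win (wiring_comp g f) x = lplus (wout f) id (win g z)"
  using assms by (auto simp: wiring_comp_def lplus_def)

lemma wout_wiring_comp:
  assumes "y \<in> Elts (Out (wcod g))"
  shows "wout (wiring_comp g f) y = wout f (wout g y)"
  using assms by (auto simp: wiring_comp_def)

lemma wiring_sum_simps [simp]:
  "wdom (wiring_sum f g) = box_sum (wdom f) (wdom g)"
  "wcod (wiring_sum f g) = box_sum (wcod f) (wcod g)"
  "x \<in> Elts (Inp (wdom f)) \<Longrightarrow> win (wiring_sum f g) (InL x) = lplus InL InL (win f x)"
  "y \<in> Elts (Inp (wdom g)) \<Longrightarrow> win (wiring_sum f g) (InR y) = lplus InR InR (win g y)"
  "x' \<in> Elts (Out (wcod f)) \<Longrightarrow> wout (wiring_sum f g) (InL x') = InL (wout f x')"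
  "y' \<in> Elts (Out (wcod g)) \<Longrightarrow> wout (wiring_sum f g) (InR y') = InR (wout g y')"
  by (auto simp: wiring_sum_def)

abbreviation unit_box :: "('i, 'o) box" where
  "unit_box \<equiv> \<lparr>Inp = tempty, Out = tempty\<rparr>"

lemma is_tset_tsum:
  assumes "is_tset C X" "is_tset C Y"
  shows "is_tset C (tsum X Y)"
proof -
  have "lcase (Typ X) (Typ Y) z = undefined" if "z \<notin> InL ` Elts X \<union> InR ` Elts Y" for z
    using assms that by (cases z) (auto simp: is_tset_def PiE_def extensional_def)
  then show ?thesis
    using assms by (auto simp: is_tset_def tsum_def PiE_def extensional_def)
qed

lemma is_box_box_sum: "is_box C X \<Longrightarrow> is_box C Y \<Longrightarrow> is_box C (box_sum X Y)"
  by (auto simp: is_box_def is_tset_tsum)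

lemma is_box_empty: "is_box C unit_box"
  by (auto simp: is_box_def is_tset_def tempty_def)

text \<open>Most facts about wirings follow by tracing each input wire to its source, which is either an
  output of the same inner box or an input of the outer box.\<close>

lemma win_cases:
  assumes "is_wiring C f" "x \<in> Elts (Inp (wdom f))"
  obtains (out) y where "y \<in> Elts (Out (wdom f))" "win f x = InL y"
      "Typ (Out (wdom f)) y = Typ (Inp (wdom f)) x"
  | (inp) z where "z \<in> Elts (Inp (wcod f))" "win f x = InR z"
      "Typ (Inp (wcod f)) z = Typ (Inp (wdom f)) x"
proof -
  have f: "typed_fun (Inp (wdom f)) (win f) (tsum (Out (wdom f)) (Inp (wcod f)))"
    using assms(1) by (simp add: is_wiring_def)
  then have "win f x \<in> Elts (tsum (Out (wdom f)) (Inp (wcod f)))"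
    "Typ (tsum (Out (wdom f)) (Inp (wcod f))) (win f x) = Typ (Inp (wdom f)) x"
    using assms(2) by (auto simp: typed_fun_def)
  then show thesis
    using that by auto
qed

lemma wout_mem:
  assumes "is_wiring C f" "y \<in> Elts (Out (wcod f))"
  shows "wout f y \<in> Elts (Out (wdom f))" "Typ (Out (wdom f)) (wout f y) = Typ (Out (wcod f)) y"
  using assms by (auto simp: is_wiring_def typed_fun_def)

lemma wiring_eqI:
  assumes "is_wiring C f" "is_wiring C g" "wdom f = wdom g" "wcod f = wcod g"
    "\<And>x. x \<in> Elts (Inp (wdom g)) \<Longrightarrow> win f x = win g x"
    "\<And>y. y \<in> Elts (Out (wcod g)) \<Longrightarrow> wout f y = wout g y"
  shows "f = g"
proof (rule wiring.equality)
  show "win f = win g"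
    using assms by (intro extensionalityI[where A = "Elts (Inp (wdom g))"])
      (auto simp: is_wiring_def typed_fun_def PiE_def)
  show "wout f = wout g"
    using assms by (intro extensionalityI[where A = "Elts (Out (wcod g))"])
      (auto simp: is_wiring_def typed_fun_def PiE_def)
qed (use assms in auto)

lemma is_wiring_mk_wiring:
  assumes "is_box C X" "is_box C Y"
    "\<And>x. x \<in> Elts (Inp X) \<Longrightarrow> a x \<in> InL ` Elts (Out X) \<union> InR ` Elts (Inp Y) \<and>
      Typ (tsum (Out X) (Inp Y)) (a x) = Typ (Inp X) x"
    "\<And>y. y \<in> Elts (Out Y) \<Longrightarrow> b y \<in> Elts (Out X) \<and> Typ (Out X) (b y) = Typ (Out Y) y"
  shows "is_wiring C (mk_wiring X Y a b)"
  using assms(1,2) assms(3,4)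
  by (auto simp: is_wiring_def typed_fun_def mk_wiring_def simp del: tsum_simps(2,3))

lemma is_wiring_comp:
  assumes f: "is_wiring C f" and g: "is_wiring C g" and fg: "wcod f = wdom g"
  shows "is_wiring C (wiring_comp g f)"
  unfolding wiring_comp_def
proof (rule is_wiring_mk_wiring)
  show "is_box C (wdom f)" "is_box C (wcod g)"
    using f g by (auto simp: is_wiring_def)
next
  fix x assume x: "x \<in> Elts (Inp (wdom f))"
  let ?a = "lcase InL id \<circ> lplus id (lplus (wout f) id) \<circ> lplus id (win g) \<circ> win f"
  from f x show "?a x \<in> InL ` Elts (Out (wdom f)) \<union> InR ` Elts (Inp (wcod g)) \<and>
      Typ (tsum (Out (wdom f)) (Inp (wcod g))) (?a x) = Typ (Inp (wdom f)) x"
  proof (cases rule: win_cases)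
    case (inp z)
    then have "z \<in> Elts (Inp (wdom g))" by (simp add: fg)
    with g show ?thesis
      by (cases rule: win_cases) (use inp fg wout_mem[OF f] in auto)
  qed auto
next
  fix y assume "y \<in> Elts (Out (wcod g))"
  then show "(wout f \<circ> wout g) y \<in> Elts (Out (wdom f)) \<and>
      Typ (Out (wdom f)) ((wout f \<circ> wout g) y) = Typ (Out (wcod g)) y"
    using wout_mem[OF f] wout_mem[OF g] fg by simp
qed

lemma is_wiring_sum:
  assumes f: "is_wiring C f" and g: "is_wiring C g"
  shows "is_wiring C (wiring_sum f g)"
  unfolding wiring_sum_def
proof (rule is_wiring_mk_wiring)
  show "is_box C (box_sum (wdom f) (wdom g))" "is_box C (box_sum (wcod f) (wcod g))"
    using f g by (auto simp: is_wiring_def is_box_box_sum)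
next
  let ?X = "box_sum (wdom f) (wdom g)" and ?Y = "box_sum (wcod f) (wcod g)"
  let ?a = "lcase (lplus InL InL \<circ> win f) (lplus InR InR \<circ> win g)"
  fix x assume "x \<in> Elts (Inp ?X)"
  then consider u where "x = InL u" "u \<in> Elts (Inp (wdom f))"
    | u where "x = InR u" "u \<in> Elts (Inp (wdom g))" by auto
  then show "?a x \<in> InL ` Elts (Out ?X) \<union> InR ` Elts (Inp ?Y) \<and>
      Typ (tsum (Out ?X) (Inp ?Y)) (?a x) = Typ (Inp ?X) x"
  proof cases
    case 1
    from f 1(2) show ?thesis by (cases rule: win_cases) (auto simp: 1(1))
  next
    case 2
    from g 2(2) show ?thesis by (cases rule: win_cases) (auto simp: 2(1))
  qed
next
  fix y assume "y \<in> Elts (Out (box_sum (wcod f) (wcod g)))"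
  then show "lplus (wout f) (wout g) y \<in> Elts (Out (box_sum (wdom f) (wdom g))) \<and>
      Typ (Out (box_sum (wdom f) (wdom g))) (lplus (wout f) (wout g) y)
        = Typ (Out (box_sum (wcod f) (wcod g))) y"
    using wout_mem[OF f] wout_mem[OF g] by auto
qed

text \<open>The identities and the structural isomorphisms of the category of wiring diagrams connect every
  wire of the inner box to a wire of the outer box, without feedback. Such a wiring is a typed
  renaming \<open>a\<close> of the inputs together with a renaming \<open>b\<close> of the outputs in the other direction.
  These wirings are closed under composition and sum, and their renamings compose and add up
  accordingly, so the coherence axioms between them are equations between functions on labels.\<close>

definition relabelling ::
  "('o, 'm, 'z) cat_scheme \<Rightarrow> ('i, 'o) box \<Rightarrow> ('i, 'o) box \<Rightarrow> ('i lbl \<Rightarrow> 'i lbl) \<Rightarrow> ('i lbl \<Rightarrow> 'i lbl) \<Rightarrow> bool" where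
  "relabelling C X Y a b \<longleftrightarrow> is_box C X \<and> is_box C Y
    \<and> (\<forall>x\<in>Elts (Inp X). a x \<in> Elts (Inp Y) \<and> Typ (Inp Y) (a x) = Typ (Inp X) x)
    \<and> (\<forall>y\<in>Elts (Out Y). b y \<in> Elts (Out X) \<and> Typ (Out X) (b y) = Typ (Out Y) y)"

definition relabel ::
  "('i, 'o) box \<Rightarrow> ('i, 'o) box \<Rightarrow> ('i lbl \<Rightarrow> 'i lbl) \<Rightarrow> ('i lbl \<Rightarrow> 'i lbl) \<Rightarrow> ('i, 'o) wiring" where
  "relabel X Y a b = mk_wiring X Y (InR \<circ> a) b"

abbreviation id_wiring :: "('i, 'o) box \<Rightarrow> ('i, 'o) wiring" where
  "id_wiring X \<equiv> relabel X X id id"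

abbreviation assoc_wiring :: "('i, 'o) box \<Rightarrow> ('i, 'o) box \<Rightarrow> ('i, 'o) box \<Rightarrow> ('i, 'o) wiring" where
  "assoc_wiring X Y Z \<equiv> relabel (box_sum (box_sum X Y) Z) (box_sum X (box_sum Y Z)) lassoc lassoc'"

abbreviation left_unit_wiring :: "('i, 'o) box \<Rightarrow> ('i, 'o) wiring" where
  "left_unit_wiring X \<equiv> relabel (box_sum unit_box X) X (lcase (\<lambda>_. undefined) id) InR"

abbreviation right_unit_wiring :: "('i, 'o) box \<Rightarrow> ('i, 'o) wiring" where
  "right_unit_wiring X \<equiv> relabel (box_sum X unit_box) X (lcase id (\<lambda>_. undefined)) InL"

abbreviation swap_wiring :: "('i, 'o) box \<Rightarrow> ('i, 'o) box \<Rightarrow> ('i, 'o) wiring" where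
  "swap_wiring X Y \<equiv> relabel (box_sum X Y) (box_sum Y X) (lcase InR InL) (lcase InR InL)"

lemma relabel_simps [simp]:
  "wdom (relabel X Y a b) = X" "wcod (relabel X Y a b) = Y"
  "x \<in> Elts (Inp X) \<Longrightarrow> win (relabel X Y a b) x = InR (a x)"
  "y \<in> Elts (Out Y) \<Longrightarrow> wout (relabel X Y a b) y = b y"
  by (auto simp: relabel_def)

lemma is_wiring_relabel: "relabelling C X Y a b \<Longrightarrow> is_wiring C (relabel X Y a b)"
  unfolding relabel_def by (rule is_wiring_mk_wiring) (auto simp: relabelling_def)

lemma relabelling_comp:
  "relabelling C X Y a b \<Longrightarrow> relabelling C Y Z a' b' \<Longrightarrow> relabelling C X Z (a' \<circ> a) (b \<circ> b')"
  by (auto simp: relabelling_def)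

lemma relabel_comp:
  assumes "relabelling C X Y a b" "relabelling C Y Z a' b'"
  shows "wiring_comp (relabel Y Z a' b') (relabel X Y a b) = relabel X Z (a' \<circ> a) (b \<circ> b')"
proof (rule wiring_eqI)
  show "is_wiring C (wiring_comp (relabel Y Z a' b') (relabel X Y a b))"
    by (rule is_wiring_comp) (use is_wiring_relabel[OF assms(1)] is_wiring_relabel[OF assms(2)] in auto)
  show "is_wiring C (relabel X Z (a' \<circ> a) (b \<circ> b'))"
    by (rule is_wiring_relabel) (rule relabelling_comp[OF assms])
qed (use assms in \<open>auto simp: win_wiring_comp wout_wiring_comp relabelling_def\<close>)

lemma relabel_cong:
  assumes "relabelling C X Y a b" "\<And>x. x \<in> Elts (Inp X) \<Longrightarrow> a x = a' x"
    "\<And>y. y \<in> Elts (Out Y) \<Longrightarrow> b y = b' y"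
  shows "relabel X Y a b = relabel X Y a' b'"
  using assms by (auto simp: relabel_def relabelling_def mk_wiring_def restrict_def fun_eq_iff)

lemma relabelling_sum:
  "relabelling C X Y a b \<Longrightarrow> relabelling C X' Y' a' b' \<Longrightarrow>
    relabelling C (box_sum X X') (box_sum Y Y') (lplus a a') (lplus b b')"
  by (auto simp: relabelling_def is_box_box_sum)

lemma relabel_sum:
  assumes "relabelling C X Y a b" "relabelling C X' Y' a' b'"
  shows "wiring_sum (relabel X Y a b) (relabel X' Y' a' b')
    = relabel (box_sum X X') (box_sum Y Y') (lplus a a') (lplus b b')"
proof (rule wiring_eqI)
  show "is_wiring C (wiring_sum (relabel X Y a b) (relabel X' Y' a' b'))"
    by (rule is_wiring_sum) (use is_wiring_relabel[OF assms(1)] is_wiring_relabel[OF assms(2)] in auto)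
  show "is_wiring C (relabel (box_sum X X') (box_sum Y Y') (lplus a a') (lplus b b'))"
    by (rule is_wiring_relabel) (rule relabelling_sum[OF assms])
qed (use assms in \<open>auto simp: win_wiring_comp wout_wiring_comp relabelling_def\<close>)

lemma relabelling_idn: "is_box C X \<Longrightarrow> relabelling C X X id id"
  by (simp add: relabelling_def)

lemma is_wiring_id: "is_box C X \<Longrightarrow> is_wiring C (id_wiring X)"
  by (rule is_wiring_relabel[OF relabelling_idn])

lemma wiring_cat_simps [simp]:
  "Ob (wiring_cat C) = {X. is_box C X}" "Ar (wiring_cat C) = {f. is_wiring C f}"
  "Dom (wiring_cat C) = wdom" "Cod (wiring_cat C) = wcod"
  "Idn (wiring_cat C) X = id_wiring X"
  "Cmp (wiring_cat C) = wiring_comp" "Ten (wiring_cat C) = box_sum"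
  "TenA (wiring_cat C) = wiring_sum" "Unt (wiring_cat C) = unit_box"
  "Asc (wiring_cat C) X Y Z = assoc_wiring X Y Z"
  "Lun (wiring_cat C) X = left_unit_wiring X"
  "Run (wiring_cat C) X = right_unit_wiring X"
  "Brd (wiring_cat C) X Y = swap_wiring X Y"
  by (auto simp: wiring_cat_def relabel_def comp_def)

lemma hom_wiring_cat:
  "f \<in> hom (wiring_cat C) X Y \<longleftrightarrow> is_wiring C f \<and> wdom f = X \<and> wcod f = Y"
  by (simp add: hom_iff)

lemma wiring_comp_relabel:
  assumes "is_wiring C f" "relabelling C (wcod f) Z a b"
  shows "x \<in> Elts (Inp (wdom f)) \<Longrightarrow>
      win (wiring_comp (relabel (wcod f) Z a b) f) x = lplus id a (win f x)"
    "y \<in> Elts (Out Z) \<Longrightarrow> wout (wiring_comp (relabel (wcod f) Z a b) f) y = wout f (b y)"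
proof -
  assume x: "x \<in> Elts (Inp (wdom f))"
  with assms(1) show "win (wiring_comp (relabel (wcod f) Z a b) f) x = lplus id a (win f x)"
    by (cases rule: win_cases) (use x in \<open>auto simp: win_wiring_comp\<close>)
qed (auto simp: wout_wiring_comp)

lemma relabel_wiring_comp:
  assumes "is_wiring C f" "relabelling C X (wdom f) a b"
  shows "x \<in> Elts (Inp X) \<Longrightarrow>
      win (wiring_comp f (relabel X (wdom f) a b)) x = lplus b id (win f (a x))"
    "y \<in> Elts (Out (wcod f)) \<Longrightarrow>
      wout (wiring_comp f (relabel X (wdom f) a b)) y = b (wout f y)"
proof -
  assume x: "x \<in> Elts (Inp X)"
  with assms(2) have "a x \<in> Elts (Inp (wdom f))" by (simp add: relabelling_def)
  with assms(1) show "win (wiring_comp f (relabel X (wdom f) a b)) x = lplus b id (win f (a x))"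
    by (cases rule: win_cases) (use x in \<open>auto simp: win_wiring_comp\<close>)
next
  assume "y \<in> Elts (Out (wcod f))"
  then show "wout (wiring_comp f (relabel X (wdom f) a b)) y = b (wout f y)"
    using wout_mem[OF assms(1)] by (auto simp: wout_wiring_comp)
qed

text \<open>Naturality of a structural isomorphism: one composite follows a wire through \<open>f\<close>, the other through
  \<open>f'\<close>, and the renamings add no feedback of their own, so it suffices to compare the translated labels
  at the source of each wire.\<close>

lemma wiring_relabel_natural:
  assumes f: "is_wiring C f" and f': "is_wiring C f'"
    and r: "relabelling C X X' a b" and r': "relabelling C Y Y' a' b'"
    and ends: "wdom f = X" "wcod f = Y" "wdom f' = X'" "wcod f' = Y'"
    and inp: "\<And>x. x \<in> Elts (Inp X) \<Longrightarrow> lplus id a' (win f x) = lplus b id (win f' (a x))"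
    and out: "\<And>y. y \<in> Elts (Out Y') \<Longrightarrow> wout f (b' y) = b (wout f' y)"
  shows "wiring_comp (relabel Y Y' a' b') f = wiring_comp f' (relabel X X' a b)"
proof (rule wiring_eqI)
  show "is_wiring C (wiring_comp (relabel Y Y' a' b') f)" "is_wiring C (wiring_comp f' (relabel X X' a b))"
    using f f' is_wiring_relabel[OF r] is_wiring_relabel[OF r'] by (simp_all add: is_wiring_comp ends)
qed (use wiring_comp_relabel[OF f, of Y' a' b'] relabel_wiring_comp[OF f', of X a b] r r' inp out ends in auto)

lemma structural_relabelling:
  assumes "is_box C X" "is_box C Y" "is_box C Z"
  shows "relabelling C (box_sum (box_sum X Y) Z) (box_sum X (box_sum Y Z)) lassoc lassoc'"
    "relabelling C (box_sum X (box_sum Y Z)) (box_sum (box_sum X Y) Z) lassoc' lassoc"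
    "relabelling C (box_sum unit_box X) X (lcase (\<lambda>_. undefined) id) InR"
    "relabelling C X (box_sum unit_box X) InR (lcase (\<lambda>_. undefined) id)"
    "relabelling C (box_sum X unit_box) X (lcase id (\<lambda>_. undefined)) InL"
    "relabelling C X (box_sum X unit_box) InL (lcase id (\<lambda>_. undefined))"
    "relabelling C (box_sum X Y) (box_sum Y X) (lcase InR InL) (lcase InR InL)"
  using assms
  by (auto simp: relabelling_def is_box_box_sum is_box_empty lassoc_def lassoc'_def)

lemma is_iso_relabel:
  assumes r: "relabelling C X Y a b" and r': "relabelling C Y X a' b'"
    and "\<And>x. x \<in> Elts (Inp X) \<Longrightarrow> a' (a x) = x" "\<And>x. x \<in> Elts (Inp Y) \<Longrightarrow> a (a' x) = x"
    "\<And>x. x \<in> Elts (Out X) \<Longrightarrow> b (b' x) = x" "\<And>x. x \<in> Elts (Out Y) \<Longrightarrow> b' (b x) = x"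
  shows "is_iso (wiring_cat C) (relabel X Y a b)"
proof -
  have "relabel X X (a' \<circ> a) (b \<circ> b') = id_wiring X"
    by (rule relabel_cong[OF relabelling_comp[OF r r']]) (use assms in auto)
  moreover have "relabel Y Y (a \<circ> a') (b' \<circ> b) = id_wiring Y"
    by (rule relabel_cong[OF relabelling_comp[OF r' r]]) (use assms in auto)
  ultimately have "inverse_pair (wiring_cat C) (relabel X Y a b) (relabel Y X a' b')"
    using is_wiring_relabel[OF r] is_wiring_relabel[OF r']
    by (simp add: inverse_pair_def hom_wiring_cat relabel_comp[OF r r'] relabel_comp[OF r' r])
  then show ?thesis by (auto simp: is_iso_def)
qed

lemma category_wiring_cat: "category (wiring_cat C)"
proof
  show "Idn (wiring_cat C) X \<in> hom (wiring_cat C) X X" if "X \<in> Ob (wiring_cat C)" for X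
    using that is_wiring_relabel[OF relabelling_idn[of C X]] by (simp add: hom_wiring_cat)
next
  fix f assume f: "f \<in> Ar (wiring_cat C)"
  then have b: "is_box C (wdom f)" "is_box C (wcod f)" by (auto simp: is_wiring_def)
  note ids = relabelling_idn[OF b(1)] relabelling_idn[OF b(2)]
  show "f \<odot>\<^bsub>wiring_cat C\<^esub> Idn (wiring_cat C) (Dom (wiring_cat C) f) = f"
    using f is_wiring_relabel[OF ids(1)]
    by (intro wiring_eqI[of C])
      (auto simp: is_wiring_comp relabel_wiring_comp[OF _ ids(1)] elim: win_cases)
  show "Idn (wiring_cat C) (Cod (wiring_cat C) f) \<odot>\<^bsub>wiring_cat C\<^esub> f = f"
    using f is_wiring_relabel[OF ids(2)]
    by (intro wiring_eqI[of C])
      (auto simp: is_wiring_comp wiring_comp_relabel[OF _ ids(2)] elim: win_cases)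
next
  fix f g h
  assume "f \<in> Ar (wiring_cat C)" "g \<in> Ar (wiring_cat C)" "h \<in> Ar (wiring_cat C)"
    "Cod (wiring_cat C) f = Dom (wiring_cat C) g" "Cod (wiring_cat C) g = Dom (wiring_cat C) h"
  then have f: "is_wiring C f" and g: "is_wiring C g" and h: "is_wiring C h"
    and fg: "wcod f = wdom g" and gh: "wcod g = wdom h" by auto
  have "wiring_comp (wiring_comp h g) f = wiring_comp h (wiring_comp g f)"
  proof (rule wiring_eqI)
    show "is_wiring C (wiring_comp (wiring_comp h g) f)" "is_wiring C (wiring_comp h (wiring_comp g f))"
      using f g h fg gh by (auto intro!: is_wiring_comp)
  next
    fix x assume "x \<in> Elts (Inp (wdom (wiring_comp h (wiring_comp g f))))"
    then have x: "x \<in> Elts (Inp (wdom f))" by simp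
    from f x show "win (wiring_comp (wiring_comp h g) f) x = win (wiring_comp h (wiring_comp g f)) x"
    proof (cases rule: win_cases)
      case (inp z)
      then have z: "z \<in> Elts (Inp (wdom g))" by (simp add: fg)
      with g show ?thesis
      proof (cases rule: win_cases)
        case (inp w)
        then have "w \<in> Elts (Inp (wdom h))" by (simp add: gh)
        with h show ?thesis
          by (cases rule: win_cases)
            (use x z inp \<open>win f x = InR z\<close> gh in \<open>auto simp: win_wiring_comp wout_wiring_comp\<close>)
      qed (use x z inp in \<open>auto simp: win_wiring_comp\<close>)
    qed (use x in \<open>auto simp: win_wiring_comp\<close>)
  next
    fix y assume "y \<in> Elts (Out (wcod (wiring_comp h (wiring_comp g f))))"
    then show "wout (wiring_comp (wiring_comp h g) f) y = wout (wiring_comp h (wiring_comp g f)) y"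
      using wout_mem[OF h] gh by (simp add: wout_wiring_comp)
  qed (auto)
  then show "(h \<odot>\<^bsub>wiring_cat C\<^esub> g) \<odot>\<^bsub>wiring_cat C\<^esub> f = h \<odot>\<^bsub>wiring_cat C\<^esub> (g \<odot>\<^bsub>wiring_cat C\<^esub> f)"
    by simp
qed (auto simp: hom_wiring_cat is_wiring_comp, auto simp: is_wiring_def)


text \<open>The coherence axioms reduce to equations of renamings by \<open>relabel_comp\<close> and \<open>relabel_sum\<close>, the
  naturality axioms to \<open>wiring_relabel_natural\<close>; only functoriality of the sum composes
  arbitrary wirings with each other.\<close>

theorem symmetric_monoidal_wiring_cat:
  fixes C :: "('o, 'm, 'z) cat_scheme"
  shows "symmetric_monoidal_category (wiring_cat C :: (('i, 'o) box, ('i, 'o) wiring) smcat)"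
proof (intro symmetric_monoidal_category.intro category_wiring_cat
    symmetric_monoidal_category_axioms.intro, unfold wiring_cat_simps mem_Collect_eq hom_wiring_cat,
    goal_cases)
  case (1 X Y)
  then show ?case by (rule is_box_box_sum)
next
  case (2 f g)
  then show ?case by (simp add: is_wiring_sum)
next
  case (3 X Y)
  note r = relabelling_idn[OF 3(1)] relabelling_idn[OF 3(2)]
  show ?case
    unfolding relabel_sum[OF r] by (rule relabel_cong[OF relabelling_sum[OF r]]) auto
next
  case w: (4 f f' g g')
  show ?case
  proof (rule wiring_eqI)
    show "is_wiring C (wiring_sum (wiring_comp f' f) (wiring_comp g' g))"
      "is_wiring C (wiring_comp (wiring_sum f' g') (wiring_sum f g))"
      using w by (simp_all add: is_wiring_comp is_wiring_sum)
  next
    fix x assume "x \<in> Elts (Inp (wdom (wiring_comp (wiring_sum f' g') (wiring_sum f g))))"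
    then consider u where "x = InL u" "u \<in> Elts (Inp (wdom f))"
      | u where "x = InR u" "u \<in> Elts (Inp (wdom g))" by auto
    then show "win (wiring_sum (wiring_comp f' f) (wiring_comp g' g)) x
        = win (wiring_comp (wiring_sum f' g') (wiring_sum f g)) x"
    proof cases
      case 1
      from w(1) 1(2) show ?thesis
      proof (cases rule: win_cases)
        case (inp z)
        then have z: "z \<in> Elts (Inp (wdom f'))" by (simp add: w)
        from w(2) z show ?thesis
          by (cases rule: win_cases) (use 1 z inp w in \<open>auto simp: win_wiring_comp\<close>)
      qed (use 1 in \<open>auto simp: win_wiring_comp\<close>)
    next
      case 2
      from w(3) 2(2) show ?thesis
      proof (cases rule: win_cases)
        case (inp z)
        then have z: "z \<in> Elts (Inp (wdom g'))" by (simp add: w)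
        from w(4) z show ?thesis
          by (cases rule: win_cases) (use 2 z inp w in \<open>auto simp: win_wiring_comp\<close>)
      qed (use 2 in \<open>auto simp: win_wiring_comp\<close>)
    qed
  next
    fix y assume "y \<in> Elts (Out (wcod (wiring_comp (wiring_sum f' g') (wiring_sum f g))))"
    then show "wout (wiring_sum (wiring_comp f' f) (wiring_comp g' g)) y
        = wout (wiring_comp (wiring_sum f' g') (wiring_sum f g)) y"
      using w wout_mem(1)[OF w(2)] wout_mem(1)[OF w(4)] by (auto simp: wout_wiring_comp)
  qed auto
next
  case 5
  show ?case by (rule is_box_empty)
next
  case (6 X Y Z)
  have "is_iso (wiring_cat C) (assoc_wiring X Y Z)"
    by (rule is_iso_relabel[OF structural_relabelling(1,2)[OF 6]]) (auto simp: lassoc_def lassoc'_def)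
  then show ?case
    using is_wiring_relabel[OF structural_relabelling(1)[OF 6]] by simp
next
  case (7 X)
  have "is_iso (wiring_cat C) (left_unit_wiring X)"
    by (rule is_iso_relabel[OF structural_relabelling(3,4)[OF 7 7 7]]) auto
  then show ?case
    using is_wiring_relabel[OF structural_relabelling(3)[OF 7 7 7]] by simp
next
  case (8 X)
  have "is_iso (wiring_cat C) (right_unit_wiring X)"
    by (rule is_iso_relabel[OF structural_relabelling(5,6)[OF 8 8 8]]) auto
  then show ?case
    using is_wiring_relabel[OF structural_relabelling(5)[OF 8 8 8]] by simp
next
  case (9 X Y)
  have "is_iso (wiring_cat C) (swap_wiring X Y)"
    by (rule is_iso_relabel[OF structural_relabelling(7)[OF 9 9(1)] structural_relabelling(7)[OF 9(2,1,1)]]) auto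
  then show ?case
    using is_wiring_relabel[OF structural_relabelling(7)[OF 9 9(1)]] by simp
next
  \<comment> \<open>naturality of associator, unitors and braiding\<close>
  case (10 f X X' g Y Y' h Z Z')
  then have w: "is_wiring C f" "is_wiring C g" "is_wiring C h"
    and ends: "wdom f = X" "wcod f = X'" "wdom g = Y" "wcod g = Y'" "wdom h = Z" "wcod h = Z'"
    and b: "is_box C X" "is_box C Y" "is_box C Z" "is_box C X'" "is_box C Y'" "is_box C Z'"
    by (auto simp: is_wiring_def)
  show ?case
    by (rule wiring_relabel_natural[OF _ _ structural_relabelling(1)[OF b(1-3)] structural_relabelling(1)[OF b(4-6)]])
      (use w ends in \<open>auto simp: is_wiring_sum lassoc_def lassoc'_def wout_mem elim: win_cases\<close>)
next
  case (11 f X X')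
  then have w: "is_wiring C f" and ends: "wdom f = X" "wcod f = X'"
    and b: "is_box C X" "is_box C X'" by (auto simp: is_wiring_def)
  show ?case
    by (rule wiring_relabel_natural[OF _ _ structural_relabelling(3)[OF b(1) b] structural_relabelling(3)[OF b(2) b]])
      (use w ends in \<open>auto simp: is_wiring_sum is_wiring_relabel relabelling_idn is_box_empty elim: win_cases\<close>)
next
  case (12 f X X')
  then have w: "is_wiring C f" and ends: "wdom f = X" "wcod f = X'"
    and b: "is_box C X" "is_box C X'" by (auto simp: is_wiring_def)
  show ?case
    by (rule wiring_relabel_natural[OF _ _ structural_relabelling(5)[OF b(1) b] structural_relabelling(5)[OF b(2) b]])
      (use w ends in \<open>auto simp: is_wiring_sum is_wiring_relabel relabelling_idn is_box_empty elim: win_cases\<close>)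
next
  case (13 f X X' g Y Y')
  then have w: "is_wiring C f" "is_wiring C g"
    and ends: "wdom f = X" "wcod f = X'" "wdom g = Y" "wcod g = Y'"
    and b: "is_box C X" "is_box C Y" "is_box C X'" "is_box C Y'"
    by (auto simp: is_wiring_def)
  show ?case
    by (rule wiring_relabel_natural[OF _ _ structural_relabelling(7)[OF b(1,2,1)] structural_relabelling(7)[OF b(3,4,1)]])
      (use w ends in \<open>auto simp: is_wiring_sum wout_mem elim: win_cases\<close>)
next
  \<comment> \<open>pentagon, triangle, hexagon and symmetry\<close>
  case (14 X Y Z V)
  note b = 14
  note c = is_box_box_sum[OF b(1,2)] is_box_box_sum[OF b(2,3)] is_box_box_sum[OF b(3,4)]
  note r = structural_relabelling(1)[OF c(1) b(3,4)] structural_relabelling(1)[OF b(1,2) c(3)]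
    structural_relabelling(1)[OF b(1-3)] structural_relabelling(1)[OF b(1) c(2) b(4)]
    structural_relabelling(1)[OF b(2-4)] relabelling_idn[OF b(1)] relabelling_idn[OF b(4)]
  note s = relabelling_sum[OF r(6) r(5)] relabelling_sum[OF r(3) r(7)]
  show ?case
    unfolding relabel_comp[OF r(1,2)] relabel_sum[OF r(6) r(5)] relabel_sum[OF r(3) r(7)]
      relabel_comp[OF s(2) r(4)] relabel_comp[OF relabelling_comp[OF s(2) r(4)] s(1)]
    by (rule relabel_cong[OF relabelling_comp[OF r(1,2)]]) (auto simp: lassoc_def lassoc'_def)
next
  case (15 X Y)
  note b = 15
  note r = structural_relabelling(5)[OF b(1) b] structural_relabelling(3)[OF b(2) b]
    structural_relabelling(1)[OF b(1) is_box_empty b(2)] relabelling_idn[OF b(1)] relabelling_idn[OF b(2)]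
  note s = relabelling_sum[OF r(1) r(5)] relabelling_sum[OF r(4) r(2)]
  show ?case
    unfolding relabel_sum[OF r(1) r(5)] relabel_sum[OF r(4) r(2)] relabel_comp[OF r(3) s(2)]
    by (rule relabel_cong[OF s(1)]) (auto simp: lassoc_def lassoc'_def)
next
  case (16 X Y Z)
  note b = 16
  note c = is_box_box_sum[OF b(2,3)]
  note r = structural_relabelling(1)[OF b] structural_relabelling(7)[OF b(1) c b(1)]
    structural_relabelling(1)[OF b(2,3,1)] structural_relabelling(7)[OF b(1,2) b(1)]
    structural_relabelling(1)[OF b(2,1,3)] structural_relabelling(7)[OF b(1,3) b(1)]
    relabelling_idn[OF b(2)] relabelling_idn[OF b(3)]
  note s = relabelling_sum[OF r(4) r(8)] relabelling_sum[OF r(7) r(6)]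
  show ?case
    unfolding relabel_sum[OF r(4) r(8)] relabel_sum[OF r(7) r(6)] relabel_comp[OF r(1) r(2)]
      relabel_comp[OF relabelling_comp[OF r(1) r(2)] r(3)] relabel_comp[OF s(1) r(5)]
      relabel_comp[OF relabelling_comp[OF s(1) r(5)] s(2)]
    by (rule relabel_cong[OF relabelling_comp[OF relabelling_comp[OF r(1) r(2)] r(3)]])
      (auto simp: lassoc_def lassoc'_def)
next
  case (17 X Y)
  note r = structural_relabelling(7)[OF 17 17(1)] structural_relabelling(7)[OF 17(2,1,1)]
  show ?case
    unfolding relabel_comp[OF r]
    by (rule relabel_cong[OF relabelling_comp[OF r]]) auto
qed

section \<open>Interval sheaves, elementwise\<close>

lemma int_cat_simps [simp]:
  "Ob int_cat = {l. 0 \<le> l}"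
  "(l', p, l) \<in> Ar int_cat \<longleftrightarrow> 0 \<le> l' \<and> 0 \<le> p \<and> p + l' \<le> l"
  "Dom int_cat (l', p, l) = l'" "Cod int_cat (l', p, l) = l" "Idn int_cat l = (l, 0, l)"
  "Cmp int_cat (l', p, l) (l'', p', m) = (l'', p + p', l)"
  by (auto simp: int_cat_def)

abbreviation translation :: "real \<times> real \<times> real \<Rightarrow> bool" where
  "translation t \<equiv> t \<in> Ar int_cat"

abbreviation src :: "real \<times> real \<times> real \<Rightarrow> real" where "src \<equiv> Dom int_cat"

abbreviation tgt :: "real \<times> real \<times> real \<Rightarrow> real" where "tgt \<equiv> Cod int_cat"

lemma category_int_cat: "category int_cat"
  by unfold_locales (auto simp: hom_iff int_cat_def)

lemma int_cat_ends:
  assumes "translation t"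
  shows "0 \<le> src t" "0 \<le> tgt t"
  using category.dom_ob[OF category_int_cat assms] category.cod_ob[OF category_int_cat assms] by auto

lemma int_cat_cmp:
  assumes "translation s" "translation t" "tgt s = src t"
  shows "translation (t \<odot>\<^bsub>int_cat\<^esub> s)" "Dom int_cat (t \<odot>\<^bsub>int_cat\<^esub> s) = src s"
    "Cod int_cat (t \<odot>\<^bsub>int_cat\<^esub> s) = tgt t"
  using category.cmp_hom[OF category_int_cat assms] by (auto simp: hom_iff)

lemma set_cat_simps [simp]:
  "Ob set_cat = UNIV" "(A, f, B) \<in> Ar set_cat \<longleftrightarrow> f \<in> A \<rightarrow>\<^sub>E B"
  "Dom set_cat (A, f, B) = A" "Cod set_cat (A, f, B) = B" "Idn set_cat A = (A, \<lambda>x\<in>A. x, A)"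
  "Cmp set_cat (B', g, D) (A, f, B) = (A, compose A g f, D)"
  by (auto simp: set_cat_def)

lemma hom_set_cat: "(A', f, B') \<in> hom set_cat A B \<longleftrightarrow> A' = A \<and> B' = B \<and> f \<in> A \<rightarrow>\<^sub>E B"
  by (auto simp: hom_iff)

lemma category_set_cat: "category set_cat"
proof
  fix f g :: "'u set \<times> ('u \<Rightarrow> 'u) \<times> 'u set"
  assume "f \<in> Ar set_cat" "g \<in> Ar set_cat" "Cod set_cat f = Dom set_cat g"
  then show "g \<odot>\<^bsub>set_cat\<^esub> f \<in> hom set_cat (Dom set_cat f) (Cod set_cat g)"
    by (cases f; cases g) (auto simp: hom_set_cat compose_def)
next
  fix f g h :: "'u set \<times> ('u \<Rightarrow> 'u) \<times> 'u set"
  assume "f \<in> Ar set_cat" "g \<in> Ar set_cat" "h \<in> Ar set_cat"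
    "Cod set_cat f = Dom set_cat g" "Cod set_cat g = Dom set_cat h"
  then show "(h \<odot>\<^bsub>set_cat\<^esub> g) \<odot>\<^bsub>set_cat\<^esub> f = h \<odot>\<^bsub>set_cat\<^esub> (g \<odot>\<^bsub>set_cat\<^esub> f)"
    by (cases f; cases g; cases h) (auto simp: compose_def fun_eq_iff)
next
  fix f :: "'u set \<times> ('u \<Rightarrow> 'u) \<times> 'u set"
  assume "f \<in> Ar set_cat"
  then show "f \<odot>\<^bsub>set_cat\<^esub> Idn set_cat (Dom set_cat f) = f"
    "Idn set_cat (Cod set_cat f) \<odot>\<^bsub>set_cat\<^esub> f = f"
    by (cases f; auto simp: compose_def fun_eq_iff PiE_def extensional_def Pi_def)+
qed (auto simp: hom_set_cat)

lemma category_int_sheaves: "category int_sheaves"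
  unfolding int_sheaves_def psh_cat_def
  by (intro category_full_subcat category_functor_cat category_op_cat category_int_cat category_set_cat)

text \<open>Elements come with a nonnegative length, so that membership alone licenses every later fact
  about them; at negative lengths a presheaf has an arbitrary default value.\<close>

definition el :: "'u psh \<Rightarrow> real \<Rightarrow> 'u set" where
  "el X l = {x \<in> FOb X l. 0 \<le> l}"

abbreviation sheaf :: "'u psh \<Rightarrow> bool" where
  "sheaf X \<equiv> X \<in> Ob int_sheaves"

lemma el_nonneg: "x \<in> el X l \<Longrightarrow> 0 \<le> l"
  by (simp add: el_def)

lemma psh_functor_iff:
  "is_functor (op_cat int_cat) set_cat X \<longleftrightarrow>
    (\<forall>t\<in>Ar int_cat. FAr X t = (FOb X (tgt t), restr X t, FOb X (src t))
      \<and> restr X t \<in> FOb X (tgt t) \<rightarrow>\<^sub>E FOb X (src t))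
    \<and> (\<forall>l. \<forall>x\<in>el X l. restr X (l, 0, l) x = x)
    \<and> (\<forall>t\<in>Ar int_cat. \<forall>s\<in>Ar int_cat. src t = tgt s \<longrightarrow>
        (\<forall>x\<in>el X (tgt t). restr X s (restr X t x) = restr X (t \<odot>\<^bsub>int_cat\<^esub> s) x))"
    (is "_ \<longleftrightarrow> ?typ \<and> ?idn \<and> ?cmp")
proof -
  have 1: "(\<forall>t\<in>Ar int_cat. FAr X t \<in> hom set_cat (FOb X (tgt t)) (FOb X (src t))) \<longleftrightarrow> ?typ"
    by (intro ball_cong refl) (auto simp: restr_def hom_iff split: prod.splits)
  have 2: "(\<forall>l\<in>Ob int_cat. FAr X (Idn int_cat l) = Idn set_cat (FOb X l)) \<longleftrightarrow> ?idn" if t: ?typ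
  proof (intro iffI ballI allI)
    fix l x assume *: "\<forall>l\<in>Ob int_cat. FAr X (Idn int_cat l) = Idn set_cat (FOb X l)" "x \<in> el X l"
    then have "FAr X (l, 0, l) = (FOb X l, \<lambda>x\<in>FOb X l. x, FOb X l)" "x \<in> FOb X l"
      by (auto simp: el_def)
    then show "restr X (l, 0, l) x = x" by (simp add: restr_def)
  next
    fix l assume i: ?idn and l: "l \<in> Ob int_cat"
    then have F: "FAr X (l, 0, l) = (FOb X l, restr X (l, 0, l), FOb X l)"
      and r: "restr X (l, 0, l) \<in> FOb X l \<rightarrow>\<^sub>E FOb X l"
      using bspec[OF t, of "(l, 0, l)"] by simp_all
    have "restr X (l, 0, l) \<in> extensional (FOb X l)" using r by (simp add: PiE_iff)
    then have "restr X (l, 0, l) = (\<lambda>x\<in>FOb X l. x)"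
      using i l by (intro extensionalityI[where A = "FOb X l"]) (auto simp: el_def)
    with F show "FAr X (Idn int_cat l) = Idn set_cat (FOb X l)" by simp
  qed
  have 3: "(\<forall>t\<in>Ar int_cat. \<forall>s\<in>Ar int_cat. src t = tgt s \<longrightarrow>
        FAr X (t \<odot>\<^bsub>int_cat\<^esub> s) = FAr X s \<odot>\<^bsub>set_cat\<^esub> FAr X t) \<longleftrightarrow> ?cmp" if t: ?typ
  proof (intro ball_cong refl imp_cong)
    fix t s assume "translation t" "translation s" "src t = tgt s"
    then have st: "translation s" "translation t" "tgt s = src t" by auto
    note c = int_cat_cmp[OF st]
    have "FAr X (t \<odot>\<^bsub>int_cat\<^esub> s) = FAr X s \<odot>\<^bsub>set_cat\<^esub> FAr X t \<longleftrightarrow>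
      restr X (t \<odot>\<^bsub>int_cat\<^esub> s) = compose (FOb X (tgt t)) (restr X s) (restr X t)"
      using t st c by simp
    also have "\<dots> \<longleftrightarrow> (\<forall>x\<in>el X (tgt t). restr X s (restr X t x) = restr X (t \<odot>\<^bsub>int_cat\<^esub> s) x)"
    proof
      assume r: "\<forall>x\<in>el X (tgt t). restr X s (restr X t x) = restr X (t \<odot>\<^bsub>int_cat\<^esub> s) x"
      have "restr X (t \<odot>\<^bsub>int_cat\<^esub> s) \<in> extensional (FOb X (tgt t))"
        using t c(1,3) by (metis PiE_iff)
      then show "restr X (t \<odot>\<^bsub>int_cat\<^esub> s) = compose (FOb X (tgt t)) (restr X s) (restr X t)"
        using r int_cat_ends[OF st(2)]
        by (intro extensionalityI[where A = "FOb X (tgt t)"]) (auto simp: compose_def el_def)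
    qed (auto simp: compose_def el_def)
    finally show "FAr X (t \<odot>\<^bsub>int_cat\<^esub> s) = FAr X s \<odot>\<^bsub>set_cat\<^esub> FAr X t \<longleftrightarrow>
      (\<forall>x\<in>el X (tgt t). restr X s (restr X t x) = restr X (t \<odot>\<^bsub>int_cat\<^esub> s) x)" .
  qed
  have "is_functor (op_cat int_cat) set_cat X \<longleftrightarrow>
      (\<forall>t\<in>Ar int_cat. FAr X t \<in> hom set_cat (FOb X (tgt t)) (FOb X (src t)))
    \<and> (\<forall>l\<in>Ob int_cat. FAr X (Idn int_cat l) = Idn set_cat (FOb X l))
    \<and> (\<forall>t\<in>Ar int_cat. \<forall>s\<in>Ar int_cat. src t = tgt s \<longrightarrow>
        FAr X (t \<odot>\<^bsub>int_cat\<^esub> s) = FAr X s \<odot>\<^bsub>set_cat\<^esub> FAr X t)"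
    using category_op_cat[OF category_int_cat]
    by (simp add: is_functor_def op_cat_def category_set_cat)
  then show ?thesis using 1 2 3 by blast
qed

lemma sheaf_iff:
  "sheaf X \<longleftrightarrow> is_functor (op_cat int_cat) set_cat X \<and> FOb X \<in> extensional (Ob int_cat)
    \<and> FAr X \<in> extensional (Ar int_cat) \<and> is_interval_sheaf X"
  by (auto simp: int_sheaves_def full_subcat_def psh_cat_def functor_cat_def Let_def op_cat_def)

context
  fixes X :: "'u psh"
  assumes X: "sheaf X"
begin

lemma restr_el:
  assumes "translation t" "x \<in> el X (tgt t)"
  shows "restr X t x \<in> el X (src t)"
  using X assms int_cat_ends[OF assms(1)] by (auto simp: sheaf_iff psh_functor_iff el_def)

lemma restr_idn: "x \<in> el X l \<Longrightarrow> restr X (l, 0, l) x = x"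
  using X by (auto simp: sheaf_iff psh_functor_iff)

lemma restr_restr:
  assumes "translation s" "translation t" "tgt s = src t" "x \<in> el X (tgt t)"
  shows "restr X s (restr X t x) = restr X (t \<odot>\<^bsub>int_cat\<^esub> s) x"
  using X assms by (auto simp: sheaf_iff psh_functor_iff)

lemma sheaf_gluing:
  assumes "x1 \<in> el X l1" "x2 \<in> el X l2" "restr X (0, l1, l1) x1 = restr X (0, 0, l2) x2"
  shows "\<exists>!x. x \<in> el X (l1 + l2) \<and> restr X (l1, 0, l1 + l2) x = x1
    \<and> restr X (l2, l1, l1 + l2) x = x2"
proof -
  have "is_interval_sheaf X" using X by (simp add: sheaf_iff)
  then have "\<exists>!x. x \<in> FOb X (l1 + l2) \<and> restr X (l1, 0, l1 + l2) x = x1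
    \<and> restr X (l2, l1, l1 + l2) x = x2"
    using assms unfolding is_interval_sheaf_def el_def by blast
  then show ?thesis
    using el_nonneg[OF assms(1)] el_nonneg[OF assms(2)] by (simp add: el_def)
qed

text \<open>The two pieces of an element always agree at the gluing point, so uniqueness of gluings applies to any
  two elements with the same pieces.\<close>

lemma sheaf_separated:
  assumes "x \<in> el X (l1 + l2)" "y \<in> el X (l1 + l2)" "0 \<le> l1" "0 \<le> l2"
    "restr X (l1, 0, l1 + l2) x = restr X (l1, 0, l1 + l2) y"
    "restr X (l2, l1, l1 + l2) x = restr X (l2, l1, l1 + l2) y"
  shows "x = y"
proof -
  let ?l = "l1 + l2"
  have "restr X (0, l1, l1) (restr X (l1, 0, ?l) x) = restr X (0, 0, l2) (restr X (l2, l1, ?l) x)"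
    using assms restr_restr[of "(0, l1, l1)" "(l1, 0, ?l)" x] restr_restr[of "(0, 0, l2)" "(l2, l1, ?l)" x]
    by simp
  moreover have "restr X (l1, 0, ?l) x \<in> el X l1" "restr X (l2, l1, ?l) x \<in> el X l2"
    using restr_el[of "(l1, 0, ?l)" x] restr_el[of "(l2, l1, ?l)" x] assms by simp_all
  ultimately have "\<exists>!z. z \<in> el X ?l \<and> restr X (l1, 0, ?l) z = restr X (l1, 0, ?l) x
    \<and> restr X (l2, l1, ?l) z = restr X (l2, l1, ?l) x"
    by (intro sheaf_gluing)
  then show ?thesis using assms by metis
qed

end

lemma el_mk_psh [simp]: "el (mk_psh A r) l = {x \<in> A l. 0 \<le> l}"
  by (auto simp: el_def mk_psh_def)

lemma restr_mk_psh [simp]: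
  "translation t \<Longrightarrow> x \<in> A (tgt t) \<Longrightarrow> restr (mk_psh A r) t x = r t x"
  by (auto simp: restr_def mk_psh_def)

text \<open>Gluing is split into existence and separatedness, since separatedness passes to
  products and subsheaves by itself.\<close>

lemma sheaf_mk_psh:
  assumes mem: "\<And>t x. translation t \<Longrightarrow> x \<in> A (tgt t) \<Longrightarrow> r t x \<in> A (src t)"
    and idn: "\<And>l x. 0 \<le> l \<Longrightarrow> x \<in> A l \<Longrightarrow> r (l, 0, l) x = x"
    and cmp: "\<And>s t x. translation s \<Longrightarrow> translation t \<Longrightarrow> tgt s = src t \<Longrightarrow>
      x \<in> A (tgt t) \<Longrightarrow> r s (r t x) = r (t \<odot>\<^bsub>int_cat\<^esub> s) x"
    and glue: "\<And>l1 l2 x1 x2. 0 \<le> l1 \<Longrightarrow> 0 \<le> l2 \<Longrightarrow> x1 \<in> A l1 \<Longrightarrow> x2 \<in> A l2 \<Longrightarrow>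
      r (0, l1, l1) x1 = r (0, 0, l2) x2 \<Longrightarrow>
      \<exists>x\<in>A (l1 + l2). r (l1, 0, l1 + l2) x = x1 \<and> r (l2, l1, l1 + l2) x = x2"
    and sep: "\<And>l1 l2 x y. 0 \<le> l1 \<Longrightarrow> 0 \<le> l2 \<Longrightarrow> x \<in> A (l1 + l2) \<Longrightarrow> y \<in> A (l1 + l2) \<Longrightarrow>
      r (l1, 0, l1 + l2) x = r (l1, 0, l1 + l2) y \<Longrightarrow>
      r (l2, l1, l1 + l2) x = r (l2, l1, l1 + l2) y \<Longrightarrow> x = y"
  shows "sheaf (mk_psh A r)"
proof -
  have ob: "FOb (mk_psh A r) l = A l" if "0 \<le> l" for l
    using that by (simp add: mk_psh_def)
  have "is_functor (op_cat int_cat) set_cat (mk_psh A r)"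
    unfolding psh_functor_iff
  proof (intro conjI ballI allI impI)
    fix t assume t: "translation t"
    have rt: "restr (mk_psh A r) t = restrict (r t) (A (tgt t))"
      using t by (simp add: restr_def mk_psh_def)
    show "FAr (mk_psh A r) t
      = (FOb (mk_psh A r) (tgt t), restr (mk_psh A r) t, FOb (mk_psh A r) (src t))"
      unfolding rt ob[OF int_cat_ends(1)[OF t]] ob[OF int_cat_ends(2)[OF t]]
      using t by (simp add: mk_psh_def)
    show "restr (mk_psh A r) t \<in> FOb (mk_psh A r) (tgt t) \<rightarrow>\<^sub>E FOb (mk_psh A r) (src t)"
      unfolding rt ob[OF int_cat_ends(1)[OF t]] ob[OF int_cat_ends(2)[OF t]]
      using mem[OF t] by auto
  next
    fix l x assume "x \<in> el (mk_psh A r) l"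
    then show "restr (mk_psh A r) (l, 0, l) x = x" by (simp add: idn)
  next
    fix t s x assume "translation t" "translation s" "src t = tgt s"
      "x \<in> el (mk_psh A r) (tgt t)"
    moreover from this have "r t x \<in> A (tgt s)" using mem[of t x] by simp
    ultimately show "restr (mk_psh A r) s (restr (mk_psh A r) t x) = restr (mk_psh A r) (t \<odot>\<^bsub>int_cat\<^esub> s) x"
      by (simp add: cmp int_cat_cmp)
  qed
  moreover have "is_interval_sheaf (mk_psh A r)"
    unfolding is_interval_sheaf_def
  proof (intro allI impI ballI)
    fix l1 l2 :: real and x1 x2
    assume l: "0 \<le> l1" "0 \<le> l2" and "x1 \<in> FOb (mk_psh A r) l1" "x2 \<in> FOb (mk_psh A r) l2"
      and e: "restr (mk_psh A r) (0, l1, l1) x1 = restr (mk_psh A r) (0, 0, l2) x2"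
    then have x: "x1 \<in> A l1" "x2 \<in> A l2" by (simp_all add: ob)
    with e l have "r (0, l1, l1) x1 = r (0, 0, l2) x2" by simp
    from glue[OF l x this] obtain x where xx: "x \<in> A (l1 + l2)" "r (l1, 0, l1 + l2) x = x1"
      "r (l2, l1, l1 + l2) x = x2" by blast
    show "\<exists>!x. x \<in> FOb (mk_psh A r) (l1 + l2) \<and> restr (mk_psh A r) (l1, 0, l1 + l2) x = x1
      \<and> restr (mk_psh A r) (l2, l1, l1 + l2) x = x2"
    proof (rule ex1I[of _ x])
      show "x \<in> FOb (mk_psh A r) (l1 + l2) \<and> restr (mk_psh A r) (l1, 0, l1 + l2) x = x1
        \<and> restr (mk_psh A r) (l2, l1, l1 + l2) x = x2"
        using xx l by (simp add: ob)
    next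
      fix y assume "y \<in> FOb (mk_psh A r) (l1 + l2) \<and> restr (mk_psh A r) (l1, 0, l1 + l2) y = x1
        \<and> restr (mk_psh A r) (l2, l1, l1 + l2) y = x2"
      then show "y = x" using l xx sep[of l1 l2 y x] by (auto simp: ob)
    qed
  qed
  ultimately show ?thesis by (simp add: sheaf_iff) (simp add: mk_psh_def)
qed

text \<open>For a predicate that is stable under restriction and holds on a concatenation as soon as it holds on
  both pieces, this is a subsheaf. The state sheaf of a wired-up machine is of this kind.\<close>

definition psh_sub :: "'u psh \<Rightarrow> (real \<Rightarrow> 'u \<Rightarrow> bool) \<Rightarrow> 'u psh" where
  "psh_sub X P = mk_psh (\<lambda>l. {x \<in> el X l. P l x}) (restr X)"

lemma sheaf_psh_sub:
  assumes X: "sheaf X"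
    and stable: "\<And>t x. translation t \<Longrightarrow> x \<in> el X (tgt t) \<Longrightarrow> P (tgt t) x \<Longrightarrow>
      P (src t) (restr X t x)"
    and local: "\<And>l1 l2 x. 0 \<le> l1 \<Longrightarrow> 0 \<le> l2 \<Longrightarrow> x \<in> el X (l1 + l2) \<Longrightarrow>
      P l1 (restr X (l1, 0, l1 + l2) x) \<Longrightarrow> P l2 (restr X (l2, l1, l1 + l2) x) \<Longrightarrow> P (l1 + l2) x"
  shows "sheaf (psh_sub X P)"
  unfolding psh_sub_def
proof (rule sheaf_mk_psh)
  fix l1 l2 :: real and x1 x2
  assume l: "0 \<le> l1" "0 \<le> l2" and x: "x1 \<in> {x \<in> el X l1. P l1 x}" "x2 \<in> {x \<in> el X l2. P l2 x}"
    and "restr X (0, l1, l1) x1 = restr X (0, 0, l2) x2"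
  then obtain x where "x \<in> el X (l1 + l2)" "restr X (l1, 0, l1 + l2) x = x1"
    "restr X (l2, l1, l1 + l2) x = x2"
    using sheaf_gluing[OF X, of x1 l1 x2 l2] by auto
  then show "\<exists>x\<in>{x \<in> el X (l1 + l2). P (l1 + l2) x}. restr X (l1, 0, l1 + l2) x = x1 \<and>
      restr X (l2, l1, l1 + l2) x = x2"
    using l x local by blast
next
  fix l1 l2 :: real and x y
  assume "0 \<le> l1" "0 \<le> l2" "x \<in> {x \<in> el X (l1 + l2). P (l1 + l2) x}"
    "y \<in> {x \<in> el X (l1 + l2). P (l1 + l2) x}"
    "restr X (l1, 0, l1 + l2) x = restr X (l1, 0, l1 + l2) y"
    "restr X (l2, l1, l1 + l2) x = restr X (l2, l1, l1 + l2) y"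
  then show "x = y" using sheaf_separated[OF X, of x l1 l2 y] by simp
qed (simp_all add: stable restr_el[OF X] restr_idn[OF X] restr_restr[OF X])

lemma el_psh_sub [simp]: "el (psh_sub X P) l = {x \<in> el X l. P l x}"
  by (auto simp: psh_sub_def dest: el_nonneg)

lemma restr_psh_sub [simp]:
  "translation t \<Longrightarrow> x \<in> el X (tgt t) \<Longrightarrow> P (tgt t) x \<Longrightarrow>
    restr (psh_sub X P) t x = restr X t x"
  by (auto simp: psh_sub_def)

lemma el_psh_times: "el (psh_times A B) l = {Two x y | x y. x \<in> el A l \<and> y \<in> el B l}"
  by (auto simp: psh_times_def el_def mk_psh_def)

lemma restr_psh_times [simp]:
  "translation t \<Longrightarrow> x \<in> el A (tgt t) \<Longrightarrow> y \<in> el B (tgt t) \<Longrightarrow>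
    restr (psh_times A B) t (Two x y) = Two (restr A t x) (restr B t y)"
  by (auto simp: psh_times_def el_def)

lemma psh_times_alt:
  "psh_times A B = mk_psh (\<lambda>l. {Two x y | x y. x \<in> el A l \<and> y \<in> el B l})
    (\<lambda>t z. case z of Two x y \<Rightarrow> Two (restr A t x) (restr B t y))"
proof -
  have "el A l = FOb A l" "el B l = FOb B l" if "0 \<le> l" for l
    using that by (auto simp: el_def)
  then show ?thesis
    unfolding psh_times_def mk_psh_def
    by (intro fctr.equality restrict_ext) (simp_all add: int_cat_ends cong: restrict_cong)
qed

lemma sheaf_psh_times:
  assumes A: "sheaf A" and B: "sheaf B"
  shows "sheaf (psh_times A B)"
  unfolding psh_times_alt
proof (rule sheaf_mk_psh, goal_cases)
  case (4 l1 l2 x1 x2)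
  then obtain a1 b1 a2 b2 where x: "x1 = Two a1 b1" "x2 = Two a2 b2"
    "a1 \<in> el A l1" "a2 \<in> el A l2" "b1 \<in> el B l1" "b2 \<in> el B l2" by auto
  then obtain a b where "a \<in> el A (l1 + l2)" "restr A (l1, 0, l1 + l2) a = a1"
    "restr A (l2, l1, l1 + l2) a = a2" "b \<in> el B (l1 + l2)" "restr B (l1, 0, l1 + l2) b = b1"
    "restr B (l2, l1, l1 + l2) b = b2"
    using sheaf_gluing[OF A, of a1 l1 a2 l2] sheaf_gluing[OF B, of b1 l1 b2 l2] 4(5) by auto
  then show ?case by (intro bexI[of _ "Two a b"]) (auto simp: x)
next
  case (5 l1 l2 x y)
  then show ?case by (auto intro: sheaf_separated[OF A] sheaf_separated[OF B])
next
  case (1 t x)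
  then show ?case using restr_el[OF A 1(1)] restr_el[OF B 1(1)] by auto
next
  case (2 l x)
  then show ?case by (auto simp: restr_idn[OF A] restr_idn[OF B])
next
  case (3 s t x)
  then show ?case by (auto simp: restr_restr[OF A] restr_restr[OF B])
qed

text \<open>A signal assigns to each wire in \<open>T\<close> an element of its type, and is undefined on all other labels;
  \<open>Fam\<close> identifies the signals with the elements of \<open>tset_prod T\<close>.\<close>

definition sig :: "('i, 'u psh) tset \<Rightarrow> real \<Rightarrow> ('i lbl \<Rightarrow> 'u option) set" where
  "sig T l = {s. dom s = Elts T \<and> (\<forall>i\<in>Elts T. the (s i) \<in> el (Typ T i) l) \<and> 0 \<le> l}"

definition srestr :: "('i, 'u psh) tset \<Rightarrow> real \<times> real \<times> real \<Rightarrow> ('i lbl \<Rightarrow> 'u option) \<Rightarrow> 'i lbl \<Rightarrow> 'u option" where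
  "srestr T t s = (\<lambda>i. map_option (restr (Typ T i) t) (s i))"

lemma sig_nonneg: "s \<in> sig T l \<Longrightarrow> 0 \<le> l"
  by (simp add: sig_def)

lemma sig_Some: "s \<in> sig T l \<Longrightarrow> i \<in> Elts T \<Longrightarrow> \<exists>x\<in>el (Typ T i) l. s i = Some x"
  by (force simp: sig_def)

lemma sig_None: "s \<in> sig T l \<Longrightarrow> i \<notin> Elts T \<Longrightarrow> s i = None"
  by (auto simp: sig_def)

lemma tset_prod_alt:
  "tset_prod T = mk_psh (\<lambda>l. Fam ` sig T l) (\<lambda>t z. case z of Fam s \<Rightarrow> Fam (srestr T t s))"
proof -
  have *: "{Fam s |s. dom s = Elts T \<and> (\<forall>i\<in>Elts T. the (s i) \<in> FOb (Typ T i) l)} = Fam ` sig T l"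
    if "0 \<le> l" for l
    using that by (auto simp: sig_def el_def)
  show ?thesis
    unfolding tset_prod_def mk_psh_def srestr_def
    by (intro fctr.equality restrict_ext) (simp_all add: * int_cat_ends cong: restrict_cong)
qed

lemma el_tset_prod: "el (tset_prod T) l = Fam ` sig T l"
  by (auto simp: tset_prod_alt sig_def)

lemma restr_tset_prod [simp]:
  "translation t \<Longrightarrow> s \<in> sig T (tgt t) \<Longrightarrow> restr (tset_prod T) t (Fam s) = Fam (srestr T t s)"
  by (simp add: tset_prod_alt)

lemma srestr_sig:
  assumes T: "is_tset int_sheaves T" and t: "translation t" and s: "s \<in> sig T (tgt t)"
  shows "srestr T t s \<in> sig T (src t)"
  unfolding sig_def
proof (intro CollectI conjI ballI)
  show "dom (srestr T t s) = Elts T" using s by (auto simp: sig_def srestr_def dom_def)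
  show "0 \<le> src t" using int_cat_ends[OF t] by simp
  fix i assume i: "i \<in> Elts T"
  with T have "sheaf (Typ T i)" by (auto simp: is_tset_def)
  then show "the (srestr T t s i) \<in> el (Typ T i) (src t)"
    using sig_Some[OF s i] restr_el[of "Typ T i" t] t by (auto simp: srestr_def)
qed

lemma sig_eqI:
  assumes "s \<in> sig T l" "s' \<in> sig T l"
    "\<And>i x x'. i \<in> Elts T \<Longrightarrow> s i = Some x \<Longrightarrow> s' i = Some x' \<Longrightarrow> x \<in> el (Typ T i) l \<Longrightarrow>
      x' \<in> el (Typ T i) l \<Longrightarrow> x = x'"
  shows "s = s'"
proof
  fix i show "s i = s' i"
    using sig_Some[OF assms(1), of i] sig_Some[OF assms(2), of i] sig_None[OF assms(1), of i]
      sig_None[OF assms(2), of i] assms(3)[of i] by (cases "i \<in> Elts T") auto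
qed

lemma sig_separated:
  assumes T: "is_tset int_sheaves T"
    and s: "s \<in> sig T (l1 + l2)" "s' \<in> sig T (l1 + l2)" and l: "0 \<le> l1" "0 \<le> l2"
    and e: "srestr T (l1, 0, l1 + l2) s = srestr T (l1, 0, l1 + l2) s'"
      "srestr T (l2, l1, l1 + l2) s = srestr T (l2, l1, l1 + l2) s'"
  shows "s = s'"
proof (rule sig_eqI[OF s])
  fix i x x' assume i: "i \<in> Elts T" and x: "s i = Some x" "s' i = Some x'"
    and m: "x \<in> el (Typ T i) (l1 + l2)" "x' \<in> el (Typ T i) (l1 + l2)"
  have "sheaf (Typ T i)" using T i by (auto simp: is_tset_def)
  then show "x = x'"
    using fun_cong[OF e(1), of i] fun_cong[OF e(2), of i] x m l
    by (auto simp: srestr_def intro: sheaf_separated)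
qed

lemma sheaf_tset_prod:
  assumes T: "is_tset int_sheaves T"
  shows "sheaf (tset_prod T)"
  unfolding tset_prod_alt
proof (rule sheaf_mk_psh, goal_cases)
  case (1 t x)
  then show ?case using srestr_sig[OF T 1(1)] by auto
next
  case (2 l x)
  then obtain s where s: "x = Fam s" "s \<in> sig T l" by auto
  have "srestr T (l, 0, l) s = s"
  proof
    fix i show "srestr T (l, 0, l) s i = s i"
    proof (cases "i \<in> Elts T")
      case True
      then have "sheaf (Typ T i)" using T by (auto simp: is_tset_def)
      then show ?thesis using sig_Some[OF s(2) True] restr_idn by (auto simp: srestr_def)
    qed (simp add: srestr_def sig_None[OF s(2)])
  qed
  then show ?case by (simp add: s)
next
  case (3 s t x)
  then obtain z where z: "x = Fam z" "z \<in> sig T (tgt t)" by auto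
  have "srestr T s (srestr T t z) = srestr T (t \<odot>\<^bsub>int_cat\<^esub> s) z"
  proof
    fix i show "srestr T s (srestr T t z) i = srestr T (t \<odot>\<^bsub>int_cat\<^esub> s) z i"
    proof (cases "i \<in> Elts T")
      case True
      then have "sheaf (Typ T i)" using T by (auto simp: is_tset_def)
      then show ?thesis using sig_Some[OF z(2) True] restr_restr[OF _ 3(1-3)] by (auto simp: srestr_def)
    qed (simp add: srestr_def sig_None[OF z(2)])
  qed
  then show ?case by (simp add: z)
next
  case (4 l1 l2 x1 x2)
  then obtain s1 s2 where s: "x1 = Fam s1" "x2 = Fam s2" "s1 \<in> sig T l1" "s2 \<in> sig T l2"
    and e: "srestr T (0, l1, l1) s1 = srestr T (0, 0, l2) s2" by auto
  have "\<exists>x. x \<in> el (Typ T i) (l1 + l2) \<and> s1 i = Some (restr (Typ T i) (l1, 0, l1 + l2) x)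
      \<and> s2 i = Some (restr (Typ T i) (l2, l1, l1 + l2) x)" if i: "i \<in> Elts T" for i
  proof -
    obtain a b where ab: "s1 i = Some a" "s2 i = Some b" "a \<in> el (Typ T i) l1" "b \<in> el (Typ T i) l2"
      using sig_Some[OF s(3) i] sig_Some[OF s(4) i] by auto
    moreover have "sheaf (Typ T i)" using T i by (auto simp: is_tset_def)
    ultimately show ?thesis
      using sheaf_gluing[of "Typ T i" a l1 b l2] fun_cong[OF e, of i] by (auto simp: srestr_def)
  qed
  then obtain g where g: "g i \<in> el (Typ T i) (l1 + l2)"
      "s1 i = Some (restr (Typ T i) (l1, 0, l1 + l2) (g i))"
      "s2 i = Some (restr (Typ T i) (l2, l1, l1 + l2) (g i))" if "i \<in> Elts T" for i
    by metis
  define z where "z = (\<lambda>i. if i \<in> Elts T then Some (g i) else None)"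
  have "z \<in> sig T (l1 + l2)"
    using g(1) 4(1,2) by (auto simp: z_def sig_def dom_def)
  moreover have "srestr T (l1, 0, l1 + l2) z = s1" "srestr T (l2, l1, l1 + l2) z = s2"
    using g(2,3) sig_None[OF s(3)] sig_None[OF s(4)] by (auto simp: z_def srestr_def fun_eq_iff)
  ultimately show ?case by (intro bexI[of _ "Fam z"]) (auto simp: s)
next
  case (5 l1 l2 x y)
  then show ?case using sig_separated[OF T, of _ l1 l2] by auto
qed

text \<open>Maps of sheaves are handled only through the functions that they induce on elements:
  \<open>psh_map_eqI\<close> says that these determine the map, and \<open>mk_map_hom\<close> builds a map from them.\<close>

definition ev :: "'u psh_map \<Rightarrow> real \<Rightarrow> 'u \<Rightarrow> 'u" where
  "ev m l = (case m of (X, \<eta>, Y) \<Rightarrow> fst (snd (\<eta> l)))"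

definition mk_map :: "'u psh \<Rightarrow> 'u psh \<Rightarrow> (real \<Rightarrow> 'u \<Rightarrow> 'u) \<Rightarrow> 'u psh_map" where
  "mk_map X Y h = (X, \<lambda>l\<in>Ob int_cat. (FOb X l, restrict (h l) (FOb X l), FOb Y l), Y)"

lemma ar_int_sheaves:
  "m \<in> Ar int_sheaves \<longleftrightarrow> (\<exists>X \<eta> Y. m = (X, \<eta>, Y) \<and> sheaf X \<and> sheaf Y \<and> \<eta> \<in> extensional (Ob int_cat)
    \<and> nat_trans (op_cat int_cat) set_cat X Y \<eta>)"
proof -
  have "Dom psh_cat (X, \<eta>, Y) = X" "Cod psh_cat (X, \<eta>, Y) = Y" for X Y :: "'u psh" and \<eta>
    by (simp_all add: psh_cat_def functor_cat_def)
  then show ?thesis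
    by (cases m)
      (auto simp: int_sheaves_def full_subcat_def psh_cat_def functor_cat_def Let_def op_cat_def)
qed

lemma int_sheaves_simps [simp]:
  "Dom int_sheaves m = fst m" "Cod int_sheaves m = snd (snd m)"
  "Idn int_sheaves X = (X, \<lambda>l\<in>Ob int_cat. Idn set_cat (FOb X l), X)"
  "Cmp int_sheaves (Y', \<theta>, Z) (X, \<eta>, Y) = (X, \<lambda>l\<in>Ob int_cat. \<theta> l \<odot>\<^bsub>set_cat\<^esub> \<eta> l, Z)"
  by (auto simp: int_sheaves_def full_subcat_def psh_cat_def functor_cat_def Let_def op_cat_def
      split: prod.splits)

lemma nat_trans_psh_iff:
  assumes X: "sheaf X" and Y: "sheaf Y"
  shows "nat_trans (op_cat int_cat) set_cat X Y \<eta> \<longleftrightarrow>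
    (\<forall>l\<ge>0. \<exists>h. \<eta> l = (FOb X l, h, FOb Y l) \<and> h \<in> FOb X l \<rightarrow>\<^sub>E FOb Y l)
    \<and> (\<forall>t\<in>Ar int_cat. \<forall>x\<in>el X (tgt t).
        fst (snd (\<eta> (src t))) (restr X t x) = restr Y t (fst (snd (\<eta> (tgt t))) x))"
    (is "_ \<longleftrightarrow> ?hom \<and> ?nat")
proof -
  have 1: "(\<forall>l\<in>Ob (op_cat int_cat). \<eta> l \<in> hom set_cat (FOb X l) (FOb Y l)) \<longleftrightarrow> ?hom"
    by (auto simp: op_cat_def hom_iff) (metis prod_cases3 set_cat_simps(2-4))+
  have 2: "(\<forall>t\<in>Ar (op_cat int_cat). \<eta> (Cod (op_cat int_cat) t) \<odot>\<^bsub>set_cat\<^esub> FAr X t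
      = FAr Y t \<odot>\<^bsub>set_cat\<^esub> \<eta> (Dom (op_cat int_cat) t)) \<longleftrightarrow> ?nat" if ?hom
  proof -
    have "\<eta> (src t) \<odot>\<^bsub>set_cat\<^esub> FAr X t = FAr Y t \<odot>\<^bsub>set_cat\<^esub> \<eta> (tgt t) \<longleftrightarrow>
      (\<forall>x\<in>el X (tgt t).
        fst (snd (\<eta> (src t))) (restr X t x) = restr Y t (fst (snd (\<eta> (tgt t))) x))"
      if t: "translation t" for t
    proof -
      note e = int_cat_ends[OF t]
      obtain h k where "\<eta> (src t) = (FOb X (src t), h, FOb Y (src t))"
        "\<eta> (tgt t) = (FOb X (tgt t), k, FOb Y (tgt t))"
        using \<open>?hom\<close> e by blast
      moreover have "FAr X t = (FOb X (tgt t), restr X t, FOb X (src t))"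
        "FAr Y t = (FOb Y (tgt t), restr Y t, FOb Y (src t))"
        using X Y t by (auto simp: sheaf_iff psh_functor_iff)
      ultimately show ?thesis
        using e by (auto simp: compose_def el_def fun_eq_iff)
    qed
    then show ?thesis by (simp add: op_cat_def)
  qed
  show ?thesis unfolding nat_trans_def using 1 2 by blast
qed

lemma hom_int_sheaves_D:
  assumes "m \<in> hom int_sheaves X Y"
  shows "sheaf X" "sheaf Y" "fst m = X" "snd (snd m) = Y"
    "x \<in> el X l \<Longrightarrow> ev m l x \<in> el Y l"
    "translation t \<Longrightarrow> x \<in> el X (tgt t) \<Longrightarrow>
      ev m (src t) (restr X t x) = restr Y t (ev m (tgt t) x)"
proof -
  obtain \<eta> where m: "m = (X, \<eta>, Y)" "sheaf X" "sheaf Y" "nat_trans (op_cat int_cat) set_cat X Y \<eta>"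
    using assms by (auto simp: hom_iff ar_int_sheaves)
  then show "sheaf X" "sheaf Y" "fst m = X" "snd (snd m) = Y" by auto
  note n = m(4)[unfolded nat_trans_psh_iff[OF m(2,3)]]
  show "ev m l x \<in> el Y l" if x: "x \<in> el X l"
  proof -
    from n x obtain h where "\<eta> l = (FOb X l, h, FOb Y l)" "h \<in> FOb X l \<rightarrow>\<^sub>E FOb Y l"
      by (auto simp: el_def)
    then show ?thesis using x by (auto simp: ev_def m(1) el_def)
  qed
  show "translation t \<Longrightarrow> x \<in> el X (tgt t) \<Longrightarrow>
      ev m (src t) (restr X t x) = restr Y t (ev m (tgt t) x)"
    using n by (auto simp: ev_def m(1))
qed

lemma psh_map_eqI:
  assumes "m \<in> hom int_sheaves X Y" "m' \<in> hom int_sheaves X Y"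
    "\<And>l x. x \<in> el X l \<Longrightarrow> ev m l x = ev m' l x"
  shows "m = m'"
proof -
  obtain \<eta> \<eta>' where m: "m = (X, \<eta>, Y)" "m' = (X, \<eta>', Y)" "sheaf X" "sheaf Y"
    and n: "nat_trans (op_cat int_cat) set_cat X Y \<eta>" "nat_trans (op_cat int_cat) set_cat X Y \<eta>'"
    and ext: "\<eta> \<in> extensional (Ob int_cat)" "\<eta>' \<in> extensional (Ob int_cat)"
    using assms(1,2) by (auto simp: hom_iff ar_int_sheaves)
  have "\<eta> = \<eta>'"
  proof (rule extensionalityI[OF ext])
    fix l assume l: "l \<in> Ob int_cat"
    then obtain h h' where h: "\<eta> l = (FOb X l, h, FOb Y l)" "\<eta>' l = (FOb X l, h', FOb Y l)"
      "h \<in> FOb X l \<rightarrow>\<^sub>E FOb Y l" "h' \<in> FOb X l \<rightarrow>\<^sub>E FOb Y l"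
      using n[unfolded nat_trans_psh_iff[OF m(3,4)]] by (metis int_cat_simps(1) mem_Collect_eq)
    have "h x = h' x" if "x \<in> FOb X l" for x
      using assms(3)[of x l] that l h(1,2) by (simp add: ev_def m el_def)
    then have "h = h'" using h(3,4) by (intro extensionalityI[of h "FOb X l"]) (auto simp: PiE_iff)
    then show "\<eta> l = \<eta>' l" by (simp add: h)
  qed
  then show ?thesis by (simp add: m)
qed

lemma ev_mk_map [simp]: "x \<in> el X l \<Longrightarrow> ev (mk_map X Y h) l x = h l x"
  by (simp add: ev_def mk_map_def el_def)

lemma mk_map_ends [simp]: "fst (mk_map X Y h) = X" "snd (snd (mk_map X Y h)) = Y"
  by (simp_all add: mk_map_def)

lemma mk_map_hom:
  assumes X: "sheaf X" and Y: "sheaf Y"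
    and mem: "\<And>l x. x \<in> el X l \<Longrightarrow> h l x \<in> el Y l"
    and nat: "\<And>t x. translation t \<Longrightarrow> x \<in> el X (tgt t) \<Longrightarrow>
      h (src t) (restr X t x) = restr Y t (h (tgt t) x)"
  shows "mk_map X Y h \<in> hom int_sheaves X Y"
proof -
  have "restrict (h l) (FOb X l) \<in> FOb X l \<rightarrow>\<^sub>E FOb Y l" if "0 \<le> l" for l
    using mem[of _ l] that by (auto simp: el_def)
  moreover have "restr X t x \<in> FOb X (src t)" "x \<in> FOb X (tgt t)"
    if "translation t" "x \<in> el X (tgt t)" for t x
    using restr_el[OF X that] that(2) by (auto simp: el_def)
  ultimately have "nat_trans (op_cat int_cat) set_cat X Y
      (\<lambda>l\<in>Ob int_cat. (FOb X l, restrict (h l) (FOb X l), FOb Y l))"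
    unfolding nat_trans_psh_iff[OF X Y] by (simp add: int_cat_ends nat)
  then show ?thesis using X Y by (auto simp: hom_iff ar_int_sheaves mk_map_def)
qed

lemma ev_idn: "x \<in> el X l \<Longrightarrow> ev (Idn int_sheaves X) l x = x"
  by (simp add: ev_def el_def)

lemma ev_cmp:
  assumes "m \<in> hom int_sheaves X Y" "m' \<in> hom int_sheaves Y Z" "x \<in> el X l"
  shows "ev (m' \<odot>\<^bsub>int_sheaves\<^esub> m) l x = ev m' l (ev m l x)"
proof -
  obtain \<eta> \<theta> where m: "m = (X, \<eta>, Y)" "m' = (Y, \<theta>, Z)" "sheaf X" "sheaf Y" "sheaf Z"
    and n: "nat_trans (op_cat int_cat) set_cat X Y \<eta>" "nat_trans (op_cat int_cat) set_cat Y Z \<theta>"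
    using assms(1,2) by (auto simp: hom_iff ar_int_sheaves)
  obtain h k where "\<eta> l = (FOb X l, h, FOb Y l)" "\<theta> l = (FOb Y l, k, FOb Z l)"
    using n(1)[unfolded nat_trans_psh_iff[OF m(3,4)]] n(2)[unfolded nat_trans_psh_iff[OF m(4,5)]]
      el_nonneg[OF assms(3)] by blast
  then show ?thesis
    using assms(3) by (simp add: ev_def m compose_def el_def)
qed

section \<open>Machines as state spaces with wires\<close>

text \<open>Total selectors in place of pattern matching: functions on states written with them compose by
  rewriting, without case distinctions.\<close>

definition efst :: "('i, 'a) elt \<Rightarrow> ('i, 'a) elt" where "efst z = (case z of Two x y \<Rightarrow> x)"
definition esnd :: "('i, 'a) elt \<Rightarrow> ('i, 'a) elt" where "esnd z = (case z of Two x y \<Rightarrow> y)"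
definition fam :: "('i, 'a) elt \<Rightarrow> 'i lbl \<Rightarrow> ('i, 'a) elt option" where
  "fam z = (case z of Fam s \<Rightarrow> s)"

lemma elt_parts [simp]: "efst (Two x y) = x" "esnd (Two x y) = y" "fam (Fam s) = s"
  by (simp_all add: efst_def esnd_def fam_def)

abbreviation box_prod :: "('i, ('i, 'a) elt psh) box \<Rightarrow> ('i, 'a) elt psh" where
  "box_prod X \<equiv> psh_times (tset_prod (Inp X)) (tset_prod (Out X))"

abbreviation sheaf_box :: "('i, ('i, 'a) elt psh) box \<Rightarrow> bool" where
  "sheaf_box \<equiv> is_box int_sheaves"

abbreviation diagram :: "('i, ('i, 'a) elt psh) wiring \<Rightarrow> bool" where
  "diagram \<equiv> is_wiring int_sheaves"

abbreviation machine :: "('i, ('i, 'a) elt psh) box \<Rightarrow> ('i, 'a) machine \<Rightarrow> bool" where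
  "machine X S \<equiv> S \<in> Ob (box_machines X)"

definition states :: "('i, 'a) machine \<Rightarrow> real \<Rightarrow> ('i, 'a) elt set" where
  "states S l = el (fst S) l"

definition inp :: "('i, 'a) machine \<Rightarrow> real \<Rightarrow> ('i, 'a) elt \<Rightarrow> 'i lbl \<Rightarrow> ('i, 'a) elt option" where
  "inp S l x = fam (efst (ev S l x))"

definition out :: "('i, 'a) machine \<Rightarrow> real \<Rightarrow> ('i, 'a) elt \<Rightarrow> 'i lbl \<Rightarrow> ('i, 'a) elt option" where
  "out S l x = fam (esnd (ev S l x))"

lemma states_nonneg: "x \<in> states S l \<Longrightarrow> 0 \<le> l"
  by (simp add: states_def el_nonneg)

lemma sheaf_box_prod: "sheaf_box X \<Longrightarrow> sheaf (box_prod X)"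
  by (simp add: is_box_def sheaf_psh_times sheaf_tset_prod)

lemma machine_iff: "machine X S \<longleftrightarrow> S \<in> hom int_sheaves (fst S) (box_prod X)"
  by (auto simp: box_machines_def machines_def slice_cat_def hom_iff)

lemma category_box_machines: "category (box_machines X)"
  unfolding box_machines_def machines_def by (intro category_slice_cat category_int_sheaves)

lemma machine_sheaf: "machine X S \<Longrightarrow> sheaf (fst S)"
  unfolding machine_iff by (rule hom_int_sheaves_D(1))

lemma machine_ev:
  assumes S: "machine X S" and x: "x \<in> states S l"
  shows "ev S l x = Two (Fam (inp S l x)) (Fam (out S l x))"
    "inp S l x \<in> sig (Inp X) l" "out S l x \<in> sig (Out X) l"
  using hom_int_sheaves_D(5)[OF S[unfolded machine_iff], of x l] x
  by (auto simp: states_def inp_def out_def el_psh_times el_tset_prod)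

lemma machine_restr:
  assumes S: "machine X S" and t: "translation t" and x: "x \<in> states S (tgt t)"
  shows "inp S (src t) (restr (fst S) t x) = srestr (Inp X) t (inp S (tgt t) x)"
    "out S (src t) (restr (fst S) t x) = srestr (Out X) t (out S (tgt t) x)"
    "restr (fst S) t x \<in> states S (src t)"
proof -
  note e = machine_ev[OF S x]
  have "ev S (src t) (restr (fst S) t x) = restr (box_prod X) t (ev S (tgt t) x)"
    by (rule hom_int_sheaves_D(6)[OF S[unfolded machine_iff] t]) (use x in \<open>simp add: states_def\<close>)
  also have "\<dots> = Two (Fam (srestr (Inp X) t (inp S (tgt t) x)))
      (Fam (srestr (Out X) t (out S (tgt t) x)))"
    using t e by (simp add: el_tset_prod)
  finally show "inp S (src t) (restr (fst S) t x) = srestr (Inp X) t (inp S (tgt t) x)"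
    "out S (src t) (restr (fst S) t x) = srestr (Out X) t (out S (tgt t) x)"
    by (simp_all add: inp_def[of S "src t"] out_def[of S "src t"])
  show "restr (fst S) t x \<in> states S (src t)"
    using x t restr_el[OF machine_sheaf[OF S]] by (simp add: states_def)
qed

definition mk_machine ::
  "('i, ('i, 'a) elt psh) box \<Rightarrow> ('i, 'a) elt psh \<Rightarrow> (real \<Rightarrow> ('i, 'a) elt \<Rightarrow> 'i lbl \<Rightarrow> ('i, 'a) elt option)
    \<Rightarrow> (real \<Rightarrow> ('i, 'a) elt \<Rightarrow> 'i lbl \<Rightarrow> ('i, 'a) elt option) \<Rightarrow> ('i, 'a) machine" where
  "mk_machine X A i o' = mk_map A (box_prod X) (\<lambda>l x. Two (Fam (i l x)) (Fam (o' l x)))"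

lemma mk_machine_simps [simp]:
  "fst (mk_machine X A i o') = A"
  "states (mk_machine X A i o') l = el A l"
  "x \<in> el A l \<Longrightarrow> inp (mk_machine X A i o') l x = i l x"
  "x \<in> el A l \<Longrightarrow> out (mk_machine X A i o') l x = o' l x"
  by (simp_all add: mk_machine_def states_def inp_def out_def)

lemma mk_machine_ob:
  assumes X: "sheaf_box X" and A: "sheaf A"
    and "\<And>l x. x \<in> el A l \<Longrightarrow> i l x \<in> sig (Inp X) l" "\<And>l x. x \<in> el A l \<Longrightarrow> o' l x \<in> sig (Out X) l"
    and "\<And>t x. translation t \<Longrightarrow> x \<in> el A (tgt t) \<Longrightarrow>
      i (src t) (restr A t x) = srestr (Inp X) t (i (tgt t) x)"
    and "\<And>t x. translation t \<Longrightarrow> x \<in> el A (tgt t) \<Longrightarrow>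
      o' (src t) (restr A t x) = srestr (Out X) t (o' (tgt t) x)"
  shows "machine X (mk_machine X A i o')"
  unfolding machine_iff mk_machine_simps unfolding mk_machine_def
  by (rule mk_map_hom[OF A sheaf_box_prod[OF X]]) (auto simp: assms el_psh_times el_tset_prod)

lemma hom_machines:
  "u \<in> hom (box_machines X) S T \<longleftrightarrow> S \<in> Ob (box_machines X) \<and> machine X T \<and>
    (\<exists>h. u = (S, h, T) \<and> h \<in> hom int_sheaves (fst S) (fst T) \<and> T \<odot>\<^bsub>int_sheaves\<^esub> h = S)"
  by (cases u) (auto simp: box_machines_def machines_def slice_cat_def hom_iff)

lemma cmp_machines:
  "(T', k, U) \<odot>\<^bsub>box_machines X\<^esub> (S, h, T) = (S, k \<odot>\<^bsub>int_sheaves\<^esub> h, U)"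
  "Idn (box_machines X) S = (S, Idn int_sheaves (fst S), S)"
  by (simp_all add: box_machines_def machines_def slice_cat_def del: int_sheaves_simps(3,4))

lemma hom_machines_iff:
  assumes S: "machine X S" and T: "machine X T"
    and h: "h \<in> hom int_sheaves (fst S) (fst T)"
  shows "(S, h, T) \<in> hom (box_machines X) S T \<longleftrightarrow> (\<forall>l. \<forall>x\<in>states S l.
    inp T l (ev h l x) = inp S l x \<and> out T l (ev h l x) = out S l x)"
proof -
  note S' = S[unfolded machine_iff] and T' = T[unfolded machine_iff]
  have Th: "T \<odot>\<^bsub>int_sheaves\<^esub> h \<in> hom int_sheaves (fst S) (box_prod X)"
    using category.cmp_hom[OF category_int_sheaves, of h T] h T' by (auto simp: hom_iff)
  have "(S, h, T) \<in> hom (box_machines X) S T \<longleftrightarrow> T \<odot>\<^bsub>int_sheaves\<^esub> h = S"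
    using S T h by (auto simp: hom_machines)
  also have "\<dots> \<longleftrightarrow> (\<forall>l. \<forall>x\<in>states S l. ev (T \<odot>\<^bsub>int_sheaves\<^esub> h) l x = ev S l x)"
    using psh_map_eqI[OF Th S'] by (auto simp: states_def)
  also have "\<dots> \<longleftrightarrow> (\<forall>l. \<forall>x\<in>states S l. inp T l (ev h l x) = inp S l x \<and> out T l (ev h l x) = out S l x)"
  proof (intro iff_allI ball_cong refl)
    fix l x assume x: "x \<in> states S l"
    have "ev h l x \<in> states T l" using hom_int_sheaves_D(5)[OF h] x by (simp add: states_def)
    moreover have "ev (T \<odot>\<^bsub>int_sheaves\<^esub> h) l x = ev T l (ev h l x)"
      by (rule ev_cmp[OF h T']) (use x in \<open>simp add: states_def\<close>)
    ultimately show "ev (T \<odot>\<^bsub>int_sheaves\<^esub> h) l x = ev S l x \<longleftrightarrow>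
        inp T l (ev h l x) = inp S l x \<and> out T l (ev h l x) = out S l x"
      by (simp add: machine_ev(1)[OF S x] machine_ev(1)[OF T])
  qed
  finally show ?thesis .
qed

definition act :: "('i, 'a) machine_map \<Rightarrow> real \<Rightarrow> ('i, 'a) elt \<Rightarrow> ('i, 'a) elt" where
  "act u = ev (fst (snd u))"

text \<open>The function \<open>h\<close> is only required to be correct on states. Keeping it as a separate argument,
  instead of computing it from the arrow, lets the action of a composite be derived from its
  syntax alone, with no membership conditions to discharge along the way.\<close>

definition acts ::
  "('i, ('i, 'a) elt psh) box \<Rightarrow> ('i, 'a) machine \<Rightarrow> ('i, 'a) machine \<Rightarrow> ('i, 'a) machine_map
    \<Rightarrow> (real \<Rightarrow> ('i, 'a) elt \<Rightarrow> ('i, 'a) elt) \<Rightarrow> bool" where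
  "acts X S T u h \<longleftrightarrow> u \<in> hom (box_machines X) S T \<and> (\<forall>l. \<forall>x\<in>states S l. act u l x = h l x)"

definition mk_arrow ::
  "('i, 'a) machine \<Rightarrow> ('i, 'a) machine \<Rightarrow> (real \<Rightarrow> ('i, 'a) elt \<Rightarrow> ('i, 'a) elt) \<Rightarrow> ('i, 'a) machine_map" where
  "mk_arrow S T h = (S, mk_map (fst S) (fst T) h, T)"

lemma acts_hom: "acts X S T u h \<Longrightarrow> u \<in> hom (box_machines X) S T"
  by (simp add: acts_def)

lemma acts_act: "u \<in> hom (box_machines X) S T \<Longrightarrow> acts X S T u (act u)"
  by (simp add: acts_def)

lemma acts_ends:
  assumes "acts X S T u h"
  shows "machine X S" "machine X T" "fst u = S" "snd (snd u) = T"
  using assms by (auto simp: acts_def hom_machines)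

lemma acts_state:
  assumes "acts X S T u h" and x: "x \<in> states S l"
  shows "h l x \<in> states T l" "inp T l (h l x) = inp S l x" "out T l (h l x) = out S l x"
proof -
  obtain m where m: "u = (S, m, T)" "m \<in> hom int_sheaves (fst S) (fst T)"
    "machine X S" "machine X T" "u \<in> hom (box_machines X) S T"
    using assms by (auto simp: acts_def hom_machines)
  have h: "h l x = ev m l x" using assms by (simp add: acts_def act_def m)
  show "h l x \<in> states T l" using hom_int_sheaves_D(5)[OF m(2)] x by (simp add: states_def h)
  show "inp T l (h l x) = inp S l x" "out T l (h l x) = out S l x"
    using m(5) hom_machines_iff[OF m(3,4,2)] x by (auto simp: h m(1))
qed

lemma acts_restr:
  assumes "acts X S T u h" and t: "translation t" and x: "x \<in> states S (tgt t)"
  shows "h (src t) (restr (fst S) t x) = restr (fst T) t (h (tgt t) x)"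
proof -
  obtain m where m: "u = (S, m, T)" "m \<in> hom int_sheaves (fst S) (fst T)"
    using assms by (auto simp: acts_def hom_machines)
  have "restr (fst S) t x \<in> states S (src t)"
    by (rule machine_restr(3)[OF acts_ends(1)[OF assms(1)] t x])
  then show ?thesis
    using assms hom_int_sheaves_D(6)[OF m(2) t, of x] by (simp add: acts_def act_def m(1) states_def)
qed

lemma acts_mk_arrow:
  assumes S: "machine X S" and T: "machine X T"
    and mem: "\<And>l x. x \<in> states S l \<Longrightarrow> h l x \<in> states T l"
    and inp: "\<And>l x. x \<in> states S l \<Longrightarrow> inp T l (h l x) = inp S l x"
    and out: "\<And>l x. x \<in> states S l \<Longrightarrow> out T l (h l x) = out S l x"
    and nat: "\<And>t x. translation t \<Longrightarrow> x \<in> states S (tgt t) \<Longrightarrow>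
      h (src t) (restr (fst S) t x) = restr (fst T) t (h (tgt t) x)"
  shows "acts X S T (mk_arrow S T h) h"
proof -
  have h: "mk_map (fst S) (fst T) h \<in> hom int_sheaves (fst S) (fst T)"
    by (rule mk_map_hom[OF machine_sheaf[OF S] machine_sheaf[OF T]])
      (use mem nat in \<open>auto simp: states_def\<close>)
  have "mk_arrow S T h \<in> hom (box_machines X) S T"
    unfolding mk_arrow_def hom_machines_iff[OF S T h] using inp out by (simp add: states_def)
  then show ?thesis by (simp add: acts_def act_def mk_arrow_def states_def)
qed

lemma acts_idn:
  assumes "machine X S"
  shows "acts X S S (Idn (box_machines X) S) (\<lambda>l x. x)"
  using category.idn_hom[OF category_box_machines assms] ev_idn
  unfolding acts_def by (auto simp: act_def cmp_machines states_def simp del: int_sheaves_simps)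

lemma acts_cmp:
  assumes "acts X S T u h" "acts X T U v k"
  shows "acts X S U (v \<odot>\<^bsub>box_machines X\<^esub> u) (\<lambda>l x. k l (h l x))"
proof -
  obtain m n where m: "u = (S, m, T)" "m \<in> hom int_sheaves (fst S) (fst T)"
    and n: "v = (T, n, U)" "n \<in> hom int_sheaves (fst T) (fst U)"
    using assms by (auto simp: acts_def hom_machines)
  have "v \<odot>\<^bsub>box_machines X\<^esub> u \<in> hom (box_machines X) S U"
    using category.cmp_hom[OF category_box_machines, of u X v] assms by (auto simp: acts_def hom_iff)
  moreover have "act (v \<odot>\<^bsub>box_machines X\<^esub> u) l x = k l (h l x)" if x: "x \<in> states S l" for l x
    using ev_cmp[OF m(2) n(2), of x l] x acts_state(1)[OF assms(1) x] assms
    by (simp add: act_def m(1) n(1) cmp_machines states_def acts_def)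
  ultimately show ?thesis by (simp add: acts_def)
qed

lemma acts_eqI:
  assumes "acts X S T u h" "acts X S T v k" "\<And>l x. x \<in> states S l \<Longrightarrow> h l x = k l x"
  shows "u = v"
proof -
  obtain m n where m: "u = (S, m, T)" "m \<in> hom int_sheaves (fst S) (fst T)"
    and n: "v = (S, n, T)" "n \<in> hom int_sheaves (fst S) (fst T)"
    using assms by (auto simp: acts_def hom_machines)
  have "m = n"
    by (rule psh_map_eqI[OF m(2) n(2)]) (use assms in \<open>auto simp: acts_def act_def m(1) n(1) states_def\<close>)
  then show ?thesis by (simp add: m n)
qed

lemma acts_cong:
  "acts X S T u h \<Longrightarrow> (\<And>l x. x \<in> states S l \<Longrightarrow> h l x = k l x) \<Longrightarrow> acts X S T u k"
  by (simp add: acts_def)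

text \<open>The pointwise inverse of a bijective arrow is automatically compatible with restriction and
  preserves signals, hence it is an arrow.\<close>

lemma acts_bij:
  assumes u: "acts X S T u h"
    and k: "\<And>l y. y \<in> states T l \<Longrightarrow> k l y \<in> states S l \<and> h l (k l y) = y"
    and kh: "\<And>l x. x \<in> states S l \<Longrightarrow> k l (h l x) = x"
  shows "is_iso (box_machines X) u" "acts X T S (inv_ar (box_machines X) u) k"
proof -
  note S = acts_ends(1)[OF u] and T = acts_ends(2)[OF u]
  let ?v = "mk_arrow T S k"
  have v: "acts X T S ?v k"
  proof (rule acts_mk_arrow[OF T S])
    fix l x assume x: "x \<in> states T l"
    then show "k l x \<in> states S l" using k by blast
    show "inp S l (k l x) = inp T l x" "out S l (k l x) = out T l x"
      using acts_state(2,3)[OF u, of "k l x" l] k x by auto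
  next
    fix t x assume t: "translation t" and x: "x \<in> states T (tgt t)"
    then have y: "k (tgt t) x \<in> states S (tgt t)"
      "h (tgt t) (k (tgt t) x) = x"
      using k by auto
    show "k (src t) (restr (fst T) t x) = restr (fst S) t (k (tgt t) x)"
      using kh[OF machine_restr(3)[OF S t y(1)]] acts_restr[OF u t y(1)] y(2) by simp
  qed
  have "?v \<odot>\<^bsub>box_machines X\<^esub> u = Idn (box_machines X) S"
    by (rule acts_eqI[OF acts_cmp[OF u v] acts_idn[OF S]]) (simp add: kh)
  moreover have "u \<odot>\<^bsub>box_machines X\<^esub> ?v = Idn (box_machines X) T"
    by (rule acts_eqI[OF acts_cmp[OF v u] acts_idn[OF T]]) (simp add: k)
  ultimately have i: "inverse_pair (box_machines X) u ?v"
    using acts_hom[OF u] acts_hom[OF v] by (simp add: inverse_pair_def hom_iff)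
  then show "is_iso (box_machines X) u" unfolding is_iso_def by blast
  show "acts X T S (inv_ar (box_machines X) u) k"
    using v category.inv_ar_eq[OF category_box_machines i] by simp
qed

section \<open>Wiring up, parallel composition and the unit machine\<close>

definition osum :: "('i lbl \<Rightarrow> 'v option) \<Rightarrow> ('i lbl \<Rightarrow> 'v option) \<Rightarrow> 'i lbl \<Rightarrow> 'v option" where
  "osum s s' = (\<lambda>x. case x of InL i \<Rightarrow> s i | InR j \<Rightarrow> s' j | Pt _ \<Rightarrow> None)"

lemma osum_simps [simp]:
  "osum s s' (InL i) = s i" "osum s s' (InR j) = s' j" "osum s s' (Pt a) = None"
  "osum s s' \<circ> InL = s" "osum s s' \<circ> InR = s'"
  by (auto simp: osum_def)

lemma osum_eqI:
  assumes "\<And>i. z (InL i) = s i" "\<And>j. z (InR j) = s' j" "\<And>a. z (Pt a) = None"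
  shows "z = osum s s'"
  using assms by (auto simp: fun_eq_iff osum_def split: lbl.split)

lemma osum_eq_iff [simp]: "osum a b = osum c d \<longleftrightarrow> a = c \<and> b = d"
  by (metis osum_simps(4,5))

lemma dom_osum: "dom (osum s s') = InL ` dom s \<union> InR ` dom s'"
proof (rule set_eqI)
  fix x show "x \<in> dom (osum s s') \<longleftrightarrow> x \<in> InL ` dom s \<union> InR ` dom s'"
    by (cases x) auto
qed

lemma osum_sig: "s \<in> sig A l \<Longrightarrow> s' \<in> sig B l \<Longrightarrow> osum s s' \<in> sig (tsum A B) l"
  by (auto simp: sig_def dom_osum)

lemma sig_tsum:
  assumes "z \<in> sig (tsum A B) l"
  shows "z \<circ> InL \<in> sig A l" "z \<circ> InR \<in> sig B l" "osum (z \<circ> InL) (z \<circ> InR) = z"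
proof -
  have d: "dom z = InL ` Elts A \<union> InR ` Elts B" using assms by (simp add: sig_def)
  have L: "z (InL i) \<noteq> None \<longleftrightarrow> i \<in> Elts A" and R: "z (InR i) \<noteq> None \<longleftrightarrow> i \<in> Elts B"
    and P: "z (Pt a) = None" for i a
    using d by (auto simp: set_eq_iff dom_def)
  show "z \<circ> InL \<in> sig A l" "z \<circ> InR \<in> sig B l"
    using assms L R ball_Un[of "InL ` Elts A" "InR ` Elts B" "\<lambda>i. the (z i) \<in> el (Typ (tsum A B) i) l"]
    by (auto simp: sig_def dom_def)
  show "osum (z \<circ> InL) (z \<circ> InR) = z"
    by (rule osum_eqI[symmetric]) (auto simp: P)
qed

lemma srestr_osum [simp]: "srestr (tsum A B) t (osum s s') = osum (srestr A t s) (srestr B t s')"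
  by (rule osum_eqI) (simp_all add: srestr_def)

lemma srestr_comp [simp]:
  "srestr (tsum A B) t z \<circ> InL = srestr A t (z \<circ> InL)"
  "srestr (tsum A B) t z \<circ> InR = srestr B t (z \<circ> InR)"
  by (auto simp: srestr_def)

lemma sig_tempty: "s \<in> sig tempty l \<longleftrightarrow> 0 \<le> l \<and> s = (\<lambda>_. None)"
  by (auto simp: sig_def)

text \<open>\<open>wire f o' y\<close> is the signal that reaches the inner box of \<open>f\<close> when the inner box emits \<open>o'\<close> and the
  outer box receives \<open>y\<close>; \<open>wire_out f o'\<close> is what the outer box then emits.\<close>

definition wire :: "('i, 'o) wiring \<Rightarrow> ('i lbl \<Rightarrow> 'v option) \<Rightarrow> ('i lbl \<Rightarrow> 'v option) \<Rightarrow> 'i lbl \<Rightarrow> 'v option" where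
  "wire f o' y = (\<lambda>i. if i \<in> Elts (Inp (wdom f)) then osum o' y (win f i) else None)"

definition wire_out :: "('i, 'o) wiring \<Rightarrow> ('i lbl \<Rightarrow> 'v option) \<Rightarrow> 'i lbl \<Rightarrow> 'v option" where
  "wire_out f o' = (\<lambda>i. if i \<in> Elts (Out (wcod f)) then o' (wout f i) else None)"

lemma wire_sig:
  assumes f: "is_wiring C f" and o': "o' \<in> sig (Out (wdom f)) l" and y: "y \<in> sig (Inp (wcod f)) l"
  shows "wire f o' y \<in> sig (Inp (wdom f)) l"
proof -
  have *: "\<exists>v\<in>el (Typ (Inp (wdom f)) i) l. wire f o' y i = Some v" if i: "i \<in> Elts (Inp (wdom f))" for i
    using f i
  proof (cases rule: win_cases)
    case (out z)
    then show ?thesis using sig_Some[OF o' out(1)] i by (auto simp: wire_def)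
  next
    case (inp z)
    then show ?thesis using sig_Some[OF y inp(1)] i by (auto simp: wire_def)
  qed
  then have "dom (wire f o' y) = Elts (Inp (wdom f))"
    by (auto simp: dom_def wire_def split: if_splits)
  then show ?thesis using * sig_nonneg[OF y] by (force simp: sig_def)
qed

lemma wire_out_sig:
  assumes f: "is_wiring C f" and o': "o' \<in> sig (Out (wdom f)) l"
  shows "wire_out f o' \<in> sig (Out (wcod f)) l"
proof -
  have *: "\<exists>v\<in>el (Typ (Out (wcod f)) i) l. wire_out f o' i = Some v" if i: "i \<in> Elts (Out (wcod f))" for i
    using sig_Some[OF o' wout_mem(1)[OF f i]] wout_mem(2)[OF f i] i by (simp add: wire_out_def)
  then have "dom (wire_out f o') = Elts (Out (wcod f))"
    by (auto simp: dom_def wire_out_def split: if_splits)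
  then show ?thesis using * sig_nonneg[OF o'] by (force simp: sig_def)
qed

lemma srestr_wire:
  assumes f: "is_wiring C f"
  shows "srestr (Inp (wdom f)) t (wire f o' y)
    = wire f (srestr (Out (wdom f)) t o') (srestr (Inp (wcod f)) t y)"
proof
  fix i show "srestr (Inp (wdom f)) t (wire f o' y) i
    = wire f (srestr (Out (wdom f)) t o') (srestr (Inp (wcod f)) t y) i"
  proof (cases "i \<in> Elts (Inp (wdom f))")
    case True
    with f show ?thesis by (cases rule: win_cases) (simp_all add: True wire_def srestr_def)
  qed (simp add: wire_def srestr_def)
qed

lemma srestr_wire_out:
  assumes f: "is_wiring C f"
  shows "srestr (Out (wcod f)) t (wire_out f o') = wire_out f (srestr (Out (wdom f)) t o')"
  using wout_mem[OF f] by (auto simp: wire_out_def srestr_def)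

lemma wire_out_comp:
  assumes "is_wiring C g" "wcod f = wdom g"
  shows "wire_out (wiring_comp g f) o' = wire_out g (wire_out f o')"
  using wout_mem(1)[OF assms(1)] assms(2) by (auto simp: wire_out_def wout_wiring_comp)

text \<open>The composite of wirings first lets \<open>g\<close> determine the signal that enters the middle box, and then \<open>f\<close>
  the one that enters the inner box. This is why the middle signal in a state of \<open>g\<^sub>* f\<^sub>* S\<close> is redundant.\<close>

lemma wire_comp:
  assumes f: "is_wiring C f" and g: "is_wiring C g" and fg: "wcod f = wdom g"
  shows "wire (wiring_comp g f) o' z = wire f o' (wire g (wire_out f o') z)"
proof
  fix i show "wire (wiring_comp g f) o' z i = wire f o' (wire g (wire_out f o') z) i"
  proof (cases "i \<in> Elts (Inp (wdom f))")
    case True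
    with f show ?thesis
    proof (cases rule: win_cases)
      case (inp w)
      then have w: "w \<in> Elts (Inp (wdom g))" by (simp add: fg)
      with g show ?thesis
        by (cases rule: win_cases)
          (use inp(2) w True fg in \<open>simp_all add: wire_def wire_out_def win_wiring_comp\<close>)
    qed (simp add: True wire_def win_wiring_comp)
  qed (simp add: wire_def)
qed

lemma wire_sum:
  assumes f: "is_wiring C f" and g: "is_wiring C g"
  shows "wire (wiring_sum f g) (osum o1 o2) y = osum (wire f o1 (y \<circ> InL)) (wire g o2 (y \<circ> InR))"
proof (rule osum_eqI)
  fix i
  show "wire (wiring_sum f g) (osum o1 o2) y (InL i) = wire f o1 (y \<circ> InL) i"
  proof (cases "i \<in> Elts (Inp (wdom f))")
    case True
    with f show ?thesis by (cases rule: win_cases) (simp_all add: True wire_def)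
  qed (auto simp: wire_def)
  show "wire (wiring_sum f g) (osum o1 o2) y (InR i) = wire g o2 (y \<circ> InR) i"
  proof (cases "i \<in> Elts (Inp (wdom g))")
    case True
    with g show ?thesis by (cases rule: win_cases) (simp_all add: True wire_def)
  qed (auto simp: wire_def)
qed (auto simp: wire_def)

lemma wire_out_sum:
  "wire_out (wiring_sum f g) (osum o1 o2) = osum (wire_out f o1) (wire_out g o2)"
  by (rule osum_eqI) (auto simp: wire_out_def)

lemma wire_relabel:
  "wire (relabel X Y a b) o' y = (\<lambda>i. if i \<in> Elts (Inp X) then y (a i) else None)"
  "wire_out (relabel X Y a b) o' = (\<lambda>i. if i \<in> Elts (Out Y) then o' (b i) else None)"
  by (auto simp: wire_def wire_out_def)

lemma wire_idn:
  "y \<in> sig (Inp X) l \<Longrightarrow> wire (id_wiring X) o' y = y"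
  "z \<in> sig (Out X) l \<Longrightarrow> wire_out (id_wiring X) z = z"
  by (auto simp: wire_relabel sig_None image_iff)

lemma wire_assoc:
  assumes y: "y \<in> sig (tsum (Inp X) (tsum (Inp Y) (Inp Z))) l"
  shows "wire (assoc_wiring X Y Z) o' y
    = osum (osum (y \<circ> InL) (y \<circ> InR \<circ> InL)) (y \<circ> InR \<circ> InR)"
proof (rule osum_eqI)
  fix j
  show "wire (assoc_wiring X Y Z) o' y (InL j)
    = osum (y \<circ> InL) (y \<circ> InR \<circ> InL) j"
    using y by (cases j) (auto simp: wire_relabel lassoc_def sig_None image_iff)
qed (use y in \<open>auto simp: wire_relabel lassoc_def sig_None image_iff\<close>)

lemma wire_out_assoc:
  assumes "a \<in> sig (Out X) l" "b \<in> sig (Out Y) l" "c \<in> sig (Out Z) l"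
  shows "wire_out (assoc_wiring X Y Z)
      (osum (osum a b) c) = osum a (osum b c)"
proof (rule osum_eqI)
  fix j
  show "wire_out (assoc_wiring X Y Z)
      (osum (osum a b) c) (InR j) = osum b c j"
    using assms by (cases j) (auto simp: wire_relabel lassoc'_def sig_None image_iff)
qed (use assms in \<open>auto simp: wire_relabel lassoc'_def sig_None image_iff\<close>)

lemma wire_swap:
  assumes y: "y \<in> sig (tsum (Inp Y) (Inp X)) l"
  shows "wire (swap_wiring X Y) o' y
    = osum (y \<circ> InR) (y \<circ> InL)"
  using y by (intro osum_eqI) (auto simp: wire_relabel sig_None image_iff)

lemma wire_out_swap:
  assumes "a \<in> sig (Out X) l" "b \<in> sig (Out Y) l"
  shows "wire_out (swap_wiring X Y) (osum a b)
    = osum b a"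
  using assms by (intro osum_eqI) (auto simp: wire_relabel sig_None image_iff)

lemma wire_left_unit:
  assumes "y \<in> sig (Inp X) l"
  shows "wire (left_unit_wiring X) o' y
    = osum (\<lambda>_. None) y"
  using assms by (intro osum_eqI) (auto simp: wire_relabel sig_None image_iff)

lemma wire_out_left_unit:
  assumes "b \<in> sig (Out X) l"
  shows "wire_out (left_unit_wiring X)
    (osum a b) = b"
  using assms by (auto simp: wire_relabel sig_None image_iff)

lemma wire_right_unit:
  assumes "y \<in> sig (Inp X) l"
  shows "wire (right_unit_wiring X) o' y
    = osum y (\<lambda>_. None)"
  using assms by (intro osum_eqI) (auto simp: wire_relabel sig_None image_iff)

lemma wire_out_right_unit:
  assumes "a \<in> sig (Out X) l"
  shows "wire_out (right_unit_wiring X)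
    (osum a b) = a"
  using assms by (auto simp: wire_relabel sig_None image_iff)

text \<open>The pullback of \<open>S\<close> along the map \<open>(y, o') \<mapsto> (wire f o' y, o')\<close> on signals; the component \<open>o'\<close> is the
  output of the state and is left out.\<close>

definition wired :: "('i, ('i, 'a) elt psh) wiring \<Rightarrow> ('i, 'a) machine \<Rightarrow> ('i, 'a) machine" where
  "wired f S = mk_machine (wcod f)
    (psh_sub (psh_times (fst S) (tset_prod (Inp (wcod f))))
      (\<lambda>l x. inp S l (efst x) = wire f (out S l (efst x)) (fam (esnd x))))
    (\<lambda>l x. fam (esnd x)) (\<lambda>l x. wire_out f (out S l (efst x)))"

lemma states_wired:
  "x \<in> states (wired f S) l \<longleftrightarrow> (\<exists>s y. x = Two s (Fam y) \<and> s \<in> states S l \<and> y \<in> sig (Inp (wcod f)) l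
    \<and> inp S l s = wire f (out S l s) y)"
  by (auto simp: wired_def el_psh_times el_tset_prod states_def)

lemma wired_wires [simp]:
  assumes "Two s (Fam y) \<in> states (wired f S) l"
  shows "inp (wired f S) l (Two s (Fam y)) = y"
    "out (wired f S) l (Two s (Fam y)) = wire_out f (out S l s)"
  using assms by (simp_all add: wired_def)

lemma restr_wired:
  assumes t: "translation t" and "Two s (Fam y) \<in> states (wired f S) (tgt t)"
  shows "restr (fst (wired f S)) t (Two s (Fam y)) = Two (restr (fst S) t s) (Fam (srestr (Inp (wcod f)) t y))"
  using assms by (auto simp: wired_def el_psh_times el_tset_prod)

text \<open>The feedback equation is stable under restriction because wiring only copies signals (\<open>srestr_wire\<close>),
  and local because both of its sides are signals on the inner box and signals are separated.\<close>

lemma wired_ob: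
  assumes f: "diagram f" and S: "machine (wdom f) S"
  shows "machine (wcod f) (wired f S)"
  unfolding wired_def
proof (rule mk_machine_ob)
  let ?P = "\<lambda>l x. inp S l (efst x) = wire f (out S l (efst x)) (fam (esnd x))"
  let ?A = "psh_times (fst S) (tset_prod (Inp (wcod f)))"
  have X: "sheaf_box (wdom f)" and Y: "sheaf_box (wcod f)"
    using f by (auto simp: is_wiring_def)
  then show "sheaf_box (wcod f)" by simp
  have T: "is_tset int_sheaves (Inp (wcod f))" "is_tset int_sheaves (Inp (wdom f))"
    using X Y by (auto simp: is_box_def)
  have A: "sheaf ?A"
    by (rule sheaf_psh_times[OF machine_sheaf[OF S] sheaf_tset_prod[OF T(1)]])
  have el_A: "x \<in> el ?A l \<longleftrightarrow> (\<exists>s y. x = Two s (Fam y) \<and> s \<in> states S l \<and> y \<in> sig (Inp (wcod f)) l)" for x l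
    by (auto simp: el_psh_times el_tset_prod states_def)
  have restr_A: "restr ?A t (Two s (Fam y)) = Two (restr (fst S) t s) (Fam (srestr (Inp (wcod f)) t y))"
    if "translation t" "s \<in> states S (tgt t)" "y \<in> sig (Inp (wcod f)) (tgt t)" for t s y
    using that by (simp add: states_def el_tset_prod)
  show "sheaf (psh_sub ?A ?P)"
  proof (rule sheaf_psh_sub[OF A])
    fix t x assume "translation t" "x \<in> el ?A (tgt t)" "?P (tgt t) x"
    then show "?P (src t) (restr ?A t x)"
      by (auto simp: el_A restr_A machine_restr[OF S] srestr_wire[OF f])
  next
    fix l1 l2 :: real and x
    assume l: "0 \<le> l1" "0 \<le> l2" and x: "x \<in> el ?A (l1 + l2)"
      and P: "?P l1 (restr ?A (l1, 0, l1 + l2) x)" "?P l2 (restr ?A (l2, l1, l1 + l2) x)"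
    obtain s y where sy: "x = Two s (Fam y)" "s \<in> states S (l1 + l2)" "y \<in> sig (Inp (wcod f)) (l1 + l2)"
      using x by (auto simp: el_A)
    note e = machine_ev(2,3)[OF S sy(2)]
    have t: "(l1, 0, l1 + l2) \<in> Ar int_cat" "(l2, l1, l1 + l2) \<in> Ar int_cat" using l by auto
    \<comment> \<open>both sides have the same restrictions, namely those for which the equation is assumed\<close>
    have "inp S (l1 + l2) s = wire f (out S (l1 + l2) s) y"
    proof (rule sig_separated[OF T(2) e(1) wire_sig[OF f e(2) sy(3)] l])
      show "srestr (Inp (wdom f)) (l1, 0, l1 + l2) (inp S (l1 + l2) s)
        = srestr (Inp (wdom f)) (l1, 0, l1 + l2) (wire f (out S (l1 + l2) s) y)"
        using P(1) sy machine_restr[OF S t(1), of s] restr_A[OF t(1)] srestr_wire[OF f] by simp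
      show "srestr (Inp (wdom f)) (l2, l1, l1 + l2) (inp S (l1 + l2) s)
        = srestr (Inp (wdom f)) (l2, l1, l1 + l2) (wire f (out S (l1 + l2) s) y)"
        using P(2) sy machine_restr[OF S t(2), of s] restr_A[OF t(2)] srestr_wire[OF f] by simp
    qed
    then show "?P (l1 + l2) x" by (simp add: sy)
  qed
  fix l x assume "x \<in> el (psh_sub ?A ?P) l"
  then show "fam (esnd x) \<in> sig (Inp (wcod f)) l" "wire_out f (out S l (efst x)) \<in> sig (Out (wcod f)) l"
    using wire_out_sig[OF f machine_ev(3)[OF S]] by (auto simp: el_A)
next
  let ?P = "\<lambda>l x. inp S l (efst x) = wire f (out S l (efst x)) (fam (esnd x))"
  let ?A = "psh_times (fst S) (tset_prod (Inp (wcod f)))"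
  fix t x assume t: "translation t" and "x \<in> el (psh_sub ?A ?P) (tgt t)"
  then show "fam (esnd (restr (psh_sub ?A ?P) t x)) = srestr (Inp (wcod f)) t (fam (esnd x))"
    "wire_out f (out S (src t) (efst (restr (psh_sub ?A ?P) t x)))
      = srestr (Out (wcod f)) t (wire_out f (out S (tgt t) (efst x)))"
    by (auto simp: el_psh_times el_tset_prod machine_restr[OF S] states_def srestr_wire_out[OF f])
qed

definition wired_arrow :: "('i, ('i, 'a) elt psh) wiring \<Rightarrow> ('i, 'a) machine_map \<Rightarrow> ('i, 'a) machine_map" where
  "wired_arrow f u = mk_arrow (wired f (fst u)) (wired f (snd (snd u)))
    (\<lambda>l x. Two (act u l (efst x)) (esnd x))"

lemma acts_wired_arrow:
  assumes f: "diagram f" and u: "acts (wdom f) S T u h"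
  shows "acts (wcod f) (wired f S) (wired f T) (wired_arrow f u) (\<lambda>l x. Two (h l (efst x)) (esnd x))"
proof -
  note ST = acts_ends[OF u]
  have "acts (wcod f) (wired f S) (wired f T) (wired_arrow f u) (\<lambda>l x. Two (act u l (efst x)) (esnd x))"
    unfolding wired_arrow_def ST(3,4)
  proof (rule acts_mk_arrow)
    note u' = acts_act[OF acts_hom[OF u]]
    have mem: "Two (act u l s) (Fam y) \<in> states (wired f T) l"
      if "Two s (Fam y) \<in> states (wired f S) l" for l s y
      using that acts_state[OF u'] by (auto simp: states_wired)
    fix l x assume "x \<in> states (wired f S) l"
    then obtain s y where x: "x = Two s (Fam y)" "s \<in> states S l" "x \<in> states (wired f S) l"
      by (auto simp: states_wired)
    then show "Two (act u l (efst x)) (esnd x) \<in> states (wired f T) l" using mem by simp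
    show "inp (wired f T) l (Two (act u l (efst x)) (esnd x)) = inp (wired f S) l x"
      "out (wired f T) l (Two (act u l (efst x)) (esnd x)) = out (wired f S) l x"
      using x mem acts_state(3)[OF u' x(2)] by simp_all
  next
    note u' = acts_act[OF acts_hom[OF u]]
    fix t x assume t: "translation t" "x \<in> states (wired f S) (tgt t)"
    then obtain s y where x: "x = Two s (Fam y)" "s \<in> states S (tgt t)"
      by (auto simp: states_wired)
    have "Two (act u (tgt t) s) (Fam y) \<in> states (wired f T) (tgt t)"
      using t x acts_state[OF u'] by (auto simp: states_wired)
    then show "Two (act u (src t) (efst (restr (fst (wired f S)) t x)))
        (esnd (restr (fst (wired f S)) t x))
      = restr (fst (wired f T)) t (Two (act u (tgt t) (efst x)) (esnd x))"
      using t x acts_restr[OF u' t(1) x(2)] by (simp add: restr_wired)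
  qed (use f ST(1,2) in \<open>simp_all add: wired_ob\<close>)
  then show ?thesis
    by (rule acts_cong) (use u in \<open>auto simp: states_wired acts_def\<close>)
qed

definition par_machine ::
  "('i, ('i, 'a) elt psh) box \<Rightarrow> ('i, ('i, 'a) elt psh) box \<Rightarrow> ('i, 'a) machine \<Rightarrow> ('i, 'a) machine \<Rightarrow> ('i, 'a) machine" where
  "par_machine X Y S T = mk_machine (box_sum X Y) (psh_times (fst S) (fst T))
    (\<lambda>l x. osum (inp S l (efst x)) (inp T l (esnd x))) (\<lambda>l x. osum (out S l (efst x)) (out T l (esnd x)))"

lemma states_par_machine:
  "x \<in> states (par_machine X Y S T) l \<longleftrightarrow> (\<exists>s t. x = Two s t \<and> s \<in> states S l \<and> t \<in> states T l)"
  by (auto simp: par_machine_def el_psh_times states_def)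

lemma par_machine_wires [simp]:
  assumes "s \<in> states S l" "t \<in> states T l"
  shows "inp (par_machine X Y S T) l (Two s t) = osum (inp S l s) (inp T l t)"
    "out (par_machine X Y S T) l (Two s t) = osum (out S l s) (out T l t)"
  using assms by (simp_all add: par_machine_def el_psh_times states_def)

lemma restr_par_machine:
  assumes "translation t" "x \<in> states S (tgt t)" "y \<in> states T (tgt t)"
  shows "restr (fst (par_machine X Y S T)) t (Two x y) = Two (restr (fst S) t x) (restr (fst T) t y)"
  using assms by (simp add: par_machine_def states_def)

lemma par_machine_ob:
  assumes X: "sheaf_box X" and Y: "sheaf_box Y"
    and S: "machine X S" and T: "machine Y T"
  shows "machine (box_sum X Y) (par_machine X Y S T)"
  unfolding par_machine_def
proof (rule mk_machine_ob)
  show "sheaf_box (box_sum X Y)" by (rule is_box_box_sum[OF X Y])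
  show "sheaf (psh_times (fst S) (fst T))"
    by (rule sheaf_psh_times[OF machine_sheaf[OF S] machine_sheaf[OF T]])
next
  fix l x assume "x \<in> el (psh_times (fst S) (fst T)) l"
  then show "osum (inp S l (efst x)) (inp T l (esnd x)) \<in> sig (Inp (box_sum X Y)) l"
    "osum (out S l (efst x)) (out T l (esnd x)) \<in> sig (Out (box_sum X Y)) l"
    using machine_ev(2,3)[OF S] machine_ev(2,3)[OF T]
    by (auto simp: el_psh_times osum_sig states_def)
next
  fix t x assume "translation t" "x \<in> el (psh_times (fst S) (fst T)) (tgt t)"
  then obtain a b where "x = Two a b" "a \<in> states S (tgt t)" "b \<in> states T (tgt t)" "translation t"
    by (auto simp: el_psh_times states_def)
  then show "osum (inp S (src t) (efst (restr (psh_times (fst S) (fst T)) t x)))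
        (inp T (src t) (esnd (restr (psh_times (fst S) (fst T)) t x)))
      = srestr (Inp (box_sum X Y)) t (osum (inp S (tgt t) (efst x)) (inp T (tgt t) (esnd x)))"
    "osum (out S (src t) (efst (restr (psh_times (fst S) (fst T)) t x)))
        (out T (src t) (esnd (restr (psh_times (fst S) (fst T)) t x)))
      = srestr (Out (box_sum X Y)) t (osum (out S (tgt t) (efst x)) (out T (tgt t) (esnd x)))"
    using machine_restr[OF S] machine_restr[OF T] by (simp_all add: states_def)
qed

definition par_arrow ::
  "('i, ('i, 'a) elt psh) box \<Rightarrow> ('i, ('i, 'a) elt psh) box \<Rightarrow> ('i, 'a) machine_map \<Rightarrow> ('i, 'a) machine_map
    \<Rightarrow> ('i, 'a) machine_map" where
  "par_arrow X Y u v = mk_arrow (par_machine X Y (fst u) (fst v)) (par_machine X Y (snd (snd u)) (snd (snd v)))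
    (\<lambda>l x. Two (act u l (efst x)) (act v l (esnd x)))"

lemma acts_par_arrow:
  assumes X: "sheaf_box X" and Y: "sheaf_box Y"
    and u: "acts X S S' u h" and v: "acts Y T T' v k"
  shows "acts (box_sum X Y) (par_machine X Y S T) (par_machine X Y S' T') (par_arrow X Y u v)
    (\<lambda>l x. Two (h l (efst x)) (k l (esnd x)))"
proof -
  note u' = acts_act[OF acts_hom[OF u]] and v' = acts_act[OF acts_hom[OF v]]
  note SS = acts_ends[OF u] and TT = acts_ends[OF v]
  have "acts (box_sum X Y) (par_machine X Y S T) (par_machine X Y S' T') (par_arrow X Y u v)
    (\<lambda>l x. Two (act u l (efst x)) (act v l (esnd x)))"
    unfolding par_arrow_def SS(3,4) TT(3,4)
  proof (rule acts_mk_arrow)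
    fix t x assume t: "translation t" "x \<in> states (par_machine X Y S T) (tgt t)"
    then show "Two (act u (src t) (efst (restr (fst (par_machine X Y S T)) t x)))
         (act v (src t) (esnd (restr (fst (par_machine X Y S T)) t x)))
      = restr (fst (par_machine X Y S' T')) t (Two (act u (tgt t) (efst x)) (act v (tgt t) (esnd x)))"
      using acts_state(1)[OF u'] acts_state(1)[OF v'] acts_restr[OF u' t(1)] acts_restr[OF v' t(1)]
      by (auto simp: states_par_machine restr_par_machine)
  qed (use acts_state[OF u'] acts_state[OF v'] X Y SS TT in
      \<open>auto simp: par_machine_ob states_par_machine\<close>)
  then show ?thesis
    using u v by (elim acts_cong) (auto simp: states_par_machine acts_def)
qed

text \<open>On the empty box a signal is the empty family, so the terminal sheaf serves both as the
  states and, via the identity, as the signals shown.\<close>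

definition unit_machine :: "('i, 'a) machine" where
  "unit_machine = mk_machine unit_box (tset_prod tempty) (\<lambda>l x. fam x) (\<lambda>l x. fam x)"

lemma states_unit_machine: "x \<in> states unit_machine l \<longleftrightarrow> 0 \<le> l \<and> x = Fam (\<lambda>_. None)"
  by (auto simp: unit_machine_def el_tset_prod sig_tempty image_iff)

lemma unit_machine_wires [simp]:
  assumes "0 \<le> l"
  shows "inp unit_machine l (Fam (\<lambda>_. None)) = (\<lambda>_. None)" "out unit_machine l (Fam (\<lambda>_. None)) = (\<lambda>_. None)"
  using assms by (simp_all add: unit_machine_def el_tset_prod sig_tempty image_iff)

lemma unit_machine_ob: "machine unit_box unit_machine"
  unfolding unit_machine_def
  by (rule mk_machine_ob)
    (use sheaf_tset_prod[of tempty] is_box_empty[of int_sheaves] in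
      \<open>auto simp: is_box_def el_tset_prod\<close>)

section \<open>Structural isomorphisms\<close>

text \<open>\<open>((s, y), z) \<mapsto> (s, z)\<close>. The inverse recovers the middle signal \<open>y\<close> as what \<open>g\<close> assembles from the
  output of \<open>f\<^sub>* S\<close> and from \<open>z\<close>.\<close>

definition cmp_arrow ::
  "('i, ('i, 'a) elt psh) wiring \<Rightarrow> ('i, ('i, 'a) elt psh) wiring \<Rightarrow> ('i, 'a) machine \<Rightarrow> ('i, 'a) machine_map" where
  "cmp_arrow g f S = mk_arrow (wired g (wired f S)) (wired (wiring_comp g f) S)
    (\<lambda>l x. Two (efst (efst x)) (esnd x))"

lemma cmp_arrow:
  assumes f: "diagram f" and g: "diagram g" and fg: "wcod f = wdom g"
    and S: "machine (wdom f) S"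
  shows "acts (wcod g) (wired g (wired f S)) (wired (wiring_comp g f) S) (cmp_arrow g f S)
      (\<lambda>l x. Two (efst (efst x)) (esnd x))" (is ?acts)
    and "is_iso (box_machines (wcod g)) (cmp_arrow g f S)" (is ?iso)
    and "acts (wcod g) (wired (wiring_comp g f) S) (wired g (wired f S))
      (inv_ar (box_machines (wcod g)) (cmp_arrow g f S))
      (\<lambda>l x. Two (Two (efst x) (Fam (wire g (wire_out f (out S l (efst x))) (fam (esnd x))))) (esnd x))" (is ?inv)
proof -
  let ?P = "wired g (wired f S)" and ?Q = "wired (wiring_comp g f) S"
  have gf: "diagram (wiring_comp g f)" by (rule is_wiring_comp[OF f g fg])
  have P: "machine (wcod g) ?P" and Q: "machine (wcod g) ?Q"
    using wired_ob[OF g, of "wired f S"] wired_ob[OF f S] wired_ob[OF gf, of S] S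
    by (simp_all add: fg)
  have st_P: "x \<in> states ?P l \<longleftrightarrow> (\<exists>s y z. x = Two (Two s (Fam y)) (Fam z) \<and> s \<in> states S l
      \<and> z \<in> sig (Inp (wcod g)) l \<and> y \<in> sig (Inp (wcod f)) l \<and> inp S l s = wire f (out S l s) y
      \<and> y = wire g (wire_out f (out S l s)) z)" for x l
  proof -
    have "x \<in> states ?P l \<longleftrightarrow> (\<exists>s y z. x = Two (Two s (Fam y)) (Fam z) \<and> Two s (Fam y) \<in> states (wired f S) l
        \<and> z \<in> sig (Inp (wcod g)) l \<and> inp (wired f S) l (Two s (Fam y))
          = wire g (out (wired f S) l (Two s (Fam y))) z)"
      unfolding states_wired[of x g] by (auto simp: states_wired[of _ f])
    also have "\<dots> \<longleftrightarrow> (\<exists>s y z. x = Two (Two s (Fam y)) (Fam z) \<and> Two s (Fam y) \<in> states (wired f S) l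
        \<and> z \<in> sig (Inp (wcod g)) l \<and> y = wire g (wire_out f (out S l s)) z)"
      by (simp cong: conj_cong)
    finally show ?thesis by (auto simp: states_wired)
  qed
  have st_Q: "x \<in> states ?Q l \<longleftrightarrow> (\<exists>s z. x = Two s (Fam z) \<and> s \<in> states S l \<and> z \<in> sig (Inp (wcod g)) l
      \<and> inp S l s = wire f (out S l s) (wire g (wire_out f (out S l s)) z))" for x l
    by (simp add: states_wired wire_comp[OF f g fg])
  show acts: ?acts
    unfolding cmp_arrow_def
  proof (rule acts_mk_arrow[OF P Q])
    fix l x assume x: "x \<in> states ?P l"
    then obtain s y z where sz: "x = Two (Two s (Fam y)) (Fam z)" "Two s (Fam z) \<in> states ?Q l"
      "Two s (Fam y) \<in> states (wired f S) l"
      unfolding st_P st_Q by (auto simp: states_wired)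
    then show "Two (efst (efst x)) (esnd x) \<in> states ?Q l" by simp
    show "inp ?Q l (Two (efst (efst x)) (esnd x)) = inp ?P l x" "out ?Q l (Two (efst (efst x)) (esnd x)) = out ?P l x"
      using sz x by (simp_all add: wire_out_comp[OF g fg])
  next
    fix t x assume t: "translation t" and x: "x \<in> states ?P (tgt t)"
    then obtain s y z where sz: "x = Two (Two s (Fam y)) (Fam z)" "Two s (Fam z) \<in> states ?Q (tgt t)"
      "Two s (Fam y) \<in> states (wired f S) (tgt t)"
      unfolding st_P st_Q by (auto simp: states_wired)
    then show "Two (efst (efst (restr (fst ?P) t x))) (esnd (restr (fst ?P) t x))
        = restr (fst ?Q) t (Two (efst (efst x)) (esnd x))"
      using t x by (simp add: restr_wired)
  qed
  let ?k = "\<lambda>l x. Two (Two (efst x) (Fam (wire g (wire_out f (out S l (efst x))) (fam (esnd x))))) (esnd x)"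
  have "?k l y \<in> states ?P l \<and> Two (efst (efst (?k l y))) (esnd (?k l y)) = y" if y: "y \<in> states ?Q l" for l y
  proof -
    obtain s z where sz: "y = Two s (Fam z)" "s \<in> states S l" "z \<in> sig (Inp (wcod g)) l"
      "inp S l s = wire f (out S l s) (wire g (wire_out f (out S l s)) z)"
      using y unfolding st_Q by blast
    have "wire g (wire_out f (out S l s)) z \<in> sig (Inp (wcod f)) l"
      using wire_sig[OF g _ sz(3), of "wire_out f (out S l s)"] wire_out_sig[OF f machine_ev(3)[OF S sz(2)]]
      by (simp add: fg)
    then show ?thesis using sz by (simp add: st_P)
  qed
  moreover have "?k l (Two (efst (efst x)) (esnd x)) = x" if "x \<in> states ?P l" for l x
    using that unfolding st_P by auto
  ultimately show ?iso ?inv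
    using acts_bij[OF acts, of ?k] by simp_all
qed

text \<open>Under the identity wiring the feedback equation says that the outer signal is the input of \<open>S\<close>.\<close>

definition idn_arrow :: "('i, ('i, 'a) elt psh) box \<Rightarrow> ('i, 'a) machine \<Rightarrow> ('i, 'a) machine_map" where
  "idn_arrow X S = mk_arrow S (wired (id_wiring X) S) (\<lambda>l s. Two s (Fam (inp S l s)))"

lemma idn_arrow:
  assumes X: "sheaf_box X" and S: "machine X S"
  shows "acts X S (wired (id_wiring X) S) (idn_arrow X S) (\<lambda>l s. Two s (Fam (inp S l s)))" (is ?acts)
    and "is_iso (box_machines X) (idn_arrow X S)" (is ?iso)
    and "acts X (wired (id_wiring X) S) S (inv_ar (box_machines X) (idn_arrow X S)) (\<lambda>l x. efst x)" (is ?inv)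
proof -
  let ?Q = "wired (id_wiring X) S"
  have Q: "machine X ?Q"
    using wired_ob[OF is_wiring_id[OF X], of S] S by simp
  have st_Q: "x \<in> states ?Q l \<longleftrightarrow> (\<exists>s. x = Two s (Fam (inp S l s)) \<and> s \<in> states S l)" for x l
    using machine_ev(2)[OF S] by (auto simp: states_wired wire_idn cong: conj_cong)
  show acts: ?acts
    unfolding idn_arrow_def
  proof (rule acts_mk_arrow[OF S Q])
    fix l x assume x: "x \<in> states S l"
    then show m: "Two x (Fam (inp S l x)) \<in> states ?Q l" by (simp add: st_Q)
    then show "inp ?Q l (Two x (Fam (inp S l x))) = inp S l x"
      "out ?Q l (Two x (Fam (inp S l x))) = out S l x"
      using wire_idn(2)[OF machine_ev(3)[OF S x]] by simp_all
  next
    fix t x assume t: "translation t" and x: "x \<in> states S (tgt t)"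
    then have "Two x (Fam (inp S (tgt t) x)) \<in> states ?Q (tgt t)" by (simp add: st_Q)
    then show "Two (restr (fst S) t x) (Fam (inp S (src t) (restr (fst S) t x)))
        = restr (fst ?Q) t (Two x (Fam (inp S (tgt t) x)))"
      using t x by (simp add: restr_wired machine_restr[OF S])
  qed
  have "efst y \<in> states S l \<and> Two (efst y) (Fam (inp S l (efst y))) = y" if "y \<in> states ?Q l" for l y
    using that by (auto simp: st_Q)
  then show ?iso ?inv
    using acts_bij[OF acts, of "\<lambda>l x. efst x"] by simp_all
qed

text \<open>\<open>((s, y), (s', y')) \<mapsto> ((s, s'), y + y')\<close>. The sum of two wirings creates no feedback from one machine to
  the other (\<open>wire_sum\<close>), so the feedback equation for the pair is the conjunction of the two.\<close>

definition interchange_arrow ::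
  "('i, ('i, 'a) elt psh) wiring \<Rightarrow> ('i, ('i, 'a) elt psh) wiring \<Rightarrow> ('i, 'a) machine \<Rightarrow> ('i, 'a) machine
    \<Rightarrow> ('i, 'a) machine_map" where
  "interchange_arrow f g S T = mk_arrow
    (par_machine (wcod f) (wcod g) (wired f S) (wired g T))
    (wired (wiring_sum f g) (par_machine (wdom f) (wdom g) S T))
    (\<lambda>l x. Two (Two (efst (efst x)) (efst (esnd x))) (Fam (osum (fam (esnd (efst x))) (fam (esnd (esnd x))))))"

lemma interchange_arrow:
  assumes f: "diagram f" and g: "diagram g"
    and S: "machine (wdom f) S" and T: "machine (wdom g) T"
  shows "acts (box_sum (wcod f) (wcod g)) (par_machine (wcod f) (wcod g) (wired f S) (wired g T))
      (wired (wiring_sum f g) (par_machine (wdom f) (wdom g) S T)) (interchange_arrow f g S T)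
      (\<lambda>l x. Two (Two (efst (efst x)) (efst (esnd x))) (Fam (osum (fam (esnd (efst x))) (fam (esnd (esnd x))))))" (is ?acts)
    and "is_iso (box_machines (box_sum (wcod f) (wcod g))) (interchange_arrow f g S T)" (is ?iso)
    and "acts (box_sum (wcod f) (wcod g)) (wired (wiring_sum f g) (par_machine (wdom f) (wdom g) S T))
      (par_machine (wcod f) (wcod g) (wired f S) (wired g T))
      (inv_ar (box_machines (box_sum (wcod f) (wcod g))) (interchange_arrow f g S T))
      (\<lambda>l x. Two (Two (efst (efst x)) (Fam (fam (esnd x) \<circ> InL))) (Two (esnd (efst x)) (Fam (fam (esnd x) \<circ> InR))))" (is ?inv)
proof -
  let ?P = "par_machine (wcod f) (wcod g) (wired f S) (wired g T)"
  let ?R = "par_machine (wdom f) (wdom g) S T"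
  let ?Q = "wired (wiring_sum f g) ?R"
  have b: "sheaf_box (wdom f)" "sheaf_box (wcod f)"
    "sheaf_box (wdom g)" "sheaf_box (wcod g)"
    using f g by (auto simp: is_wiring_def)
  have P: "machine (box_sum (wcod f) (wcod g)) ?P"
    by (rule par_machine_ob[OF b(2,4) wired_ob[OF f S] wired_ob[OF g T]])
  have Q: "machine (box_sum (wcod f) (wcod g)) ?Q"
    using wired_ob[OF is_wiring_sum[OF f g], of ?R] par_machine_ob[OF b(1,3) S T] by simp
  have st_P: "x \<in> states ?P l \<longleftrightarrow> (\<exists>s y s' y'. x = Two (Two s (Fam y)) (Two s' (Fam y')) \<and>
      Two s (Fam y) \<in> states (wired f S) l \<and> Two s' (Fam y') \<in> states (wired g T) l)" for x l
    by (auto simp: states_par_machine states_wired)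
  have st_Q: "Two (Two s s') (Fam (osum y y')) \<in> states ?Q l \<longleftrightarrow>
      Two s (Fam y) \<in> states (wired f S) l \<and> Two s' (Fam y') \<in> states (wired g T) l" for s y s' y' l
  proof -
    have "osum y y' \<in> sig (tsum (Inp (wcod f)) (Inp (wcod g))) l \<longleftrightarrow>
        y \<in> sig (Inp (wcod f)) l \<and> y' \<in> sig (Inp (wcod g)) l"
      using sig_tsum(1,2)[of "osum y y'" "Inp (wcod f)" "Inp (wcod g)" l]
        osum_sig[of y "Inp (wcod f)" l y' "Inp (wcod g)"]
      by (simp only: osum_simps) blast
    then show ?thesis
      by (auto simp: states_wired states_par_machine wire_sum[OF f g])
  qed
  have Q_cases: "\<exists>s s' y y'. x = Two (Two s s') (Fam (osum y y'))" if "x \<in> states ?Q l" for x l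
  proof -
    obtain s s' z where x: "x = Two (Two s s') (Fam z)" "z \<in> sig (tsum (Inp (wcod f)) (Inp (wcod g))) l"
      using \<open>x \<in> states ?Q l\<close> by (auto simp: states_wired states_par_machine)
    show ?thesis using sig_tsum(3)[OF x(2)] by (metis x(1))
  qed
  let ?h = "\<lambda>x. Two (Two (efst (efst x)) (efst (esnd x))) (Fam (osum (fam (esnd (efst x))) (fam (esnd (esnd x)))))"
  let ?k = "\<lambda>x. Two (Two (efst (efst x)) (Fam (fam (esnd x) \<circ> InL))) (Two (esnd (efst x)) (Fam (fam (esnd x) \<circ> InR)))"
  show acts: ?acts
    unfolding interchange_arrow_def
  proof (rule acts_mk_arrow[OF P Q])
    fix l x assume x: "x \<in> states ?P l"
    then obtain s y s' y' where xx: "x = Two (Two s (Fam y)) (Two s' (Fam y'))"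
      "Two s (Fam y) \<in> states (wired f S) l" "Two s' (Fam y') \<in> states (wired g T) l"
      unfolding st_P by auto
    show m: "?h x \<in> states ?Q l" using xx by (simp add: st_Q)
    have "s \<in> states S l" "s' \<in> states T l" using xx by (auto simp: states_wired)
    then show "inp ?Q l (?h x) = inp ?P l x" "out ?Q l (?h x) = out ?P l x"
      using xx m by (simp_all add: wire_out_sum)
  next
    fix t x assume t: "translation t" and x: "x \<in> states ?P (tgt t)"
    then obtain s y s' y' where xx: "x = Two (Two s (Fam y)) (Two s' (Fam y'))"
      "Two s (Fam y) \<in> states (wired f S) (tgt t)"
      "Two s' (Fam y') \<in> states (wired g T) (tgt t)"
      unfolding st_P by auto
    then have "Two (Two s s') (Fam (osum y y')) \<in> states ?Q (tgt t)"
      "s \<in> states S (tgt t)" "s' \<in> states T (tgt t)"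
      by (simp_all add: st_Q) (auto simp: states_wired)
    then show "?h (restr (fst ?P) t x) = restr (fst ?Q) t (?h x)"
      using t xx by (simp add: restr_wired restr_par_machine)
  qed
  have "?k y \<in> states ?P l \<and> ?h (?k y) = y" if y: "y \<in> states ?Q l" for l y
  proof -
    obtain s s' z z' where "y = Two (Two s s') (Fam (osum z z'))" using Q_cases[OF y] by blast
    then show ?thesis using y by (simp add: st_P st_Q)
  qed
  moreover have "?k (?h x) = x" if "x \<in> states ?P l" for l x
    using that unfolding st_P by auto
  ultimately show ?iso ?inv
    using acts_bij[OF acts, of "\<lambda>l. ?k"] by simp_all
qed

text \<open>The associator, unit and symmetry isomorphisms in one lemma. When \<open>r\<close> only renames wires, the feedback
  equation can be solved for the outer signal (hypothesis \<open>inp\<close>), so a state of \<open>r\<^sub>* S\<close> amounts to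
  a state of \<open>S\<close>, which \<open>h\<close> rearranges into a state of \<open>T\<close>.\<close>

lemma wired_relabel_iso:
  assumes r: "diagram r" and S: "machine (wdom r) S"
    and T: "machine (wcod r) T"
    and h: "\<And>l s. s \<in> states S l \<Longrightarrow> h s \<in> states T l \<and> k (h s) = s"
    and k: "\<And>l y. y \<in> states T l \<Longrightarrow> k y \<in> states S l \<and> h (k y) = y"
    and inp: "\<And>l s y. s \<in> states S l \<Longrightarrow> y \<in> sig (Inp (wcod r)) l \<Longrightarrow>
      inp S l s = wire r (out S l s) y \<longleftrightarrow> y = inp T l (h s)"
    and out: "\<And>l s. s \<in> states S l \<Longrightarrow> wire_out r (out S l s) = out T l (h s)"
    and nat: "\<And>t s. translation t \<Longrightarrow> s \<in> states S (tgt t) \<Longrightarrow>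
      h (restr (fst S) t s) = restr (fst T) t (h s)"
  defines "u \<equiv> mk_arrow (wired r S) T (\<lambda>l x. h (efst x))"
  shows "acts (wcod r) (wired r S) T u (\<lambda>l x. h (efst x)) \<and> is_iso (box_machines (wcod r)) u"
    (is "?acts \<and> ?iso")
proof -
  let ?P = "wired r S"
  note P = wired_ob[OF r S]
  \<comment> \<open>the outer signal is determined by the state\<close>
  have st_P: "x \<in> states ?P l \<longleftrightarrow> (\<exists>s. x = Two s (Fam (inp T l (h s))) \<and> s \<in> states S l)" for x l
    using inp machine_ev(2)[OF T] h by (fastforce simp: states_wired)
  have acts: ?acts
    unfolding u_def
  proof (rule acts_mk_arrow[OF P T])
    fix l x assume x: "x \<in> states ?P l"
    then obtain s where s: "x = Two s (Fam (inp T l (h s)))" "s \<in> states S l" by (auto simp: st_P)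
    then show "h (efst x) \<in> states T l" "inp T l (h (efst x)) = inp ?P l x" "out T l (h (efst x)) = out ?P l x"
      using h x by (simp_all add: out)
  next
    fix t x assume t: "translation t" and x: "x \<in> states ?P (tgt t)"
    then obtain s where s: "x = Two s (Fam (inp T (tgt t) (h s)))" "s \<in> states S (tgt t)"
      by (auto simp: st_P)
    then show "h (efst (restr (fst ?P) t x)) = restr (fst T) t (h (efst x))"
      using t x by (simp add: restr_wired nat)
  qed
  moreover have ?iso
    by (rule acts_bij(1)[OF acts, of "\<lambda>l y. Two (k y) (Fam (inp T l y))"]) (use h k in \<open>auto simp: st_P\<close>)
  ultimately show ?thesis by simp
qed

lemma sig_tsum_cases:
  assumes "z \<in> sig (tsum A B) l"
  obtains a b where "z = osum a b" "a \<in> sig A l" "b \<in> sig B l"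
  using sig_tsum[OF assms] by metis

definition assoc_arrow where
  "assoc_arrow X Y Z S T U = mk_arrow
    (wired (assoc_wiring X Y Z) (par_machine (box_sum X Y) Z (par_machine X Y S T) U))
    (par_machine X (box_sum Y Z) S (par_machine Y Z T U))
    (\<lambda>l x. Two (efst (efst (efst x))) (Two (esnd (efst (efst x))) (esnd (efst x))))"

lemma assoc_arrow:
  assumes b: "sheaf_box X" "sheaf_box Y" "sheaf_box Z"
    and S: "machine X S" and T: "machine Y T" and U: "machine Z U"
  shows "acts (box_sum X (box_sum Y Z))
      (wired (assoc_wiring X Y Z) (par_machine (box_sum X Y) Z (par_machine X Y S T) U))
      (par_machine X (box_sum Y Z) S (par_machine Y Z T U)) (assoc_arrow X Y Z S T U)
      (\<lambda>l x. Two (efst (efst (efst x))) (Two (esnd (efst (efst x))) (esnd (efst x))))" (is ?acts)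
    and "is_iso (box_machines (box_sum X (box_sum Y Z))) (assoc_arrow X Y Z S T U)" (is ?iso)
proof -
  let ?P = "par_machine (box_sum X Y) Z (par_machine X Y S T) U"
  let ?Q = "par_machine X (box_sum Y Z) S (par_machine Y Z T U)"
  let ?h = "\<lambda>x. Two (efst (efst x)) (Two (esnd (efst x)) (esnd x))"
  let ?k = "\<lambda>x. Two (Two (efst x) (efst (esnd x))) (esnd (esnd x))"
  note c = is_box_box_sum[OF b(1,2)] is_box_box_sum[OF b(2,3)]
  have P: "machine (box_sum (box_sum X Y) Z) ?P"
    by (intro par_machine_ob b c S T U)
  have Q: "machine (box_sum X (box_sum Y Z)) ?Q"
    by (intro par_machine_ob b c S T U)
  have st_P: "x \<in> states ?P l \<longleftrightarrow> (\<exists>s t u. x = Two (Two s t) u \<and> s \<in> states S l \<and> t \<in> states T l \<and> u \<in> states U l)" for x l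
    by (auto simp: states_par_machine)
  have st_Q: "x \<in> states ?Q l \<longleftrightarrow> (\<exists>s t u. x = Two s (Two t u) \<and> s \<in> states S l \<and> t \<in> states T l \<and> u \<in> states U l)" for x l
    by (auto simp: states_par_machine)
  have r: "diagram (assoc_wiring X Y Z)"
    by (rule is_wiring_relabel[OF structural_relabelling(1)[OF b]])
  have "acts (wcod (assoc_wiring X Y Z)) (wired (assoc_wiring X Y Z) ?P) ?Q (assoc_arrow X Y Z S T U)
      (\<lambda>l x. ?h (efst x)) \<and> is_iso (box_machines (wcod (assoc_wiring X Y Z))) (assoc_arrow X Y Z S T U)"
    unfolding assoc_arrow_def
  proof (rule wired_relabel_iso[OF r, where k = ?k and h = ?h])
    fix l s y assume s: "s \<in> states ?P l" and y: "y \<in> sig (Inp (wcod (assoc_wiring X Y Z))) l"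
    then have y': "y \<in> sig (tsum (Inp X) (tsum (Inp Y) (Inp Z))) l" by simp
    obtain y1 z where z: "y = osum y1 z" "z \<in> sig (tsum (Inp Y) (Inp Z)) l"
      using y' by (rule sig_tsum_cases) blast
    obtain y2 y3 where "z = osum y2 y3"
      using z(2) by (rule sig_tsum_cases) blast
    with z have yy: "y = osum y1 (osum y2 y3)" by simp
    show "inp ?P l s = wire (assoc_wiring X Y Z) (out ?P l s) y \<longleftrightarrow> y = inp ?Q l (?h s)"
      using s unfolding wire_assoc[OF y'] by (auto simp: st_P yy states_par_machine comp_assoc)
  next
    fix l s assume "s \<in> states ?P l"
    then show "wire_out (assoc_wiring X Y Z) (out ?P l s) = out ?Q l (?h s)"
      by (auto simp: st_P states_par_machine
          wire_out_assoc[OF machine_ev(3)[OF S] machine_ev(3)[OF T] machine_ev(3)[OF U]])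
  qed (use P Q in \<open>auto simp: st_P st_Q states_par_machine restr_par_machine machine_restr(3)[OF S]
      machine_restr(3)[OF T] machine_restr(3)[OF U]\<close>)
  then show ?acts ?iso by simp_all
qed

definition left_unit_arrow where
  "left_unit_arrow X S = mk_arrow
    (wired (left_unit_wiring X) (par_machine unit_box X unit_machine S)) S (\<lambda>l x. esnd (efst x))"

lemma left_unit_arrow:
  assumes b: "sheaf_box X" and S: "machine X S"
  shows "acts X (wired (left_unit_wiring X) (par_machine unit_box X unit_machine S)) S
      (left_unit_arrow X S) (\<lambda>l x. esnd (efst x))" (is ?acts)
    and "is_iso (box_machines X) (left_unit_arrow X S)" (is ?iso)
proof -
  let ?P = "par_machine unit_box X unit_machine S"
  let ?w = "left_unit_wiring X"
  have P: "machine (box_sum unit_box X) ?P"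
    by (intro par_machine_ob b is_box_empty S unit_machine_ob)
  have st_P: "x \<in> states ?P l \<longleftrightarrow> (\<exists>s. x = Two (Fam (\<lambda>_. None)) s \<and> s \<in> states S l)" for x l
    by (auto simp: states_par_machine states_unit_machine dest: states_nonneg)
  have r: "diagram ?w"
    by (rule is_wiring_relabel[OF structural_relabelling(3)[OF b b b]])
  have "acts (wcod ?w) (wired ?w ?P) S (left_unit_arrow X S) (\<lambda>l x. esnd (efst x))
      \<and> is_iso (box_machines (wcod ?w)) (left_unit_arrow X S)"
    unfolding left_unit_arrow_def
  proof (rule wired_relabel_iso[OF r, where k = "\<lambda>s. Two (Fam (\<lambda>_. None)) s" and h = esnd])
    fix l s y assume s: "s \<in> states ?P l" and "y \<in> sig (Inp (wcod ?w)) l"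
    then have y: "y \<in> sig (Inp X) l" by simp
    obtain s' where s': "s = Two (Fam (\<lambda>_. None)) s'" "s' \<in> states S l" using s by (auto simp: st_P)
    have "0 \<le> l" using sig_nonneg[OF y] .
    then show "inp ?P l s = wire ?w (out ?P l s) y \<longleftrightarrow> y = inp S l (esnd s)"
      unfolding wire_left_unit[OF y] using s' by (auto simp: states_unit_machine)
  next
    fix l s assume s: "s \<in> states ?P l"
    then obtain s' where s': "s = Two (Fam (\<lambda>_. None)) s'" "s' \<in> states S l" by (auto simp: st_P)
    then show "wire_out ?w (out ?P l s) = out S l (esnd s)"
      using states_nonneg[OF s'(2)] by (simp add: states_unit_machine wire_out_left_unit[OF machine_ev(3)[OF S s'(2)]])
  qed (use P S in \<open>auto simp: st_P restr_par_machine states_unit_machine dest: states_nonneg\<close>)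
  then show ?acts ?iso by simp_all
qed

definition right_unit_arrow where
  "right_unit_arrow X S = mk_arrow
    (wired (right_unit_wiring X) (par_machine X unit_box S unit_machine)) S (\<lambda>l x. efst (efst x))"

lemma right_unit_arrow:
  assumes b: "sheaf_box X" and S: "machine X S"
  shows "acts X (wired (right_unit_wiring X) (par_machine X unit_box S unit_machine)) S
      (right_unit_arrow X S) (\<lambda>l x. efst (efst x))" (is ?acts)
    and "is_iso (box_machines X) (right_unit_arrow X S)" (is ?iso)
proof -
  let ?P = "par_machine X unit_box S unit_machine"
  let ?w = "right_unit_wiring X"
  have P: "machine (box_sum X unit_box) ?P"
    by (intro par_machine_ob b is_box_empty S unit_machine_ob)
  have st_P: "x \<in> states ?P l \<longleftrightarrow> (\<exists>s. x = Two s (Fam (\<lambda>_. None)) \<and> s \<in> states S l)" for x l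
    by (auto simp: states_par_machine states_unit_machine dest: states_nonneg)
  have r: "diagram ?w"
    by (rule is_wiring_relabel[OF structural_relabelling(5)[OF b b b]])
  have "acts (wcod ?w) (wired ?w ?P) S (right_unit_arrow X S) (\<lambda>l x. efst (efst x))
      \<and> is_iso (box_machines (wcod ?w)) (right_unit_arrow X S)"
    unfolding right_unit_arrow_def
  proof (rule wired_relabel_iso[OF r, where k = "\<lambda>s. Two s (Fam (\<lambda>_. None))" and h = efst])
    fix l s y assume s: "s \<in> states ?P l" and "y \<in> sig (Inp (wcod ?w)) l"
    then have y: "y \<in> sig (Inp X) l" by simp
    obtain s' where s': "s = Two s' (Fam (\<lambda>_. None))" "s' \<in> states S l" using s by (auto simp: st_P)
    have "0 \<le> l" using sig_nonneg[OF y] .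
    then show "inp ?P l s = wire ?w (out ?P l s) y \<longleftrightarrow> y = inp S l (efst s)"
      unfolding wire_right_unit[OF y] using s' by (auto simp: states_unit_machine)
  next
    fix l s assume s: "s \<in> states ?P l"
    then obtain s' where s': "s = Two s' (Fam (\<lambda>_. None))" "s' \<in> states S l" by (auto simp: st_P)
    then show "wire_out ?w (out ?P l s) = out S l (efst s)"
      using states_nonneg[OF s'(2)] by (simp add: states_unit_machine wire_out_right_unit[OF machine_ev(3)[OF S s'(2)]])
  qed (use P S in \<open>auto simp: st_P restr_par_machine states_unit_machine dest: states_nonneg\<close>)
  then show ?acts ?iso by simp_all
qed

definition swap_arrow where
  "swap_arrow X Y S T = mk_arrow
    (wired (swap_wiring X Y) (par_machine X Y S T)) (par_machine Y X T S)
    (\<lambda>l x. Two (esnd (efst x)) (efst (efst x)))"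

lemma swap_arrow:
  assumes b: "sheaf_box X" "sheaf_box Y"
    and S: "machine X S" and T: "machine Y T"
  shows "acts (box_sum Y X) (wired (swap_wiring X Y) (par_machine X Y S T)) (par_machine Y X T S)
      (swap_arrow X Y S T) (\<lambda>l x. Two (esnd (efst x)) (efst (efst x)))" (is ?acts)
    and "is_iso (box_machines (box_sum Y X)) (swap_arrow X Y S T)" (is ?iso)
proof -
  let ?P = "par_machine X Y S T" and ?Q = "par_machine Y X T S"
  let ?w = "swap_wiring X Y"
  let ?h = "\<lambda>x. Two (esnd x) (efst x)"
  have P: "machine (box_sum X Y) ?P" and Q: "machine (box_sum Y X) ?Q"
    by (intro par_machine_ob b S T)+
  have r: "diagram ?w"
    by (rule is_wiring_relabel[OF structural_relabelling(7)[OF b b(1)]])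
  have "acts (wcod ?w) (wired ?w ?P) ?Q (swap_arrow X Y S T) (\<lambda>l x. ?h (efst x))
      \<and> is_iso (box_machines (wcod ?w)) (swap_arrow X Y S T)"
    unfolding swap_arrow_def
  proof (rule wired_relabel_iso[OF r, where k = ?h and h = ?h])
    fix l s y assume s: "s \<in> states ?P l" and "y \<in> sig (Inp (wcod ?w)) l"
    then have y: "y \<in> sig (tsum (Inp Y) (Inp X)) l" by simp
    then obtain y1 y2 where yy: "y = osum y1 y2" by (rule sig_tsum_cases) blast
    show "inp ?P l s = wire ?w (out ?P l s) y \<longleftrightarrow> y = inp ?Q l (?h s)"
      using s unfolding wire_swap[OF y] by (auto simp: states_par_machine yy)
  next
    fix l s assume "s \<in> states ?P l"
    then show "wire_out ?w (out ?P l s) = out ?Q l (?h s)"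
      by (auto simp: states_par_machine wire_out_swap[OF machine_ev(3)[OF S] machine_ev(3)[OF T]])
  qed (use P Q in \<open>auto simp: states_par_machine restr_par_machine\<close>)
  then show ?acts ?iso by simp_all
qed

section \<open>The algebra of machines\<close>

definition mch :: "(('i, ('i, 'a) elt psh) box, ('i, ('i, 'a) elt psh) wiring,
    ('i, 'a) machine, ('i, 'a) machine_map) lax_data" where
  "mch =
    \<lparr>LOb = box_machines,
     LAr = (\<lambda>f. \<lparr>FOb = wired f, FAr = wired_arrow f\<rparr>),
     LCmp = cmp_arrow,
     LIdn = idn_arrow,
     LTen = (\<lambda>X Y. \<lparr>FOb = (\<lambda>(S, T). par_machine X Y S T), FAr = (\<lambda>(u, v). par_arrow X Y u v)\<rparr>),
     LTenA = (\<lambda>f g (S, T). interchange_arrow f g S T),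
     LUnt = \<lparr>FOb = (\<lambda>_. unit_machine), FAr = (\<lambda>_. Idn (box_machines unit_box) unit_machine)\<rparr>,
     LAsc = (\<lambda>X Y Z ((S, T), U). assoc_arrow X Y Z S T U),
     LLun = (\<lambda>X (_, S). left_unit_arrow X S),
     LRun = (\<lambda>X (S, _). right_unit_arrow X S),
     LBrd = (\<lambda>X Y (S, T). swap_arrow X Y S T)\<rparr>"

lemma mch_simps [simp]:
  "LOb mch = box_machines" "FOb (LAr mch f) = wired f" "FAr (LAr mch f) = wired_arrow f"
  "LCmp mch = cmp_arrow" "LIdn mch = idn_arrow"
  "FOb (LTen mch X Y) (S, T) = par_machine X Y S T" "FAr (LTen mch X Y) (u, v) = par_arrow X Y u v"
  "LTenA mch f g (S, T) = interchange_arrow f g S T"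
  "FOb (LUnt mch) e = unit_machine" "FAr (LUnt mch) e = Idn (box_machines unit_box) unit_machine"
  "LAsc mch X Y Z ((S, T), U) = assoc_arrow X Y Z S T U"
  "LLun mch X (e, S) = left_unit_arrow X S" "LRun mch X (S, e) = right_unit_arrow X S"
  "LBrd mch X Y (S, T) = swap_arrow X Y S T"
  by (simp_all add: mch_def)

section \<open>Functoriality and naturality\<close>

lemma Dom_box_machines [simp]: "Dom (box_machines X) u = fst u" "Cod (box_machines X) u = snd (snd u)"
  by (auto simp: box_machines_def machines_def slice_cat_def split: prod.splits)

lemma ar_box_machines: "u \<in> Ar (box_machines X) \<Longrightarrow> acts X (fst u) (snd (snd u)) u (act u)"
  by (simp add: acts_def hom_iff)

lemma is_functor_machinesI:
  assumes C: "category C"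
    and ob: "\<And>a. a \<in> Ob C \<Longrightarrow> machine X (FOb F a)"
    and ar: "\<And>f. f \<in> Ar C \<Longrightarrow> acts X (FOb F (Dom C f)) (FOb F (Cod C f)) (FAr F f) (h f)"
    and idn: "\<And>a l x. a \<in> Ob C \<Longrightarrow> x \<in> states (FOb F a) l \<Longrightarrow> h (Idn C a) l x = x"
    and cmp: "\<And>f g l x. f \<in> Ar C \<Longrightarrow> g \<in> Ar C \<Longrightarrow> Cod C f = Dom C g \<Longrightarrow> x \<in> states (FOb F (Dom C f)) l \<Longrightarrow>
      h (g \<odot>\<^bsub>C\<^esub> f) l x = h g l (h f l x)"
  shows "is_functor C (box_machines X) F"
  unfolding is_functor_def
proof (intro conjI ballI impI C category_box_machines ob)
  show "FAr F f \<in> hom (box_machines X) (FOb F (Dom C f)) (FOb F (Cod C f))" if "f \<in> Ar C" for f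
    by (rule acts_hom[OF ar[OF that]])
next
  interpret category C by fact
  fix a assume a: "a \<in> Ob C"
  have "acts X (FOb F a) (FOb F a) (FAr F (Idn C a)) (h (Idn C a))"
    using ar[of "Idn C a"] idn_hom[OF a] by (simp add: hom_iff)
  then show "FAr F (Idn C a) = Idn (box_machines X) (FOb F a)"
    by (rule acts_eqI[OF _ acts_idn[OF ob[OF a]]]) (rule idn[OF a])
next
  interpret category C by fact
  fix f g assume fg: "f \<in> Ar C" "g \<in> Ar C" "Cod C f = Dom C g"
  then have gf: "g \<odot>\<^bsub>C\<^esub> f \<in> Ar C" "Dom C (g \<odot>\<^bsub>C\<^esub> f) = Dom C f" "Cod C (g \<odot>\<^bsub>C\<^esub> f) = Cod C g"
    using cmp_hom[OF fg] by (auto simp: hom_iff)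
  have "acts X (FOb F (Dom C f)) (FOb F (Cod C g)) (FAr F (g \<odot>\<^bsub>C\<^esub> f)) (h (g \<odot>\<^bsub>C\<^esub> f))"
    using ar[OF gf(1)] gf by simp
  moreover have "acts X (FOb F (Dom C f)) (FOb F (Cod C g)) (FAr F g \<odot>\<^bsub>box_machines X\<^esub> FAr F f)
      (\<lambda>l x. h g l (h f l x))"
    using acts_cmp[OF ar[OF fg(1)], of _ "FAr F g" "h g"] ar[OF fg(2)] fg(3) by simp
  ultimately show "FAr F (g \<odot>\<^bsub>C\<^esub> f) = FAr F g \<odot>\<^bsub>box_machines X\<^esub> FAr F f"
    by (rule acts_eqI) (rule cmp[OF fg])
qed

lemma nat_iso_machinesI:
  assumes C: "category C"
    and ob: "\<And>a. a \<in> Ob C \<Longrightarrow> acts X (FOb F a) (FOb G a) (\<eta> a) (h a)"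
    and iso: "\<And>a. a \<in> Ob C \<Longrightarrow> is_iso (box_machines X) (\<eta> a)"
    and F: "\<And>f. f \<in> Ar C \<Longrightarrow> acts X (FOb F (Dom C f)) (FOb F (Cod C f)) (FAr F f) (k f)"
    and G: "\<And>f. f \<in> Ar C \<Longrightarrow> acts X (FOb G (Dom C f)) (FOb G (Cod C f)) (FAr G f) (k' f)"
    and nat: "\<And>f l x. f \<in> Ar C \<Longrightarrow> x \<in> states (FOb F (Dom C f)) l \<Longrightarrow>
      h (Cod C f) l (k f l x) = k' f l (h (Dom C f) l x)"
  shows "nat_iso C (box_machines X) F G \<eta>"
  unfolding nat_iso_def nat_trans_def
proof (intro conjI ballI iso)
  show "\<eta> a \<in> hom (box_machines X) (FOb F a) (FOb G a)" if "a \<in> Ob C" for a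
    by (rule acts_hom[OF ob[OF that]])
next
  interpret category C by fact
  fix f assume f: "f \<in> Ar C"
  note ends = dom_ob[OF f] cod_ob[OF f]
  show "\<eta> (Cod C f) \<odot>\<^bsub>box_machines X\<^esub> FAr F f = FAr G f \<odot>\<^bsub>box_machines X\<^esub> \<eta> (Dom C f)"
    by (rule acts_eqI[OF acts_cmp[OF F[OF f] ob[OF ends(2)]] acts_cmp[OF ob[OF ends(1)] G[OF f]]])
      (rule nat[OF f])
qed

lemma is_functor_wired:
  assumes f: "diagram f"
  shows "is_functor (box_machines (wdom f)) (box_machines (wcod f)) (LAr mch f)"
proof (rule is_functor_machinesI[OF category_box_machines, where h = "\<lambda>u l x. Two (act u l (efst x)) (esnd x)"],
    goal_cases)
  case (1 S)
  then show ?case using wired_ob[OF f] by simp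
next
  case (2 u)
  then show ?case using acts_wired_arrow[OF f ar_box_machines] by simp
next
  case (3 S l x)
  then show ?case using acts_idn[of S "wdom f"] by (auto simp: states_wired acts_def)
next
  case (4 u v l x)
  have "acts (wdom f) (fst u) (snd (snd v)) (v \<odot>\<^bsub>box_machines (wdom f)\<^esub> u) (\<lambda>l x. act v l (act u l x))"
    using acts_cmp[OF ar_box_machines[OF 4(1)], of _ v "act v"] ar_box_machines[OF 4(2)] 4(3) by simp
  then show ?case using 4(4) by (auto simp: states_wired acts_def)
qed

lemma prod_cat_simps:
  "Ob (C \<times>\<^sub>C D) = Ob C \<times> Ob D" "Ar (C \<times>\<^sub>C D) = Ar C \<times> Ar D"
  "Dom (C \<times>\<^sub>C D) = map_prod (Dom C) (Dom D)" "Cod (C \<times>\<^sub>C D) = map_prod (Cod C) (Cod D)"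
  "Idn (C \<times>\<^sub>C D) = map_prod (Idn C) (Idn D)"
  "Cmp (C \<times>\<^sub>C D) (g, g') (f, f') = (g \<odot>\<^bsub>C\<^esub> f, g' \<odot>\<^bsub>D\<^esub> f')"
  by (simp_all add: prod_cat_def)

lemma one_cat_simps: "Ob one_cat = UNIV" "Ar one_cat = UNIV" "Dom one_cat e = ()" "Cod one_cat e = ()"
  by (simp_all add: one_cat_def)

lemma fctr_simps [simp]:
  "FOb id_fctr a = a" "FAr id_fctr f = f"
  "FOb (G \<circ>\<^sub>F F) a = FOb G (FOb F a)" "FAr (G \<circ>\<^sub>F F) f = FAr G (FAr F f)"
  "FOb (F \<times>\<^sub>F F') (a, b) = (FOb F a, FOb F' b)" "FAr (F \<times>\<^sub>F F') (f, g) = (FAr F f, FAr F' g)"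
  "FOb fst_fctr (a, b) = a" "FAr fst_fctr (f, g) = f" "FOb snd_fctr (a, b) = b" "FAr snd_fctr (f, g) = g"
  "FOb swap_fctr (a, b) = (b, a)" "FAr swap_fctr (f, g) = (g, f)"
  "FOb assoc_fctr ((a, b), c) = (a, b, c)" "FAr assoc_fctr ((f, g), h) = (f, g, h)"
  by (simp_all add: id_fctr_def comp_fctr_def prod_fctr_def fst_fctr_def snd_fctr_def swap_fctr_def assoc_fctr_def)

lemma is_functor_par:
  assumes X: "sheaf_box X" and Y: "sheaf_box Y"
  shows "is_functor (box_machines X \<times>\<^sub>C box_machines Y) (box_machines (box_sum X Y)) (LTen mch X Y)"
proof (rule is_functor_machinesI[OF category_prod_cat[OF category_box_machines category_box_machines],
      where h = "\<lambda>w l x. Two (act (fst w) l (efst x)) (act (snd w) l (esnd x))"],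
    unfold prod_cat_simps, goal_cases)
  case (1 P)
  then show ?case using par_machine_ob[OF X Y] by auto
next
  case (2 w)
  then obtain u v where "w = (u, v)" "u \<in> Ar (box_machines X)" "v \<in> Ar (box_machines Y)" by auto
  then show ?case using acts_par_arrow[OF X Y ar_box_machines ar_box_machines, of u v] by simp
next
  case (3 P l x)
  then show ?case
    using acts_idn[of "fst P" X] acts_idn[of "snd P" Y] by (auto simp: states_par_machine acts_def)
next
  case w: (4 w w' l x)
  obtain u v u' v' where uv: "w = (u, v)" "w' = (u', v')" by (metis prod.exhaust)
  have "acts X (fst u) (snd (snd u')) (u' \<odot>\<^bsub>box_machines X\<^esub> u) (\<lambda>l x. act u' l (act u l x))"
    using acts_cmp[OF ar_box_machines[of u X], of _ u' "act u'"] ar_box_machines[of u' X] w by (simp add: uv)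
  moreover have "acts Y (fst v) (snd (snd v')) (v' \<odot>\<^bsub>box_machines Y\<^esub> v) (\<lambda>l x. act v' l (act v l x))"
    using acts_cmp[OF ar_box_machines[of v Y], of _ v' "act v'"] ar_box_machines[of v' Y] w by (simp add: uv)
  ultimately show ?case
    using w(4) by (auto simp: uv prod_cat_simps states_par_machine acts_def)
qed

lemma is_functor_unit: "is_functor one_cat (box_machines unit_box) (LUnt mch)"
proof (rule is_functor_machinesI[OF category_one_cat, where h = "\<lambda>w l x. x"])
  show "acts unit_box (FOb (LUnt mch) (Dom one_cat f)) (FOb (LUnt mch) (Cod one_cat f)) (FAr (LUnt mch) f) (\<lambda>l x. x)" for f
    using acts_idn[OF unit_machine_ob] by simp
qed (simp_all add: unit_machine_ob)

lemma nat_iso_cmp: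
  assumes f: "diagram f" and g: "diagram g" and fg: "wcod f = wdom g"
  shows "nat_iso (box_machines (wdom f)) (box_machines (wcod g)) (LAr mch g \<circ>\<^sub>F LAr mch f)
    (LAr mch (wiring_comp g f)) (cmp_arrow g f)"
proof (rule nat_iso_machinesI[OF category_box_machines, where h = "\<lambda>_ l x. Two (efst (efst x)) (esnd x)"
      and k = "\<lambda>u l x. Two (Two (act u l (efst (efst x))) (esnd (efst x))) (esnd x)"
      and k' = "\<lambda>u l x. Two (act u l (efst x)) (esnd x)"], goal_cases)
  case (1 S)
  then show ?case using cmp_arrow(1)[OF f g fg] by simp
next
  case (2 S)
  then show ?case by (rule cmp_arrow(2)[OF f g fg])
next
  case (3 u)
  show ?case
    using acts_wired_arrow[OF g acts_wired_arrow[OF f ar_box_machines[OF 3], unfolded fg]] by simp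
next
  case (4 u)
  show ?case using acts_wired_arrow[OF is_wiring_comp[OF f g fg]] ar_box_machines[OF 4] by simp
qed simp

lemma nat_iso_idn:
  assumes X: "sheaf_box X"
  shows "nat_iso (box_machines X) (box_machines X) id_fctr (LAr mch (id_wiring X)) (idn_arrow X)"
proof (rule nat_iso_machinesI[OF category_box_machines, where h = "\<lambda>S l s. Two s (Fam (inp S l s))"
      and k = act and k' = "\<lambda>u l x. Two (act u l (efst x)) (esnd x)"], goal_cases)
  case (1 S)
  then show ?case using idn_arrow(1)[OF X] by simp
next
  case (2 S)
  then show ?case by (rule idn_arrow(2)[OF X])
next
  case (3 u)
  then show ?case using ar_box_machines by simp
next
  case (4 u)
  show ?case
    using acts_wired_arrow[OF is_wiring_id[OF X]] ar_box_machines[OF 4] by simp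
next
  case (5 u l x)
  then show ?case using acts_state(2)[OF ar_box_machines] by simp
qed

lemma prod_cases3':
  obtains u v w where "p = ((u, v), w)"
  by (cases p) auto

lemma nat_iso_interchange:
  assumes f: "diagram f" and g: "diagram g"
  shows "nat_iso (box_machines (wdom f) \<times>\<^sub>C box_machines (wdom g)) (box_machines (box_sum (wcod f) (wcod g)))
    (LTen mch (wcod f) (wcod g) \<circ>\<^sub>F (LAr mch f \<times>\<^sub>F LAr mch g))
    (LAr mch (wiring_sum f g) \<circ>\<^sub>F LTen mch (wdom f) (wdom g)) (LTenA mch f g)"
proof (rule nat_iso_machinesI[OF category_prod_cat[OF category_box_machines category_box_machines],
      where h = "\<lambda>_ l x. Two (Two (efst (efst x)) (efst (esnd x))) (Fam (osum (fam (esnd (efst x))) (fam (esnd (esnd x)))))"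
        and k = "\<lambda>(u, v) l x. Two (Two (act u l (efst (efst x))) (esnd (efst x))) (Two (act v l (efst (esnd x))) (esnd (esnd x)))"
        and k' = "\<lambda>(u, v) l x. Two (Two (act u l (efst (efst x))) (act v l (esnd (efst x)))) (esnd x)"], goal_cases)
  case (1 P)
  then show ?case using interchange_arrow(1)[OF f g, of "fst P" "snd P"] by (cases P) (simp add: prod_cat_simps)
next
  case (2 P)
  then show ?case using interchange_arrow(2)[OF f g, of "fst P" "snd P"] by (cases P) (simp add: prod_cat_simps)
next
  case (3 w)
  obtain u v where w: "w = (u, v)" by (cases w)
  with 3 have a: "u \<in> Ar (box_machines (wdom f))" "v \<in> Ar (box_machines (wdom g))"
    by (simp_all add: prod_cat_simps)
  have b: "sheaf_box (wcod f)" "sheaf_box (wcod g)" using f g by (auto simp: is_wiring_def)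
  show ?case
    using acts_par_arrow[OF b acts_wired_arrow[OF f ar_box_machines[OF a(1)]]
        acts_wired_arrow[OF g ar_box_machines[OF a(2)]]]
    by (simp add: w prod_cat_simps)
next
  case (4 w)
  obtain u v where w: "w = (u, v)" by (cases w)
  with 4 have a: "u \<in> Ar (box_machines (wdom f))" "v \<in> Ar (box_machines (wdom g))"
    by (simp_all add: prod_cat_simps)
  have b: "sheaf_box (wdom f)" "sheaf_box (wdom g)" using f g by (auto simp: is_wiring_def)
  show ?case
    using acts_wired_arrow[OF is_wiring_sum[OF f g], simplified, OF acts_par_arrow[OF b a[THEN ar_box_machines]]]
    by (simp add: w prod_cat_simps)
next
  case (5 w l x)
  then show ?case by (cases w) simp
qed

lemma nat_iso_assoc:
  assumes b: "sheaf_box X" "sheaf_box Y" "sheaf_box Z"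
  shows "nat_iso ((box_machines X \<times>\<^sub>C box_machines Y) \<times>\<^sub>C box_machines Z) (box_machines (box_sum X (box_sum Y Z)))
    (LAr mch (assoc_wiring X Y Z) \<circ>\<^sub>F LTen mch (box_sum X Y) Z \<circ>\<^sub>F (LTen mch X Y \<times>\<^sub>F id_fctr))
    (LTen mch X (box_sum Y Z) \<circ>\<^sub>F (id_fctr \<times>\<^sub>F LTen mch Y Z) \<circ>\<^sub>F assoc_fctr) (LAsc mch X Y Z)"
proof (rule nat_iso_machinesI[OF category_prod_cat[OF category_prod_cat[OF category_box_machines category_box_machines] category_box_machines],
      where h = "\<lambda>_ l x. Two (efst (efst (efst x))) (Two (esnd (efst (efst x))) (esnd (efst x)))"
        and k = "\<lambda>((u, v), w) l x. Two (Two (Two (act u l (efst (efst (efst x)))) (act v l (esnd (efst (efst x))))) (act w l (esnd (efst x)))) (esnd x)"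
        and k' = "\<lambda>((u, v), w) l x. Two (act u l (efst x)) (Two (act v l (efst (esnd x))) (act w l (esnd (esnd x))))"], goal_cases)
  case (1 P)
  then show ?case using assoc_arrow(1)[OF b, of "fst (fst P)" "snd (fst P)" "snd P"]
    by (cases P rule: prod_cases3') (simp add: prod_cat_simps)
next
  case (2 P)
  then show ?case using assoc_arrow(2)[OF b, of "fst (fst P)" "snd (fst P)" "snd P"]
    by (cases P rule: prod_cases3') (simp add: prod_cat_simps)
next
  case (3 p)
  obtain u v w where p: "p = ((u, v), w)" by (cases p rule: prod_cases3')
  with 3 have a: "u \<in> Ar (box_machines X)" "v \<in> Ar (box_machines Y)" "w \<in> Ar (box_machines Z)"
    by (simp_all add: prod_cat_simps)
  note a = a[THEN ar_box_machines]
  show ?case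
    using acts_wired_arrow[OF is_wiring_relabel[OF structural_relabelling(1)[OF b]], simplified,
        OF acts_par_arrow[OF is_box_box_sum[OF b(1,2)] b(3) acts_par_arrow[OF b(1,2) a(1,2)] a(3)]]
    by (simp add: p prod_cat_simps)
next
  case (4 p)
  obtain u v w where p: "p = ((u, v), w)" by (cases p rule: prod_cases3')
  with 4 have a: "u \<in> Ar (box_machines X)" "v \<in> Ar (box_machines Y)" "w \<in> Ar (box_machines Z)"
    by (simp_all add: prod_cat_simps)
  note a = a[THEN ar_box_machines]
  show ?case
    using acts_par_arrow[OF b(1) is_box_box_sum[OF b(2,3)] a(1) acts_par_arrow[OF b(2,3) a(2,3)]]
    by (simp add: p prod_cat_simps)
next
  case (5 p l x)
  then show ?case by (cases p rule: prod_cases3') simp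
qed

lemma nat_iso_left_unit:
  assumes b: "sheaf_box X"
  shows "nat_iso (one_cat \<times>\<^sub>C box_machines X) (box_machines X)
    (LAr mch (left_unit_wiring X) \<circ>\<^sub>F LTen mch unit_box X \<circ>\<^sub>F (LUnt mch \<times>\<^sub>F id_fctr)) snd_fctr (LLun mch X)"
proof (rule nat_iso_machinesI[OF category_prod_cat[OF category_one_cat category_box_machines],
      where h = "\<lambda>_ l x. esnd (efst x)" and k = "\<lambda>(_, u) l x. Two (Two (efst (efst x)) (act u l (esnd (efst x)))) (esnd x)"
        and k' = "\<lambda>(_, u). act u"], goal_cases)
  case (1 P)
  then show ?case using left_unit_arrow(1)[OF b, of "snd P"] by (cases P) (simp add: prod_cat_simps)
next
  case (2 P)
  then show ?case using left_unit_arrow(2)[OF b, of "snd P"] by (cases P) (simp add: prod_cat_simps)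
next
  case (3 p)
  obtain e u where p: "p = (e, u)" by (cases p)
  with 3 have a: "acts X (fst u) (snd (snd u)) u (act u)"
    by (simp add: prod_cat_simps ar_box_machines)
  show ?case
    using acts_wired_arrow[OF is_wiring_relabel[OF structural_relabelling(3)[OF b b b]], simplified,
        OF acts_par_arrow[OF is_box_empty b acts_idn[OF unit_machine_ob] a]]
    by (simp add: p prod_cat_simps)
next
  case (4 p)
  then show ?case using ar_box_machines[of "snd p" X] by (cases p) (simp add: prod_cat_simps)
next
  case (5 p l x)
  then show ?case by (cases p) simp
qed

lemma nat_iso_right_unit:
  assumes b: "sheaf_box X"
  shows "nat_iso (box_machines X \<times>\<^sub>C one_cat) (box_machines X)
    (LAr mch (right_unit_wiring X) \<circ>\<^sub>F LTen mch X unit_box \<circ>\<^sub>F (id_fctr \<times>\<^sub>F LUnt mch)) fst_fctr (LRun mch X)"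
proof (rule nat_iso_machinesI[OF category_prod_cat[OF category_box_machines category_one_cat],
      where h = "\<lambda>_ l x. efst (efst x)" and k = "\<lambda>(u, _) l x. Two (Two (act u l (efst (efst x))) (esnd (efst x))) (esnd x)"
        and k' = "\<lambda>(u, _). act u"], goal_cases)
  case (1 P)
  then show ?case using right_unit_arrow(1)[OF b, of "fst P"] by (cases P) (simp add: prod_cat_simps)
next
  case (2 P)
  then show ?case using right_unit_arrow(2)[OF b, of "fst P"] by (cases P) (simp add: prod_cat_simps)
next
  case (3 p)
  obtain e u where p: "p = (u, e)" by (cases p)
  with 3 have a: "acts X (fst u) (snd (snd u)) u (act u)"
    by (simp add: prod_cat_simps ar_box_machines)
  show ?case
    using acts_wired_arrow[OF is_wiring_relabel[OF structural_relabelling(5)[OF b b b]], simplified,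
        OF acts_par_arrow[OF b is_box_empty a acts_idn[OF unit_machine_ob]]]
    by (simp add: p prod_cat_simps)
next
  case (4 p)
  then show ?case using ar_box_machines[of "fst p" X] by (cases p) (simp add: prod_cat_simps)
next
  case (5 p l x)
  then show ?case by (cases p) simp
qed

lemma nat_iso_swap:
  assumes b: "sheaf_box X" "sheaf_box Y"
  shows "nat_iso (box_machines X \<times>\<^sub>C box_machines Y) (box_machines (box_sum Y X))
    (LAr mch (swap_wiring X Y) \<circ>\<^sub>F LTen mch X Y) (LTen mch Y X \<circ>\<^sub>F swap_fctr) (LBrd mch X Y)"
proof (rule nat_iso_machinesI[OF category_prod_cat[OF category_box_machines category_box_machines],
      where h = "\<lambda>_ l x. Two (esnd (efst x)) (efst (efst x))"
        and k = "\<lambda>(u, v) l x. Two (Two (act u l (efst (efst x))) (act v l (esnd (efst x)))) (esnd x)"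
        and k' = "\<lambda>(u, v) l x. Two (act v l (efst x)) (act u l (esnd x))"], goal_cases)
  case (1 P)
  then show ?case using swap_arrow(1)[OF b, of "fst P" "snd P"] by (cases P) (simp add: prod_cat_simps)
next
  case (2 P)
  then show ?case using swap_arrow(2)[OF b, of "fst P" "snd P"] by (cases P) (simp add: prod_cat_simps)
next
  case (3 w)
  obtain u v where w: "w = (u, v)" by (cases w)
  with 3 have a: "u \<in> Ar (box_machines X)" "v \<in> Ar (box_machines Y)"
    by (simp_all add: prod_cat_simps)
  show ?case
    using acts_wired_arrow[OF is_wiring_relabel[OF structural_relabelling(7)[OF b b(1)]], simplified,
        OF acts_par_arrow[OF b a[THEN ar_box_machines]]]
    by (simp add: w prod_cat_simps)
next
  case (4 w)
  obtain u v where w: "w = (u, v)" by (cases w)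
  with 4 have a: "u \<in> Ar (box_machines X)" "v \<in> Ar (box_machines Y)"
    by (simp_all add: prod_cat_simps)
  show ?case
    using acts_par_arrow[OF b(2,1) ar_box_machines[OF a(2)] ar_box_machines[OF a(1)]]
    by (simp add: w prod_cat_simps)
next
  case (5 w l x)
  then show ?case by (cases w) simp
qed

section \<open>Cells and their underlying functions\<close>

abbreviation (input) W :: "(('i, ('i, 'a) elt psh) box, ('i, ('i, 'a) elt psh) wiring) smcat" where
  "W \<equiv> wiring_cat int_sheaves"

text \<open>A cell over \<open>f\<close> from \<open>S\<close> to \<open>T\<close>, that is a triple \<open>(f, S, u)\<close> with \<open>u : f\<^sub>* S \<rightarrow> T\<close>, together with the
  function that \<open>u\<close> induces on states.\<close>

definition cell :: "(('i, ('i, 'a) elt psh) wiring, ('i, 'a) machine, ('i, 'a) machine_map) cell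
    \<Rightarrow> ('i, ('i, 'a) elt psh) wiring \<Rightarrow> ('i, 'a) machine \<Rightarrow> ('i, 'a) machine
    \<Rightarrow> (real \<Rightarrow> ('i, 'a) elt \<Rightarrow> ('i, 'a) elt) \<Rightarrow> bool" where
  "cell c f S T h \<longleftrightarrow> diagram f \<and> machine (wdom f) S
    \<and> (\<exists>u. c = (f, S, u) \<and> acts (wcod f) (wired f S) T u h)"

lemma cell_eqI:
  assumes "cell c f S T h" "cell d g S T k" "f = g"
    "\<And>l s y. s \<in> states S l \<Longrightarrow> y \<in> sig (Inp (wcod g)) l \<Longrightarrow> h l (Two s (Fam y)) = k l (Two s (Fam y))"
  shows "c = d"
proof -
  obtain u v where uv: "c = (g, S, u)" "acts (wcod g) (wired g S) T u h"
    "d = (g, S, v)" "acts (wcod g) (wired g S) T v k"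
    using assms(1-3) by (auto simp: cell_def)
  have "u = v"
    by (rule acts_eqI[OF uv(2,4)]) (use assms(4) in \<open>auto simp: states_wired\<close>)
  then show ?thesis by (simp add: uv)
qed

text \<open>Pasting inserts the inverse of \<open>cmp_arrow\<close>, so the middle signal has to be
  reconstructed before the first cell can be applied. The structural cells ignore that signal, which
  is why it disappears from all coherence equations except those that involve \<open>push_cell\<close>.\<close>

lemma cell_paste:
  assumes d: "cell d g T R k" and c: "cell c f S T h" and fg: "wcod f = wdom g"
  shows "cell (paste W mch d c) (wiring_comp g f) S R
    (\<lambda>l x. k l (Two (h l (Two (efst x) (Fam (wire g (wire_out f (out S l (efst x))) (fam (esnd x)))))) (esnd x)))"
proof -
  obtain v u where c: "c = (f, S, u)" "diagram f" "machine (wdom f) S"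
      "acts (wcod f) (wired f S) T u h"
    and d: "d = (g, T, v)" "diagram g" "acts (wcod g) (wired g T) R v k"
    using c d by (auto simp: cell_def)
  have "acts (wcod g) (wired g (wired f S)) (wired g T) (wired_arrow g u) (\<lambda>l x. Two (h l (efst x)) (esnd x))"
    by (rule acts_wired_arrow[OF d(2)]) (use c(4) fg in simp)
  from acts_cmp[OF acts_cmp[OF cmp_arrow(3)[OF c(2) d(2) fg c(3)] this] d(3)]
  show ?thesis
    using c(2,3) d(2) is_wiring_comp[OF c(2) d(2) fg] by (simp add: cell_def paste_def c(1) d(1) Let_def)
qed

text \<open>Tensoring inserts the inverse of \<open>interchange_arrow\<close>, which distributes the outer signal to
  the two machines.\<close>

lemma cell_juxt:
  assumes c: "cell c f S S' h" and d: "cell d g T T' k"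
  shows "cell (juxt W mch c d) (wiring_sum f g) (par_machine (wdom f) (wdom g) S T)
    (par_machine (wcod f) (wcod g) S' T')
    (\<lambda>l x. Two (h l (Two (efst (efst x)) (Fam (fam (esnd x) \<circ> InL)))) (k l (Two (esnd (efst x)) (Fam (fam (esnd x) \<circ> InR)))))"
proof -
  obtain v u where c: "c = (f, S, u)" "diagram f" "machine (wdom f) S"
      "acts (wcod f) (wired f S) S' u h"
    and d: "d = (g, T, v)" "diagram g" "machine (wdom g) T"
      "acts (wcod g) (wired g T) T' v k"
    using c d by (auto simp: cell_def)
  have b: "sheaf_box (wdom f)" "sheaf_box (wcod f)"
    "sheaf_box (wdom g)" "sheaf_box (wcod g)"
    using c(2) d(2) by (auto simp: is_wiring_def)
  from acts_cmp[OF interchange_arrow(3)[OF c(2) d(2) c(3) d(3)] acts_par_arrow[OF b(2,4) c(4) d(4)]]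
  show ?thesis
    using is_wiring_sum[OF c(2) d(2)] par_machine_ob[OF b(1,3) c(3) d(3)]
    by (simp add: cell_def juxt_def c(1) d(1) Let_def)
qed

lemma cell_id:
  assumes "sheaf_box X" "machine X S"
  shows "cell (id_cell W mch (X, S)) (id_wiring X) S S (\<lambda>l x. efst x)"
  using idn_arrow(3)[OF assms] assms is_wiring_id[OF assms(1)]
  by (simp add: cell_def id_cell_def)

lemma cell_push:
  assumes "diagram f" "machine (wdom f) S"
  shows "cell (push_cell W mch f S) f S (wired f S) (\<lambda>l x. x)"
  using acts_idn[OF wired_ob[OF assms]] assms by (simp add: cell_def push_cell_def)

lemma cell_assoc:
  assumes "sheaf_box X" "sheaf_box Y" "sheaf_box Z"
    and "machine X S" "machine Y T" "machine Z U"
  shows "cell (asc_cell W mch (X, S) (Y, T) (Z, U)) (assoc_wiring X Y Z)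
    (par_machine (box_sum X Y) Z (par_machine X Y S T) U) (par_machine X (box_sum Y Z) S (par_machine Y Z T U))
    (\<lambda>l x. Two (efst (efst (efst x))) (Two (esnd (efst (efst x))) (esnd (efst x))))"
  using assoc_arrow(1)[OF assms] assms is_wiring_relabel[OF structural_relabelling(1)[OF assms(1-3)]]
  by (simp add: cell_def asc_cell_def over_ten_def par_machine_ob is_box_box_sum)

lemma cell_left_unit:
  assumes "sheaf_box X" "machine X S"
  shows "cell (lun_cell W mch (X, S)) (left_unit_wiring X) (par_machine unit_box X unit_machine S) S
    (\<lambda>l x. esnd (efst x))"
  using left_unit_arrow(1)[OF assms] assms is_wiring_relabel[OF structural_relabelling(3)[OF assms(1,1,1)]]
  by (simp add: cell_def lun_cell_def over_ten_def over_unt_def par_machine_ob is_box_empty unit_machine_ob)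

lemma cell_right_unit:
  assumes "sheaf_box X" "machine X S"
  shows "cell (run_cell W mch (X, S)) (right_unit_wiring X) (par_machine X unit_box S unit_machine) S
    (\<lambda>l x. efst (efst x))"
  using right_unit_arrow(1)[OF assms] assms is_wiring_relabel[OF structural_relabelling(5)[OF assms(1,1,1)]]
  by (simp add: cell_def run_cell_def over_ten_def over_unt_def par_machine_ob is_box_empty unit_machine_ob)

lemma cell_swap:
  assumes "sheaf_box X" "sheaf_box Y"
    and "machine X S" "machine Y T"
  shows "cell (brd_cell W mch (X, S) (Y, T)) (swap_wiring X Y) (par_machine X Y S T) (par_machine Y X T S)
    (\<lambda>l x. Two (esnd (efst x)) (efst (efst x)))"
  using swap_arrow(1)[OF assms] assms is_wiring_relabel[OF structural_relabelling(7)[OF assms(1,2,1)]]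
  by (simp add: cell_def brd_cell_def over_ten_def par_machine_ob)

section \<open>Coherence\<close>

lemmas W_monoidal = symmetric_monoidal_wiring_cat[of int_sheaves]
lemmas W_category = category_wiring_cat[of int_sheaves]

text \<open>Both sides send \<open>(((s, x), y), z)\<close> to \<open>(s, z)\<close>.\<close>

lemma cmp_arrow_assoc:
  assumes f: "diagram f" and g: "diagram g" and h: "diagram h"
    and fg: "wcod f = wdom g" and gh: "wcod g = wdom h" and S: "machine (wdom f) S"
  shows "cmp_arrow h (wiring_comp g f) S \<odot>\<^bsub>box_machines (wcod h)\<^esub> wired_arrow h (cmp_arrow g f S)
    = cmp_arrow (wiring_comp h g) f S \<odot>\<^bsub>box_machines (wcod h)\<^esub> cmp_arrow h g (wired f S)"
proof -
  note gf = is_wiring_comp[OF f g fg] and hg = is_wiring_comp[OF g h gh]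
  have assoc: "wiring_comp (wiring_comp h g) f = wiring_comp h (wiring_comp g f)"
    using category.cmp_assoc[OF W_category, of f g h] f g h fg gh by simp
  note lhs = acts_cmp[OF acts_wired_arrow[OF h cmp_arrow(1)[OF f g fg S, unfolded gh]]
      cmp_arrow(1)[OF gf h, simplified, OF gh S]]
  note rhs = acts_cmp[OF cmp_arrow(1)[OF g h gh wired_ob[OF f S, unfolded fg]]
      cmp_arrow(1)[OF f hg _ S, simplified, OF fg, unfolded assoc]]
  show ?thesis by (rule acts_eqI[OF lhs rhs]) simp
qed

lemma cmp_arrow_idn_right:
  assumes f: "diagram f" and S: "machine (wdom f) S"
  shows "cmp_arrow f (id_wiring (wdom f)) S \<odot>\<^bsub>box_machines (wcod f)\<^esub>
      wired_arrow f (idn_arrow (wdom f) S) = Idn (box_machines (wcod f)) (wired f S)"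
proof -
  have X: "sheaf_box (wdom f)" using f by (simp add: is_wiring_def)
  have i: "wiring_comp f (id_wiring (wdom f)) = f"
    using category.cmp_idn_right[OF W_category, of f] f by simp
  note lhs = acts_cmp[OF acts_wired_arrow[OF f idn_arrow(1)[OF X S]]
      cmp_arrow(1)[OF is_wiring_id[OF X] f, simplified, OF S, unfolded i]]
  show ?thesis
    by (rule acts_eqI[OF lhs acts_idn[OF wired_ob[OF f S]]]) (auto simp: states_wired)
qed

lemma cmp_arrow_idn_left:
  assumes f: "diagram f" and S: "machine (wdom f) S"
  shows "cmp_arrow (id_wiring (wcod f)) f S \<odot>\<^bsub>box_machines (wcod f)\<^esub>
      idn_arrow (wcod f) (wired f S) = Idn (box_machines (wcod f)) (wired f S)"
proof -
  have Y: "sheaf_box (wcod f)" using f by (simp add: is_wiring_def)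
  have i: "wiring_comp (id_wiring (wcod f)) f = f"
    using category.cmp_idn_left[OF W_category, of f] f by simp
  note lhs = acts_cmp[OF idn_arrow(1)[OF Y wired_ob[OF f S]]
      cmp_arrow(1)[OF f is_wiring_id[OF Y] _ S, simplified, unfolded i]]
  show ?thesis
  proof (rule acts_eqI[OF lhs acts_idn[OF wired_ob[OF f S]]])
    fix l x assume x: "x \<in> states (wired f S) l"
    then obtain s y where "x = Two s (Fam y)" by (auto simp: states_wired)
    then show "Two (efst (efst (Two x (Fam (inp (wired f S) l x))))) (esnd (Two x (Fam (inp (wired f S) l x)))) = x"
      using x by simp
  qed
qed

text \<open>Both sides forget the two middle signals and pair up the rest.\<close>

lemma interchange_arrow_cmp:
  assumes f: "diagram f" and f': "diagram f'" and ff: "wcod f = wdom f'"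
    and g: "diagram g" and g': "diagram g'" and gg: "wcod g = wdom g'"
    and S: "machine (wdom f) S" and T: "machine (wdom g) T"
  shows "interchange_arrow (wiring_comp f' f) (wiring_comp g' g) S T \<odot>\<^bsub>box_machines (box_sum (wcod f') (wcod g'))\<^esub>
      par_arrow (wcod f') (wcod g') (cmp_arrow f' f S) (cmp_arrow g' g T)
    = cmp_arrow (wiring_sum f' g') (wiring_sum f g) (par_machine (wdom f) (wdom g) S T)
      \<odot>\<^bsub>box_machines (box_sum (wcod f') (wcod g'))\<^esub>
        (wired_arrow (wiring_sum f' g') (interchange_arrow f g S T)
        \<odot>\<^bsub>box_machines (box_sum (wcod f') (wcod g'))\<^esub> interchange_arrow f' g' (wired f S) (wired g T))"
proof -
  note f'f = is_wiring_comp[OF f f' ff] and g'g = is_wiring_comp[OF g g' gg]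
  note fg = is_wiring_sum[OF f g] and fg' = is_wiring_sum[OF f' g']
  have b: "sheaf_box (wcod f')" "sheaf_box (wcod g')" "sheaf_box (wdom f)" "sheaf_box (wdom g)"
    using f g f' g' by (auto simp: is_wiring_def)
  have i: "wiring_sum (wiring_comp f' f) (wiring_comp g' g) = wiring_comp (wiring_sum f' g') (wiring_sum f g)"
    using symmetric_monoidal_category.ten_cmp[OF W_monoidal, of f f' g g'] f f' g g' ff gg by simp
  note lhs = acts_cmp[OF acts_par_arrow[OF b(1,2) cmp_arrow(1)[OF f f' ff S] cmp_arrow(1)[OF g g' gg T]]
      interchange_arrow(1)[OF f'f g'g, simplified, OF S T, unfolded i]]
  note rhs = acts_cmp[OF acts_cmp[OF
        interchange_arrow(1)[OF f' g' wired_ob[OF f S, unfolded ff] wired_ob[OF g T, unfolded gg]]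
        acts_wired_arrow[OF fg', simplified, OF interchange_arrow(1)[OF f g S T, unfolded ff gg]]]
      cmp_arrow(1)[OF fg fg', simplified, OF _ par_machine_ob[OF b(3,4) S T], simplified ff gg, simplified]]
  show ?thesis by (rule acts_eqI[OF lhs rhs]) simp
qed

lemma interchange_arrow_idn:
  assumes X: "sheaf_box X" and Y: "sheaf_box Y"
    and S: "machine X S" and T: "machine Y T"
  shows "interchange_arrow (id_wiring X) (id_wiring Y) S T \<odot>\<^bsub>box_machines (box_sum X Y)\<^esub>
      par_arrow X Y (idn_arrow X S) (idn_arrow Y T) = idn_arrow (box_sum X Y) (par_machine X Y S T)"
proof -
  have i: "wiring_sum (id_wiring X) (id_wiring Y) = id_wiring (box_sum X Y)"
    using symmetric_monoidal_category.ten_idn[OF W_monoidal, of X Y] X Y by simp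
  note r = is_wiring_id[OF X] is_wiring_id[OF Y]
  note lhs = acts_cmp[OF acts_par_arrow[OF X Y idn_arrow(1)[OF X S] idn_arrow(1)[OF Y T]]
      interchange_arrow(1)[OF r, simplified, OF S T, unfolded i]]
  show ?thesis
    by (rule acts_eqI[OF lhs idn_arrow(1)[OF is_box_box_sum[OF X Y] par_machine_ob[OF X Y S T]]])
      (auto simp: states_par_machine)
qed

text \<open>In the modification axioms the outer signal survives, because \<open>push_cell\<close> keeps it. One side splits it
  after the associator has renamed its wires, the other splits it directly; \<open>wire_assoc\<close> and its
  analogues show that the parts are the same.\<close>

lemma assoc_modification:
  assumes f: "diagram f" and g: "diagram g" and h: "diagram h"
    and S: "machine (wdom f) S" and T: "machine (wdom g) T"
    and U: "machine (wdom h) U"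
  shows "paste W mch (asc_cell W mch (wcod f, wired f S) (wcod g, wired g T) (wcod h, wired h U))
      (juxt W mch (juxt W mch (push_cell W mch f S) (push_cell W mch g T)) (push_cell W mch h U))
    = paste W mch (juxt W mch (push_cell W mch f S) (juxt W mch (push_cell W mch g T) (push_cell W mch h U)))
      (asc_cell W mch (wdom f, S) (wdom g, T) (wdom h, U))"
proof -
  have b: "sheaf_box (wdom f)" "sheaf_box (wdom g)" "sheaf_box (wdom h)"
    "sheaf_box (wcod f)" "sheaf_box (wcod g)" "sheaf_box (wcod h)"
    using f g h by (auto simp: is_wiring_def)
  note p = cell_push[OF f S] cell_push[OF g T] cell_push[OF h U]
  note m = wired_ob[OF f S] wired_ob[OF g T] wired_ob[OF h U]
  note c1 = cell_paste[OF cell_assoc[OF b(4-6) m] cell_juxt[OF cell_juxt[OF p(1,2)] p(3), simplified], simplified]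
  note c2 = cell_paste[OF cell_juxt[OF p(1) cell_juxt[OF p(2,3)], simplified] cell_assoc[OF b(1-3) S T U], simplified]
  show ?thesis
  proof (rule cell_eqI[OF c1 c2])
    show "wiring_comp (assoc_wiring (wcod f) (wcod g) (wcod h)) (wiring_sum (wiring_sum f g) h)
      = wiring_comp (wiring_sum f (wiring_sum g h)) (assoc_wiring (wdom f) (wdom g) (wdom h))"
      using symmetric_monoidal_category.asc_nat[OF W_monoidal, of f _ _ g _ _ h] f g h
      by (simp add: hom_wiring_cat)
  qed (simp add: wire_assoc[of _ "wcod f" "wcod g" "wcod h"] comp_assoc)
qed

lemma left_unit_modification:
  assumes f: "diagram f" and S: "machine (wdom f) S"
  shows "paste W mch (lun_cell W mch (wcod f, wired f S))
      (juxt W mch (id_cell W mch (unit_box, unit_machine)) (push_cell W mch f S))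
    = paste W mch (push_cell W mch f S) (lun_cell W mch (wdom f, S))"
proof -
  have b: "sheaf_box (wdom f)" "sheaf_box (wcod f)"
    using f by (auto simp: is_wiring_def)
  note p = cell_push[OF f S] and i = cell_id[OF is_box_empty unit_machine_ob]
  note c1 = cell_paste[OF cell_left_unit[OF b(2) wired_ob[OF f S]] cell_juxt[OF i p, simplified], simplified]
  note c2 = cell_paste[OF p cell_left_unit[OF b(1) S], simplified]
  show ?thesis
  proof (rule cell_eqI[OF c1 c2])
    show "wiring_comp (left_unit_wiring (wcod f)) (wiring_sum (id_wiring unit_box) f)
      = wiring_comp f (left_unit_wiring (wdom f))"
      using symmetric_monoidal_category.lun_nat[OF W_monoidal, of f] f by (simp add: hom_wiring_cat)
  qed (simp add: wire_left_unit)
qed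

lemma right_unit_modification:
  assumes f: "diagram f" and S: "machine (wdom f) S"
  shows "paste W mch (run_cell W mch (wcod f, wired f S))
      (juxt W mch (push_cell W mch f S) (id_cell W mch (unit_box, unit_machine)))
    = paste W mch (push_cell W mch f S) (run_cell W mch (wdom f, S))"
proof -
  have b: "sheaf_box (wdom f)" "sheaf_box (wcod f)"
    using f by (auto simp: is_wiring_def)
  note p = cell_push[OF f S] and i = cell_id[OF is_box_empty unit_machine_ob]
  note c1 = cell_paste[OF cell_right_unit[OF b(2) wired_ob[OF f S]] cell_juxt[OF p i, simplified], simplified]
  note c2 = cell_paste[OF p cell_right_unit[OF b(1) S], simplified]
  show ?thesis
  proof (rule cell_eqI[OF c1 c2])
    show "wiring_comp (right_unit_wiring (wcod f)) (wiring_sum f (id_wiring unit_box))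
      = wiring_comp f (right_unit_wiring (wdom f))"
      using symmetric_monoidal_category.run_nat[OF W_monoidal, of f] f by (simp add: hom_wiring_cat)
  qed (simp add: wire_right_unit)
qed

lemma swap_modification:
  assumes f: "diagram f" and g: "diagram g"
    and S: "machine (wdom f) S" and T: "machine (wdom g) T"
  shows "paste W mch (brd_cell W mch (wcod f, wired f S) (wcod g, wired g T))
      (juxt W mch (push_cell W mch f S) (push_cell W mch g T))
    = paste W mch (juxt W mch (push_cell W mch g T) (push_cell W mch f S))
      (brd_cell W mch (wdom f, S) (wdom g, T))"
proof -
  have b: "sheaf_box (wdom f)" "sheaf_box (wdom g)"
    "sheaf_box (wcod f)" "sheaf_box (wcod g)"
    using f g by (auto simp: is_wiring_def)
  note p = cell_push[OF f S] cell_push[OF g T]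
  note m = wired_ob[OF f S] wired_ob[OF g T]
  note c1 = cell_paste[OF cell_swap[OF b(3,4) m] cell_juxt[OF p], simplified]
  note c2 = cell_paste[OF cell_juxt[OF p(2,1)] cell_swap[OF b(1,2) S T], simplified]
  show ?thesis
  proof (rule cell_eqI[OF c1 c2])
    show "wiring_comp (swap_wiring (wcod f) (wcod g)) (wiring_sum f g)
      = wiring_comp (wiring_sum g f) (swap_wiring (wdom f) (wdom g))"
      using symmetric_monoidal_category.brd_nat[OF W_monoidal, of f _ _ g] f g
      by (simp add: hom_wiring_cat)
  qed (simp add: wire_swap[of _ "wcod g" "wcod f"])
qed

text \<open>In the remaining axioms no signal is left: both sides only rebracket, permute or drop the states
  of the machines involved.\<close>

lemma pentagon_cells:
  assumes b: "sheaf_box X" "sheaf_box Y" "sheaf_box Z" "sheaf_box V"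
    and m: "machine X S" "machine Y T" "machine Z U" "machine V R"
  shows "paste W mch (asc_cell W mch (X, S) (Y, T) (box_sum Z V, par_machine Z V U R))
      (asc_cell W mch (box_sum X Y, par_machine X Y S T) (Z, U) (V, R))
    = paste W mch (juxt W mch (id_cell W mch (X, S)) (asc_cell W mch (Y, T) (Z, U) (V, R)))
      (paste W mch (asc_cell W mch (X, S) (box_sum Y Z, par_machine Y Z T U) (V, R))
        (juxt W mch (asc_cell W mch (X, S) (Y, T) (Z, U)) (id_cell W mch (V, R))))"
proof -
  note bb = is_box_box_sum[OF b(1,2)] is_box_box_sum[OF b(2,3)] is_box_box_sum[OF b(3,4)]
  note mm = par_machine_ob[OF b(1,2) m(1,2)] par_machine_ob[OF b(2,3) m(2,3)] par_machine_ob[OF b(3,4) m(3,4)]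
  note c1 = cell_paste[OF cell_assoc[OF b(1,2) bb(3) m(1,2) mm(3)] cell_assoc[OF bb(1) b(3,4) mm(1) m(3,4)], simplified]
  note c2 = cell_paste[OF cell_juxt[OF cell_id[OF b(1) m(1)] cell_assoc[OF b(2-4) m(2-4)], simplified]
      cell_paste[OF cell_assoc[OF b(1) bb(2) b(4) m(1) mm(2) m(4)]
        cell_juxt[OF cell_assoc[OF b(1-3) m(1-3)] cell_id[OF b(4) m(4)], simplified], simplified], simplified]
  show ?thesis
  proof (rule cell_eqI[OF c1 c2])
    show "wiring_comp (assoc_wiring X Y (box_sum Z V)) (assoc_wiring (box_sum X Y) Z V) =
      wiring_comp (wiring_sum (id_wiring X) (assoc_wiring Y Z V))
        (wiring_comp (assoc_wiring X (box_sum Y Z) V) (wiring_sum (assoc_wiring X Y Z) (id_wiring V)))"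
      using symmetric_monoidal_category.pentagon[OF W_monoidal, of X Y Z V] b by simp
  qed simp
qed

lemma triangle_cells:
  assumes b: "sheaf_box X" "sheaf_box Y"
    and m: "machine X S" "machine Y T"
  shows "juxt W mch (run_cell W mch (X, S)) (id_cell W mch (Y, T))
    = paste W mch (juxt W mch (id_cell W mch (X, S)) (lun_cell W mch (Y, T)))
      (asc_cell W mch (X, S) (unit_box, unit_machine) (Y, T))"
proof -
  note c1 = cell_juxt[OF cell_right_unit[OF b(1) m(1)] cell_id[OF b(2) m(2)], simplified]
  note c2 = cell_paste[OF cell_juxt[OF cell_id[OF b(1) m(1)] cell_left_unit[OF b(2) m(2)], simplified]
      cell_assoc[OF b(1) is_box_empty b(2) m(1) unit_machine_ob m(2)], simplified]
  show ?thesis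
  proof (rule cell_eqI[OF c1 c2])
    show "wiring_sum (right_unit_wiring X) (id_wiring Y) =
      wiring_comp (wiring_sum (id_wiring X) (left_unit_wiring Y)) (assoc_wiring X unit_box Y)"
      using symmetric_monoidal_category.triangle[OF W_monoidal, of X Y] b by simp
  qed simp
qed

lemma hexagon_cells:
  assumes b: "sheaf_box X" "sheaf_box Y" "sheaf_box Z"
    and m: "machine X S" "machine Y T" "machine Z U"
  shows "paste W mch (asc_cell W mch (Y, T) (Z, U) (X, S))
      (paste W mch (brd_cell W mch (X, S) (box_sum Y Z, par_machine Y Z T U))
        (asc_cell W mch (X, S) (Y, T) (Z, U)))
    = paste W mch (juxt W mch (id_cell W mch (Y, T)) (brd_cell W mch (X, S) (Z, U)))
      (paste W mch (asc_cell W mch (Y, T) (X, S) (Z, U))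
        (juxt W mch (brd_cell W mch (X, S) (Y, T)) (id_cell W mch (Z, U))))"
proof -
  note bb = is_box_box_sum[OF b(2,3)] and mm = par_machine_ob[OF b(2,3) m(2,3)]
  note c1 = cell_paste[OF cell_assoc[OF b(2,3,1) m(2,3,1)]
      cell_paste[OF cell_swap[OF b(1) bb m(1) mm] cell_assoc[OF b m], simplified], simplified]
  note c2 = cell_paste[OF cell_juxt[OF cell_id[OF b(2) m(2)] cell_swap[OF b(1,3) m(1,3)], simplified]
      cell_paste[OF cell_assoc[OF b(2,1,3) m(2,1,3)]
        cell_juxt[OF cell_swap[OF b(1,2) m(1,2)] cell_id[OF b(3) m(3)], simplified], simplified], simplified]
  show ?thesis
  proof (rule cell_eqI[OF c1 c2])
    show "wiring_comp (assoc_wiring Y Z X) (wiring_comp (swap_wiring X (box_sum Y Z)) (assoc_wiring X Y Z)) =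
      wiring_comp (wiring_sum (id_wiring Y) (swap_wiring X Z))
        (wiring_comp (assoc_wiring Y X Z) (wiring_sum (swap_wiring X Y) (id_wiring Z)))"
      using symmetric_monoidal_category.hexagon[OF W_monoidal, of X Y Z] b by simp
  qed simp
qed

lemma symmetry_cells:
  assumes b: "sheaf_box X" "sheaf_box Y"
    and m: "machine X S" "machine Y T"
  shows "paste W mch (brd_cell W mch (Y, T) (X, S)) (brd_cell W mch (X, S) (Y, T))
    = id_cell W mch (box_sum X Y, par_machine X Y S T)"
proof -
  note c1 = cell_paste[OF cell_swap[OF b(2,1) m(2,1)] cell_swap[OF b m], simplified]
  note c2 = cell_id[OF is_box_box_sum[OF b] par_machine_ob[OF b m]]
  show ?thesis
  proof (rule cell_eqI[OF c1 c2])
    show "wiring_comp (swap_wiring Y X) (swap_wiring X Y) = id_wiring (box_sum X Y)"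
      using symmetric_monoidal_category.symmetry[OF W_monoidal, of X Y] b by simp
  qed (auto simp: states_par_machine)
qed

theorem proposition4p1p3:
  shows "\<exists>Mch :: (('i, ('i, 'a) elt psh) box, ('i, ('i, 'a) elt psh) wiring,
                 ('i, 'a) machine, ('i, 'a) machine_map) lax_data.
    wiring_algebra int_sheaves Mch
    \<and> (\<forall>X\<in>Ob (wiring_cat int_sheaves). LOb Mch X = box_machines X)"
proof (intro exI conjI ballI)
  show "wiring_algebra int_sheaves (mch :: (('i, ('i, 'a) elt psh) box, ('i, ('i, 'a) elt psh) wiring,
                 ('i, 'a) machine, ('i, 'a) machine_map) lax_data)"
    unfolding wiring_algebra_def
  proof (intro symmetric_lax_monoidal_pseudofunctor.intro symmetric_monoidal_wiring_cat
      symmetric_lax_monoidal_pseudofunctor_axioms.intro, goal_cases)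
    \<comment> \<open>the pseudofunctor: fibres, transition functors, their composition and identity constraints\<close>
    case 1 show ?case by (simp add: category_box_machines)
  next
    case (2 f X Y)
    then show ?case using is_functor_wired[of f]
      by (auto simp: hom_wiring_cat)
  next
    case (3 f X Y g Z)
    then show ?case using nat_iso_cmp[of f g]
      by (auto simp: hom_wiring_cat)
  next
    case (4 X)
    then show ?case using nat_iso_idn[of X]
      by simp
  next
    case (5 f X Y g Z h V S)
    then show ?case using cmp_arrow_assoc[of f g h S]
      by (auto simp: hom_wiring_cat)
  next
    case (6 f X Y S)
    then show ?case using cmp_arrow_idn_right[of f S]
      by (auto simp: hom_wiring_cat)
  next
    case (7 f X Y S)
    then show ?case using cmp_arrow_idn_left[of f S]
      by (auto simp: hom_wiring_cat)
  next
    \<comment> \<open>the laxator, its pseudonaturality constraints, and the unit\<close>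
    case (8 X Y)
    then show ?case using is_functor_par[of X Y]
      by simp
  next
    case (9 f X X' g Y Y')
    then show ?case using nat_iso_interchange[of f g]
      by (auto simp: hom_wiring_cat)
  next
    case (10 f X X' f' X'' g Y Y' g' Y'' S T)
    then show ?case using interchange_arrow_cmp[of f f' g g' S T]
      by (auto simp: hom_wiring_cat)
  next
    case (11 X Y S T)
    then show ?case using interchange_arrow_idn[of X Y S T]
      by simp
  next
    case 12
    then show ?case using is_functor_unit
      by simp
  next
    \<comment> \<open>associativity, unit and symmetry isomorphisms\<close>
    case (13 X Y Z)
    then show ?case using nat_iso_assoc[of X Y Z]
      by simp
  next
    case (14 X)
    then show ?case using nat_iso_left_unit[of X]
      by simp
  next
    case (15 X)
    then show ?case using nat_iso_right_unit[of X]
      by simp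
  next
    case (16 X Y)
    then show ?case using nat_iso_swap[of X Y]
      by simp
  next
    \<comment> \<open>these are modifications\<close>
    case (17 f X X' g Y Y' h Z Z' S T U)
    then show ?case using assoc_modification[of f g h S T U]
      by (auto simp: hom_wiring_cat push_def)
  next
    case (18 f X X' S)
    then show ?case using left_unit_modification[of f S]
      by (auto simp: hom_wiring_cat push_def over_unt_def)
  next
    case (19 f X X' S)
    then show ?case using right_unit_modification[of f S]
      by (auto simp: hom_wiring_cat push_def over_unt_def)
  next
    case (20 f X X' g Y Y' S T)
    then show ?case using swap_modification[of f g S T]
      by (auto simp: hom_wiring_cat push_def)
  next
    \<comment> \<open>coherence axioms; the objects come paired with their boxes\<close>
    case (21 P Q R K)
    then show ?case using pentagon_cells[of "fst P" "fst Q" "fst R" "fst K" "snd P" "snd Q" "snd R" "snd K"]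
      by (cases P; cases Q; cases R; cases K) (simp add: over_def over_ten_def)
  next
    case (22 P Q)
    then show ?case using triangle_cells[of "fst P" "fst Q" "snd P" "snd Q"]
      by (cases P; cases Q) (simp add: over_def over_unt_def)
  next
    case (23 P Q R)
    then show ?case using hexagon_cells[of "fst P" "fst Q" "fst R" "snd P" "snd Q" "snd R"]
      by (cases P; cases Q; cases R) (simp add: over_def over_ten_def)
  next
    case (24 P Q)
    then show ?case using symmetry_cells[of "fst P" "fst Q" "snd P" "snd Q"]
      by (cases P; cases Q) (simp add: over_def over_ten_def)
  qed
qed simp

end
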